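(* Let $\mathbb{X}=[X_1\rightrightarrows X_0]$ be a Lie groupoid equipped with an Ehresmann connection $\mathbb{H}$ and let $\pi\colon P\to M$ be a principal $\mathbb{X}$-bundle with anchor $a$. Then the map $\xi=da\colon TP\to a^*TX_0$, the quasi actions $$\tau^0_g(u)=u.(di)_{g^{-1}}\sigma_{g^{-1}}(da)_p(u)\ \ (u\in T_pP),\qquad \tau^1_g(v)=\lambda^1_{g^{-1}}(v)\ \ (v\in T_{a(p)}X_0),\qquad a(p)=t(g),$$ and the homotopy map $\Upsilon(g,h)\colon T_{a(p)}X_0\to T_{pgh}P$, $\Upsilon(g,h)(v)=0_p.\,l_{gh}\bigl(K(h^{-1},g^{-1})(v)\bigr)$ (for $a(p)=t(g)$, $s(g)=t(h)$), make the graded vector bundle $TP\oplus a^*TX_0\to P$ into a quasi equivariant $\mathbb{X}$-bundle up to homotopy.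
   Context: Lie groupoid $\mathbb{X}=[X_1\rightrightarrows X_0]$: source $s$, target $t$ are submersions, $gh$ is defined when $s(g)=t(h)$, units $1_x$, inversion $i$. For tangent vectors, $\beta.\alpha:=dm_{(g,h)}(\beta,\alpha)$, $m$ the composition. Right action on $P$ with anchor $a\colon P\to X_0$: $pg$ is defined when $a(p)=t(g)$, $a(pg)=s(g)$, $(pg)h=p(gh)$, $p1_{a(p)}=p$; for $(u,\beta)$ tangent to $P\times_{a,X_0,t}X_1$ at $(p,g)$, $u.\beta\in T_{pg}P$ is its image under the differential of the action. Principal $\mathbb{X}$-bundle: a surjective submersion $\pi\colon P\to M$ with a right action, $\pi(pg)=\pi(p)$, and $(p,g)\mapsto(p,pg)$ a diffeomorphism $P\times_{X_0}X_1\to P\times_MP$. Lie algebroid $A\to X_0$: $A_x=\ker(ds)_{1_x}$. $r_g\colon A_{t(g)}\to T_gX_1$ is the differential at $1_{t(g)}$ of $h\mapsto hg$; $l_g\colon A_{s(g)}\to T_gX_1$ is the differential at $1_{s(g)}$ of $h\mapsto gh^{-1}$ on $s^{-1}(s(g))$. Ehresmann connection: a subbundle $\mathbb{H}\subset TX_1$ with $TX_1=\mathbb{H}\oplus\ker ds$ and $\mathbb{H}_{1_x}=(d1)_x(T_xX_0)$; $\sigma_g\colon T_{s(g)}X_0\to\mathbb{H}_g$ is the inverse of $ds|_{\mathbb{H}_g}$; $\psi_g\colon T_gX_1\to A_{t(g)}$ satisfies $r_g\psi_g+\sigma_g(ds)_g=\mathrm{Id}$. $\lambda^1_g=(dt)_g\sigma_g\colon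 T_{s(g)}X_0\to T_{t(g)}X_0$. Basic curvature: $K(g,h)(v)=-\psi_{gh}(\sigma_g(\lambda^1_hv).\sigma_h(v))\in A_{t(g)}$ for $v\in T_{s(h)}X_0$. A (degree 2) quasi equivariant $\mathbb{X}$-bundle up to homotopy over $P$ is a graded vector bundle $E=E^0\oplus E^1\to P$ with: smooth maps $\tau^j\colon E^j\times_{X_0}X_1\to E^j$ ($j=0,1$) given by linear maps $\tau^j_g\colon E^j_p\to E^j_{pg}$ for $a(p)=t(g)$, with $\tau^j_{1_{a(p)}}=\mathrm{Id}$; a smooth vector bundle map $\xi\colon E^0\to E^1$; a smooth family of linear maps $\Upsilon(g,h)\colon E^1_p\to E^0_{pgh}$ for $a(p)=t(g)$, $s(g)=t(h)$; such that for all composable $g,h,k$ and $a(p)=t(g)$: $\xi_{pg}\tau^0_g=\tau^1_g\xi_p$; $\tau^0_{gh}-\tau^0_h\tau^0_g=\Upsilon(g,h)\xi_p$; $\tau^1_{gh}-\tau^1_h\tau^1_g=\xi_{pgh}\Upsilon(g,h)$; and $\tau^0_k\Upsilon(g,h)+\Upsilon(gh,k)-\Upsilon(g,hk)-\Upsilon(h,k)\tau^1_g=0$. *)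

theory Defs
  imports "HOL-Analysis.Analysis"
begin

section \<open>Model spaces\<close>

text \<open>
  Class \<^class>\<open>euclidean_space\<close> requires a nonempty basis, which would exclude manifolds of
  dimension 0 (for instance the unit manifold of a Lie group seen as a Lie groupoid).  The
  following class has the same axioms except for that one, with the basis existentially quantified.
\<close>

class model_space = real_inner +
  assumes ex_orthonormal_basis:
    "\<exists>B. finite B \<and> (\<forall>u\<in>B. \<forall>v\<in>B. inner u v = (if u = v then 1 else 0)) \<and>
         (\<forall>x. (\<forall>u\<in>B. inner x u = 0) \<longleftrightarrow> x = 0)"

instance euclidean_space \<subseteq> model_space
proof
  show "\<exists>B::'a set. finite B \<and>
      (\<forall>u\<in>B. \<forall>v\<in>B. inner u v = (if u = v then 1 else 0)) \<and>
      (\<forall>x. (\<forall>u\<in>B. inner x u = 0) \<longleftrightarrow> x = 0)"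
    by (intro exI[of _ Basis] conjI ballI allI finite_Basis inner_Basis euclidean_all_zero_iff)
qed

instance prod :: (model_space, model_space) model_space
proof
  obtain A :: "'a set" where A: "finite A"
      "\<forall>u\<in>A. \<forall>v\<in>A. inner u v = (if u = v then 1 else 0)"
      "\<forall>x. (\<forall>u\<in>A. inner x u = 0) \<longleftrightarrow> x = 0"
    using ex_orthonormal_basis[where 'a = 'a] by (elim exE conjE)
  obtain B :: "'b set" where B: "finite B"
      "\<forall>u\<in>B. \<forall>v\<in>B. inner u v = (if u = v then 1 else 0)"
      "\<forall>x. (\<forall>u\<in>B. inner x u = 0) \<longleftrightarrow> x = 0"
    using ex_orthonormal_basis[where 'a = 'b] by (elim exE conjE)
  have nz: "(0::'a) \<notin> A" "(0::'b) \<notin> B"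
    using A(2)[rule_format, of 0 0] B(2)[rule_format, of 0 0] by auto
  let ?C = "(\<lambda>u. (u, 0)) ` A \<union> (\<lambda>v. (0, v)) ` B"
  have "finite ?C"
    using A(1) B(1) by simp
  moreover have "\<forall>u\<in>?C. \<forall>v\<in>?C. inner u v = (if u = v then 1 else 0)"
    by (auto simp: A(2) B(2) nz split: if_splits)
  moreover have "\<forall>x. (\<forall>u\<in>?C. inner x u = 0) \<longleftrightarrow> x = 0"
  proof
    fix x :: "'a \<times> 'b"
    have "(\<forall>u\<in>?C. inner x u = 0) \<longleftrightarrow>
        (\<forall>u\<in>A. inner (fst x) u = 0) \<and> (\<forall>v\<in>B. inner (snd x) v = 0)"
      by (cases x) (simp add: ball_Un)
    also have "\<dots> \<longleftrightarrow> x = 0"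
      using A(3) B(3) by (simp add: prod_eq_iff)
    finally show "(\<forall>u\<in>?C. inner x u = 0) \<longleftrightarrow> x = 0" .
  qed
  ultimately show "\<exists>B::('a \<times> 'b) set. finite B \<and>
      (\<forall>u\<in>B. \<forall>v\<in>B. inner u v = (if u = v then 1 else 0)) \<and>
      (\<forall>x. (\<forall>u\<in>B. inner x u = 0) \<longleftrightarrow> x = 0)"
    by (intro exI[of _ ?C] conjI)
qed

instantiation unit :: model_space
begin

definition plus_unit :: "unit \<Rightarrow> unit \<Rightarrow> unit" where "plus_unit x y = ()"
definition minus_unit :: "unit \<Rightarrow> unit \<Rightarrow> unit" where "minus_unit x y = ()"
definition uminus_unit :: "unit \<Rightarrow> unit" where "uminus_unit x = ()"
definition zero_unit :: unit where "zero_unit = ()"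
definition scaleR_unit :: "real \<Rightarrow> unit \<Rightarrow> unit" where "scaleR_unit r x = ()"
definition sgn_unit :: "unit \<Rightarrow> unit" where "sgn_unit x = ()"
definition norm_unit :: "unit \<Rightarrow> real" where "norm_unit x = 0"
definition dist_unit :: "unit \<Rightarrow> unit \<Rightarrow> real" where "dist_unit x y = 0"
definition inner_unit :: "unit \<Rightarrow> unit \<Rightarrow> real" where "inner_unit x y = 0"
definition uniformity_unit :: "(unit \<times> unit) filter" where
  "uniformity_unit = (INF e\<in>{0<..}. principal {(x, y). dist x y < e})"
definition open_unit :: "unit set \<Rightarrow> bool" where
  "open_unit U \<longleftrightarrow> (\<forall>x\<in>U. eventually (\<lambda>(x', y). x' = x \<longrightarrow> y \<in> U) uniformity)"

instance
proof
  show "\<exists>B::unit set. finite B \<and> (\<forall>u\<in>B. \<forall>v\<in>B. inner u v = (if u = v then 1 else 0)) \<and>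
      (\<forall>x. (\<forall>u\<in>B. inner x u = 0) \<longleftrightarrow> x = 0)"
    by (intro exI[of _ "{}"]) simp
  show "open U \<longleftrightarrow> (\<forall>x\<in>U. \<forall>\<^sub>F (x', y) in uniformity. x' = x \<longrightarrow> y \<in> U)" for U :: "unit set"
    by (fact open_unit_def)
  show "(uniformity :: (unit \<times> unit) filter) =
      (INF e\<in>{0<..}. principal {(x, y). dist x y < e})"
    by (fact uniformity_unit_def)
qed (simp_all add: norm_unit_def dist_unit_def inner_unit_def)

end


section \<open>Manifolds and smooth maps\<close>

text \<open>\<open>higher_differentiable_on W f n\<close> says that \<open>f\<close> is \<open>C\<^sup>n\<close> on the open set \<open>W\<close>.\<close>

primrec higher_differentiable_on ::
  "'a::model_space set \<Rightarrow> ('a \<Rightarrow> 'b::model_space) \<Rightarrow> nat \<Rightarrow> bool"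
where
  "higher_differentiable_on W f 0 \<longleftrightarrow> continuous_on W f"
| "higher_differentiable_on W f (Suc n) \<longleftrightarrow>
     (\<forall>x\<in>W. f differentiable (at x)) \<and>
     (\<forall>v. higher_differentiable_on W (\<lambda>x. frechet_derivative f (at x) v) n)"

definition smooth_on :: "'a::model_space set \<Rightarrow> ('a \<Rightarrow> 'b::model_space) \<Rightarrow> bool" where
  "smooth_on W f \<longleftrightarrow> (\<forall>n. higher_differentiable_on W f n)"

type_synonym ('a, 'e) chart = "'a set \<times> ('a \<Rightarrow> 'e)"

text \<open>
  The field \<open>chart_at\<close> selects a chart around each point.  A class of pairs (chart around \<open>p\<close>,
  vector) that represents a tangent vector at \<open>p\<close> has exactly one representative in the selected
  chart.  Therefore the tangent space at \<open>p\<close> is taken to be the model space \<open>'e\<close>, an element of it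
  standing for the class of its pair with \<open>chart_at M p\<close>.
\<close>

record ('a, 'e) manifold =
  carrier :: "'a set"
  atlas :: "('a, 'e) chart set"
  chart_at :: "'a \<Rightarrow> ('a, 'e) chart"

text \<open>The topology is the one induced by the charts.\<close>

definition open_in :: "('a, 'e::model_space) manifold \<Rightarrow> 'a set \<Rightarrow> bool" where
  "open_in M W \<longleftrightarrow> W \<subseteq> carrier M \<and> (\<forall>(U, \<phi>)\<in>atlas M. open (\<phi> ` (U \<inter> W)))"

definition smooth_manifold :: "('a, 'e::model_space) manifold \<Rightarrow> bool" where
  "smooth_manifold M \<longleftrightarrow>
     (\<forall>(U, \<phi>)\<in>atlas M. U \<subseteq> carrier M \<and> inj_on \<phi> U \<and> open (\<phi> ` U)) \<and>
     (\<forall>(U, \<phi>)\<in>atlas M. \<forall>(V, \<psi>)\<in>atlas M.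
        open (\<phi> ` (U \<inter> V)) \<and> smooth_on (\<phi> ` (U \<inter> V)) (\<lambda>x. \<psi> (inv_into U \<phi> x))) \<and>
     (\<forall>p\<in>carrier M. chart_at M p \<in> atlas M \<and> p \<in> fst (chart_at M p)) \<and>
     (\<forall>p\<in>carrier M. \<forall>q\<in>carrier M. p \<noteq> q \<longrightarrow>
        (\<exists>U V. open_in M U \<and> open_in M V \<and> p \<in> U \<and> q \<in> V \<and> U \<inter> V = {})) \<and>
     (\<exists>\<B>. countable \<B> \<and> (\<forall>W\<in>\<B>. open_in M W) \<and>
        (\<forall>W. open_in M W \<longrightarrow> (\<exists>\<C>\<subseteq>\<B>. W = \<Union>\<C>)))"

definition prod_chart ::
  "('a, 'e) chart \<Rightarrow> ('b, 'f) chart \<Rightarrow> ('a \<times> 'b, 'e \<times> 'f) chart"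
where
  "prod_chart c d = (fst c \<times> fst d, map_prod (snd c) (snd d))"

text \<open>
  The selected charts of a product are products of selected charts, so that
  \<open>T\<^bsub>(p,q)\<^esub>(M \<times> N)\<close> is literally \<open>T\<^sub>pM \<times> T\<^sub>qN\<close>.
\<close>

definition prod_manifold :: "('a, 'e::model_space) manifold \<Rightarrow> ('b, 'f::model_space) manifold \<Rightarrow>
    ('a \<times> 'b, 'e \<times> 'f) manifold"  (infixr \<open>\<times>\<^sub>M\<^sub>f\<close> 80)
where
  "M \<times>\<^sub>M\<^sub>f N =
     \<lparr>carrier = carrier M \<times> carrier N,
      atlas = {prod_chart c d |c d. c \<in> atlas M \<and> d \<in> atlas N},
      chart_at = (\<lambda>(p, q). prod_chart (chart_at M p) (chart_at N q))\<rparr>"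

definition model_manifold :: "('e::model_space, 'e) manifold" where
  "model_manifold = \<lparr>carrier = UNIV, atlas = {(UNIV, id)}, chart_at = (\<lambda>_. (UNIV, id))\<rparr>"

text \<open>
  Smoothness on an arbitrary subset \<open>S\<close> means existence of local smooth extensions, in charts.  For
  an embedded submanifold \<open>S\<close>, in particular for a fibre product along a submersion or a fibre of
  a submersion, this is smoothness for the manifold structure of \<open>S\<close>.
\<close>

definition smooth_map_on :: "('a, 'e::model_space) manifold \<Rightarrow> ('b, 'f::model_space) manifold \<Rightarrow>
    'a set \<Rightarrow> ('a \<Rightarrow> 'b) \<Rightarrow> bool"
where
  "smooth_map_on M N S f \<longleftrightarrow> S \<subseteq> carrier M \<and> f ` S \<subseteq> carrier N \<and>
     (\<forall>p\<in>S. \<exists>(U, \<phi>)\<in>atlas M. \<exists>(V, \<psi>)\<in>atlas N. \<exists>W F.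
        p \<in> U \<and> \<phi> p \<in> W \<and> open W \<and> W \<subseteq> \<phi> ` U \<and> smooth_on W F \<and>
        (\<forall>q\<in>U \<inter> S. \<phi> q \<in> W \<longrightarrow> f q \<in> V \<and> \<psi> (f q) = F (\<phi> q)))"

abbreviation smooth_map :: "('a, 'e::model_space) manifold \<Rightarrow> ('b, 'f::model_space) manifold \<Rightarrow>
    ('a \<Rightarrow> 'b) \<Rightarrow> bool"
where
  "smooth_map M N f \<equiv> smooth_map_on M N (carrier M) f"

definition diffeomorphism_on :: "('a, 'e::model_space) manifold \<Rightarrow> 'a set \<Rightarrow>
    ('b, 'f::model_space) manifold \<Rightarrow> 'b set \<Rightarrow> ('a \<Rightarrow> 'b) \<Rightarrow> bool"
where
  "diffeomorphism_on M S N T f \<longleftrightarrow>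
     bij_betw f S T \<and> smooth_map_on M N S f \<and> smooth_map_on N M T (inv_into S f)"

text \<open>
  The differential at \<open>p\<close> of a map defined on \<open>S\<close>, read in the selected charts.  If \<open>S\<close> is a proper
  submanifold, then \<^const>\<open>frechet_derivative\<close> within \<open>S\<close> is one of several linear maps, but all of
  them agree on the vectors tangent to \<open>S\<close>, and it is applied to such vectors only.
\<close>

definition differential_on :: "('a, 'e::model_space) manifold \<Rightarrow> ('b, 'f::model_space) manifold \<Rightarrow>
    'a set \<Rightarrow> ('a \<Rightarrow> 'b) \<Rightarrow> 'a \<Rightarrow> 'e \<Rightarrow> 'f"
where
  "differential_on M N S f p =
     (let (U, \<phi>) = chart_at M p; (V, \<psi>) = chart_at N (f p)
      in frechet_derivative (\<lambda>x. \<psi> (f (inv_into U \<phi> x))) (at (\<phi> p) within \<phi> ` (U \<inter> S)))"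

abbreviation differential :: "('a, 'e::model_space) manifold \<Rightarrow> ('b, 'f::model_space) manifold \<Rightarrow>
    ('a \<Rightarrow> 'b) \<Rightarrow> 'a \<Rightarrow> 'e \<Rightarrow> 'f"
where
  "differential M N f \<equiv> differential_on M N (carrier M) f"

definition submersion :: "('a, 'e::model_space) manifold \<Rightarrow> ('b, 'f::model_space) manifold \<Rightarrow>
    ('a \<Rightarrow> 'b) \<Rightarrow> bool"
where
  "submersion M N f \<longleftrightarrow> smooth_map M N f \<and> (\<forall>p\<in>carrier M. surj (differential M N f p))"


section \<open>Vector bundles\<close>

text \<open>
  A vector bundle over \<open>B\<close> with fibre \<open>\<real>\<^sup>k\<close>, \<open>'v\<close> being the model of \<open>\<real>\<^sup>k\<close>, is given by its local
  trivializations.  As a set, each fibre is \<open>'v\<close>; a trivialization \<open>(U, \<Phi>)\<close> maps the fibre at \<open>p\<close> to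
  \<open>'v\<close> by the linear isomorphism \<open>\<Phi> p\<close>, and these need not be smooth or even continuous in \<open>p\<close> with
  respect to the product structure on \<open>B \<times> 'v\<close>.
\<close>

type_synonym ('a, 'v) trivialization = "'a set \<times> ('a \<Rightarrow> 'v \<Rightarrow> 'v)"

definition vector_bundle ::
  "('a, 'e::model_space) manifold \<Rightarrow> ('a, 'v::model_space) trivialization set \<Rightarrow> bool"
where
  "vector_bundle B E \<longleftrightarrow>
     (\<forall>(U, \<Phi>)\<in>E. open_in B U \<and> (\<forall>p\<in>U. linear (\<Phi> p) \<and> bij (\<Phi> p))) \<and>
     (\<Union>(U, \<Phi>)\<in>E. U) = carrier B \<and>
     (\<forall>(U, \<Phi>)\<in>E. \<forall>(V, \<Psi>)\<in>E.
        smooth_map_on (B \<times>\<^sub>M\<^sub>f model_manifold) model_manifold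
          ((U \<inter> V) \<times> UNIV) (\<lambda>(p, v). \<Psi> p (inv (\<Phi> p) v)))"

definition total_chart ::
  "('a, 'e) chart \<Rightarrow> ('a, 'v) trivialization \<Rightarrow> ('a \<times> 'v, 'e \<times> 'v) chart"
where
  "total_chart c T = ((fst c \<inter> fst T) \<times> UNIV, \<lambda>(p, v). (snd c p, snd T p v))"

definition total_space ::
  "('a, 'e::model_space) manifold \<Rightarrow> ('a, 'v::model_space) trivialization set \<Rightarrow>
    ('a \<times> 'v, 'e \<times> 'v) manifold"
where
  "total_space B E =
     \<lparr>carrier = carrier B \<times> UNIV,
      atlas = {total_chart c T |c T. c \<in> atlas B \<and> T \<in> E},
      chart_at = (\<lambda>(p, v). total_chart (chart_at B p) (SOME T. T \<in> E \<and> p \<in> fst T))\<rparr>"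

text \<open>The second condition says that \<open>(U, \<Phi>)\<close> is a local trivialization of \<open>E\<close>, not only one of
  those by which \<open>E\<close> is given.\<close>

definition subbundle :: "('a, 'e::model_space) manifold \<Rightarrow>
    ('a, 'v::model_space) trivialization set \<Rightarrow> ('a \<Rightarrow> 'v set) \<Rightarrow> bool"
where
  "subbundle B E H \<longleftrightarrow>
     (\<forall>p\<in>carrier B. \<exists>U \<Phi> W.
        p \<in> U \<and> vector_bundle B (insert (U, \<Phi>) E) \<and> subspace W \<and> (\<forall>q\<in>U. \<Phi> q ` H q = W))"

text \<open>Each chart \<open>(U, \<phi>)\<close> trivializes the tangent bundle over \<open>U\<close> by the differentials of \<open>\<phi>\<close>.\<close>

definition tangent_bundle :: "('a, 'e::model_space) manifold \<Rightarrow> ('a, 'e) trivialization set" where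
  "tangent_bundle M = {(U, \<lambda>p. differential_on M model_manifold U \<phi> p) |U \<phi>. (U, \<phi>) \<in> atlas M}"

definition pullback_bundle :: "('a, 'e::model_space) manifold \<Rightarrow> ('a \<Rightarrow> 'b) \<Rightarrow>
    ('b, 'v::model_space) trivialization set \<Rightarrow> ('a, 'v) trivialization set"
where
  "pullback_bundle M f E = {({p \<in> carrier M. f p \<in> U}, \<lambda>p. \<Phi> (f p)) |U \<Phi>. (U, \<Phi>) \<in> E}"


section \<open>Lie groupoids and principal bundles\<close>

record ('g, 'e, 'x, 'd) groupoid =
  arrows :: "('g, 'e) manifold"
  objects :: "('x, 'd) manifold"
  src :: "'g \<Rightarrow> 'x"
  tgt :: "'g \<Rightarrow> 'x"
  gcomp :: "'g \<Rightarrow> 'g \<Rightarrow> 'g"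
  gunit :: "'x \<Rightarrow> 'g"
  ginv :: "'g \<Rightarrow> 'g"

definition composable :: "('g, 'e::model_space, 'x, 'd::model_space) groupoid \<Rightarrow> ('g \<times> 'g) set"
where
  "composable X =
     {(g, h). g \<in> carrier (arrows X) \<and> h \<in> carrier (arrows X) \<and> src X g = tgt X h}"

definition lie_groupoid :: "('g, 'e::model_space, 'x, 'd::model_space) groupoid \<Rightarrow> bool" where
  "lie_groupoid X \<longleftrightarrow>
     smooth_manifold (arrows X) \<and> smooth_manifold (objects X) \<and>
     submersion (arrows X) (objects X) (src X) \<and>
     submersion (arrows X) (objects X) (tgt X) \<and>
     smooth_map_on (arrows X \<times>\<^sub>M\<^sub>f arrows X) (arrows X) (composable X) (\<lambda>(g, h). gcomp X g h) \<and>
     smooth_map (objects X) (arrows X) (gunit X) \<and>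
     smooth_map (arrows X) (arrows X) (ginv X) \<and>
     (\<forall>(g, h)\<in>composable X. src X (gcomp X g h) = src X h \<and> tgt X (gcomp X g h) = tgt X g) \<and>
     (\<forall>g h k. (g, h) \<in> composable X \<and> (h, k) \<in> composable X \<longrightarrow>
        gcomp X (gcomp X g h) k = gcomp X g (gcomp X h k)) \<and>
     (\<forall>x\<in>carrier (objects X). src X (gunit X x) = x \<and> tgt X (gunit X x) = x) \<and>
     (\<forall>g\<in>carrier (arrows X).
        gcomp X g (gunit X (src X g)) = g \<and> gcomp X (gunit X (tgt X g)) g = g \<and>
        src X (ginv X g) = tgt X g \<and> tgt X (ginv X g) = src X g \<and>
        gcomp X (ginv X g) g = gunit X (src X g) \<and> gcomp X g (ginv X g) = gunit X (tgt X g))"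

text \<open>\<open>dcomp X g h \<beta> \<alpha>\<close> is \<open>\<beta>.\<alpha> \<in> T\<^bsub>gh\<^esub>X\<^sub>1\<close>.\<close>

definition dcomp :: "('g, 'e::model_space, 'x, 'd::model_space) groupoid \<Rightarrow>
    'g \<Rightarrow> 'g \<Rightarrow> 'e \<Rightarrow> 'e \<Rightarrow> 'e"
where
  "dcomp X g h \<beta> \<alpha> =
     differential_on (arrows X \<times>\<^sub>M\<^sub>f arrows X) (arrows X) (composable X) (\<lambda>(g, h). gcomp X g h)
       (g, h) (\<beta>, \<alpha>)"

definition act_domain :: "('g, 'e::model_space, 'x, 'd::model_space) groupoid \<Rightarrow>
    ('p, 'k::model_space) manifold \<Rightarrow> ('p \<Rightarrow> 'x) \<Rightarrow> ('p \<times> 'g) set"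
where
  "act_domain X P a = {(p, g). p \<in> carrier P \<and> g \<in> carrier (arrows X) \<and> a p = tgt X g}"

definition right_action :: "('g, 'e::model_space, 'x, 'd::model_space) groupoid \<Rightarrow>
    ('p, 'k::model_space) manifold \<Rightarrow> ('p \<Rightarrow> 'x) \<Rightarrow> ('p \<Rightarrow> 'g \<Rightarrow> 'p) \<Rightarrow> bool"
where
  "right_action X P a act \<longleftrightarrow>
     smooth_manifold P \<and>
     smooth_map P (objects X) a \<and>
     smooth_map_on (P \<times>\<^sub>M\<^sub>f arrows X) P (act_domain X P a) (\<lambda>(p, g). act p g) \<and>
     (\<forall>(p, g)\<in>act_domain X P a. a (act p g) = src X g) \<and>
     (\<forall>p g h. (p, g) \<in> act_domain X P a \<and> (g, h) \<in> composable X \<longrightarrow>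
        act (act p g) h = act p (gcomp X g h)) \<and>
     (\<forall>p\<in>carrier P. act p (gunit X (a p)) = p)"

text \<open>\<open>dact X P a act p g u \<beta>\<close> is \<open>u.\<beta> \<in> T\<^bsub>pg\<^esub>P\<close>.\<close>

definition dact :: "('g, 'e::model_space, 'x, 'd::model_space) groupoid \<Rightarrow>
    ('p, 'k::model_space) manifold \<Rightarrow> ('p \<Rightarrow> 'x) \<Rightarrow> ('p \<Rightarrow> 'g \<Rightarrow> 'p) \<Rightarrow>
    'p \<Rightarrow> 'g \<Rightarrow> 'k \<Rightarrow> 'e \<Rightarrow> 'k"
where
  "dact X P a act p g u \<beta> =
     differential_on (P \<times>\<^sub>M\<^sub>f arrows X) P (act_domain X P a) (\<lambda>(p, g). act p g) (p, g) (u, \<beta>)"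

definition principal_bundle :: "('g, 'e::model_space, 'x, 'd::model_space) groupoid \<Rightarrow>
    ('p, 'k::model_space) manifold \<Rightarrow> ('m, 'l::model_space) manifold \<Rightarrow>
    ('p \<Rightarrow> 'm) \<Rightarrow> ('p \<Rightarrow> 'x) \<Rightarrow> ('p \<Rightarrow> 'g \<Rightarrow> 'p) \<Rightarrow> bool"
where
  "principal_bundle X P M \<pi> a act \<longleftrightarrow>
     smooth_manifold M \<and> right_action X P a act \<and>
     submersion P M \<pi> \<and> \<pi> ` carrier P = carrier M \<and>
     (\<forall>(p, g)\<in>act_domain X P a. \<pi> (act p g) = \<pi> p) \<and>
     diffeomorphism_on (P \<times>\<^sub>M\<^sub>f arrows X) (act_domain X P a)
       (P \<times>\<^sub>M\<^sub>f P) {(p, q). p \<in> carrier P \<and> q \<in> carrier P \<and> \<pi> p = \<pi> q}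
       (\<lambda>(p, g). (p, act p g))"


section \<open>Lie algebroid, Ehresmann connections and basic curvature\<close>

definition algebroid :: "('g, 'e::model_space, 'x, 'd::model_space) groupoid \<Rightarrow> 'x \<Rightarrow> 'e set" where
  "algebroid X x = {\<alpha>. differential (arrows X) (objects X) (src X) (gunit X x) \<alpha> = 0}"

text \<open>\<open>r\<^sub>g\<close> and \<open>l\<^sub>g\<close> are applied to elements of the algebroid, that is, to vectors tangent to the
  source fibre on which the differentiated map is defined.\<close>

definition right_translation :: "('g, 'e::model_space, 'x, 'd::model_space) groupoid \<Rightarrow>
    'g \<Rightarrow> 'e \<Rightarrow> 'e"
where
  "right_translation X g =
     differential_on (arrows X) (arrows X) {h \<in> carrier (arrows X). src X h = tgt X g}
       (\<lambda>h. gcomp X h g) (gunit X (tgt X g))"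

definition left_translation :: "('g, 'e::model_space, 'x, 'd::model_space) groupoid \<Rightarrow>
    'g \<Rightarrow> 'e \<Rightarrow> 'e"
where
  "left_translation X g =
     differential_on (arrows X) (arrows X) {h \<in> carrier (arrows X). src X h = src X g}
       (\<lambda>h. gcomp X g (ginv X h)) (gunit X (src X g))"

definition ehresmann_connection :: "('g, 'e::model_space, 'x, 'd::model_space) groupoid \<Rightarrow>
    ('g \<Rightarrow> 'e set) \<Rightarrow> bool"
where
  "ehresmann_connection X H \<longleftrightarrow>
     subbundle (arrows X) (tangent_bundle (arrows X)) H \<and>
     (\<forall>g\<in>carrier (arrows X).
        let V = {w. differential (arrows X) (objects X) (src X) g w = 0}
        in H g \<inter> V = {0} \<and> (\<forall>w. \<exists>y\<in>H g. \<exists>z\<in>V. w = y + z)) \<and>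
     (\<forall>x\<in>carrier (objects X).
        H (gunit X x) = range (differential (objects X) (arrows X) (gunit X) x))"

text \<open>\<open>horizontal_lift\<close> is \<open>\<sigma>\<close>, \<open>vertical_part\<close> is \<open>\<psi>\<close>, \<open>lambda1\<close> is \<open>\<lambda>\<^sup>1\<close>.\<close>

definition horizontal_lift :: "('g, 'e::model_space, 'x, 'd::model_space) groupoid \<Rightarrow>
    ('g \<Rightarrow> 'e set) \<Rightarrow> 'g \<Rightarrow> 'd \<Rightarrow> 'e"
where
  "horizontal_lift X H g = the_inv_into (H g) (differential (arrows X) (objects X) (src X) g)"

definition vertical_part :: "('g, 'e::model_space, 'x, 'd::model_space) groupoid \<Rightarrow>
    ('g \<Rightarrow> 'e set) \<Rightarrow> 'g \<Rightarrow> 'e \<Rightarrow> 'e"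
where
  "vertical_part X H g w =
     (THE \<alpha>. \<alpha> \<in> algebroid X (tgt X g) \<and>
        right_translation X g \<alpha> +
          horizontal_lift X H g (differential (arrows X) (objects X) (src X) g w) = w)"

definition lambda1 :: "('g, 'e::model_space, 'x, 'd::model_space) groupoid \<Rightarrow>
    ('g \<Rightarrow> 'e set) \<Rightarrow> 'g \<Rightarrow> 'd \<Rightarrow> 'd"
where
  "lambda1 X H g v =
     differential (arrows X) (objects X) (tgt X) g (horizontal_lift X H g v)"

definition basic_curvature :: "('g, 'e::model_space, 'x, 'd::model_space) groupoid \<Rightarrow>
    ('g \<Rightarrow> 'e set) \<Rightarrow> 'g \<Rightarrow> 'g \<Rightarrow> 'd \<Rightarrow> 'e"
where
  "basic_curvature X H g h v =
     - vertical_part X H (gcomp X g h)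
         (dcomp X g h (horizontal_lift X H g (lambda1 X H h v)) (horizontal_lift X H h v))"


section \<open>Quasi equivariant bundles up to homotopy\<close>

text \<open>
  The graded bundle is the pair \<open>E0\<close>, \<open>E1\<close>.  The maps \<open>\<tau>\<^sup>j\<^sub>g : E\<^sup>j\<^sub>p \<rightarrow> E\<^sup>j\<^bsub>pg\<^esub>\<close> and
  \<open>\<Upsilon>(g,h) : E\<^sup>1\<^sub>p \<rightarrow> E\<^sup>0\<^bsub>pgh\<^esub>\<close> depend on the base point \<open>p\<close>, which is written as an explicit first
  argument: \<open>\<tau>0 p g\<close>, \<open>\<tau>1 p g\<close>, \<open>\<Upsilon> p g h\<close>.
\<close>

definition quasi_action :: "('g, 'e::model_space, 'x, 'd::model_space) groupoid \<Rightarrow>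
    ('p, 'k::model_space) manifold \<Rightarrow> ('p \<Rightarrow> 'x) \<Rightarrow> ('p \<Rightarrow> 'g \<Rightarrow> 'p) \<Rightarrow>
    ('p, 'v::model_space) trivialization set \<Rightarrow> ('p \<Rightarrow> 'g \<Rightarrow> 'v \<Rightarrow> 'v) \<Rightarrow> bool"
where
  "quasi_action X P a act E \<tau> \<longleftrightarrow>
     smooth_map_on (total_space P E \<times>\<^sub>M\<^sub>f arrows X) (total_space P E)
       {((p, e), g). (p, g) \<in> act_domain X P a} (\<lambda>((p, e), g). (act p g, \<tau> p g e)) \<and>
     (\<forall>(p, g)\<in>act_domain X P a. linear (\<tau> p g)) \<and>
     (\<forall>p\<in>carrier P. \<tau> p (gunit X (a p)) = id)"

definition quasi_equivariant_bundle :: "('g, 'e::model_space, 'x, 'd::model_space) groupoid \<Rightarrow>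
    ('p, 'k::model_space) manifold \<Rightarrow> ('p \<Rightarrow> 'x) \<Rightarrow> ('p \<Rightarrow> 'g \<Rightarrow> 'p) \<Rightarrow>
    ('p, 'v::model_space) trivialization set \<Rightarrow> ('p, 'w::model_space) trivialization set \<Rightarrow>
    ('p \<Rightarrow> 'g \<Rightarrow> 'v \<Rightarrow> 'v) \<Rightarrow> ('p \<Rightarrow> 'g \<Rightarrow> 'w \<Rightarrow> 'w) \<Rightarrow> ('p \<Rightarrow> 'v \<Rightarrow> 'w) \<Rightarrow>
    ('p \<Rightarrow> 'g \<Rightarrow> 'g \<Rightarrow> 'w \<Rightarrow> 'v) \<Rightarrow> bool"
where
  "quasi_equivariant_bundle X P a act E0 E1 \<tau>0 \<tau>1 \<xi> \<Upsilon> \<longleftrightarrow>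
     right_action X P a act \<and>
     vector_bundle P E0 \<and> vector_bundle P E1 \<and>
     quasi_action X P a act E0 \<tau>0 \<and> quasi_action X P a act E1 \<tau>1 \<and>
     smooth_map (total_space P E0) (total_space P E1) (\<lambda>(p, e). (p, \<xi> p e)) \<and>
     (\<forall>p\<in>carrier P. linear (\<xi> p)) \<and>
     smooth_map_on (total_space P E1 \<times>\<^sub>M\<^sub>f (arrows X \<times>\<^sub>M\<^sub>f arrows X)) (total_space P E0)
       {((p, e), (g, h)). (p, g) \<in> act_domain X P a \<and> (g, h) \<in> composable X}
       (\<lambda>((p, e), (g, h)). (act p (gcomp X g h), \<Upsilon> p g h e)) \<and>
     (\<forall>p g h. (p, g) \<in> act_domain X P a \<and> (g, h) \<in> composable X \<longrightarrow> linear (\<Upsilon> p g h)) \<and>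
     (\<forall>p g. (p, g) \<in> act_domain X P a \<longrightarrow> (\<forall>e. \<xi> (act p g) (\<tau>0 p g e) = \<tau>1 p g (\<xi> p e))) \<and>
     (\<forall>p g h. (p, g) \<in> act_domain X P a \<and> (g, h) \<in> composable X \<longrightarrow>
        (\<forall>e. \<tau>0 p (gcomp X g h) e - \<tau>0 (act p g) h (\<tau>0 p g e) = \<Upsilon> p g h (\<xi> p e)) \<and>
        (\<forall>e. \<tau>1 p (gcomp X g h) e - \<tau>1 (act p g) h (\<tau>1 p g e)
             = \<xi> (act p (gcomp X g h)) (\<Upsilon> p g h e))) \<and>
     (\<forall>p g h k. (p, g) \<in> act_domain X P a \<and> (g, h) \<in> composable X \<and> (h, k) \<in> composable X \<longrightarrow>
        (\<forall>e. \<tau>0 (act p (gcomp X g h)) k (\<Upsilon> p g h e) + \<Upsilon> p (gcomp X g h) k e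
             - \<Upsilon> p g (gcomp X h k) e - \<Upsilon> (act p g) h k (\<tau>1 p g e) = 0))"

end

theory Submission
  imports Defs
begin

text \<open>
  The differentials of the structure maps turn the tangent vectors of a Lie groupoid into a groupoid
  again, which acts on \<open>TP\<close>: the operations \<open>\<beta>.\<alpha>\<close> and \<open>u.\<beta>\<close> are additive, and
  \<open>da(u.\<beta>) = ds \<beta>\<close>, \<open>(u.\<beta>).\<alpha> = u.(\<beta>.\<alpha>)\<close>, \<open>u.d1(da u) = u\<close>, \<open>dt(\<beta>.\<alpha>) = dt \<beta>\<close> and
  \<open>di(\<beta>.\<alpha>) = di \<alpha>.di \<beta>\<close>.  From these rules the four equations follow by algebra,
  the first one being an instance of \<open>da(u.\<beta>) = ds \<beta>\<close>.  Let
  \<open>\<rho>\<^sub>g(v) = di \<sigma>(v)\<close>, the lift \<open>\<sigma>\<close> being taken at \<open>g\<inverse>\<close>; this is a lift of \<open>v\<close> along \<open>dt\<close> instead of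
  \<open>ds\<close> (\<open>target_lift\<close>), and \<open>\<tau>\<^sup>0\<^sub>g(u) = u.\<rho>\<^sub>g(da u)\<close>.  The lifts \<open>\<rho>\<close> are multiplicative up to the defect
  \<open>\<delta>(g,h)(v) = \<rho>\<^bsub>gh\<^esub>(v) - \<rho>\<^sub>g(v).\<rho>\<^sub>h(\<tau>\<^sup>1\<^sub>g v)\<close> (\<open>lift_defect\<close>), which \<open>dt\<close> annihilates.  By additivity
  and associativity \<open>\<tau>\<^sup>0\<^bsub>gh\<^esub>(u) - \<tau>\<^sup>0\<^sub>h\<tau>\<^sup>0\<^sub>g(u) = 0.\<delta>(g,h)(da u)\<close>, and \<open>\<delta>(g,h)\<close> is the left translate of the
  basic curvature: this is the inversion applied to the decomposition \<open>r\<psi> + \<sigma> ds = Id\<close>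
  (\<open>left_translation_basic_curvature\<close>).  Hence \<open>\<Upsilon>(g,h) = 0.\<delta>(g,h)\<close>.  The equation for \<open>\<tau>\<^sup>1\<close> is the
  image of the definition of \<open>\<delta>\<close> under \<open>ds\<close>, and in the last equation all terms cancel by associativity
  (\<open>lift_defect_cocycle\<close>).

  The rules for tangent vectors are proved with curves.  A differential sends the velocity of a curve
  to the velocity of the image curve (\<open>differential_on_has_velocity\<close>), also for a map that is defined on
  a fibre product only and whose derivative within the fibre product is not unique.  So an identity
  between points, applied along a curve, becomes an identity between vectors.  What this needs is that
  compatible vectors are the velocities of a curve in the fibre product, and this is the lifting of
  curves through a submersion (\<open>submersion_lift\<close>), a consequence of the contraction principle.

  Smoothness is tested on plots, the smooth maps from subsets of a model space.  A map on a subset of a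
  manifold is smooth if and only if it sends plots in that subset to plots (\<open>smooth_map_onI_plots\<close>,
  \<open>plot_at_smooth_map\<close>), and a plot in the total space of a pulled back tangent bundle is a plot in the
  base together with a smooth vector field along it (\<open>plot_at_total_spaceD\<close>, \<open>plot_at_total_spaceI\<close>).
  Smooth vector fields along plots are preserved by differentials (\<open>field_at_differential\<close>) and by
  horizontal lifting (\<open>field_at_hlift\<close>), and the quasi actions and the homotopy are composed of these.
\<close>


section \<open>Linear algebra in model spaces\<close>

definition mbasis :: "'a::model_space set" where
  "mbasis = (SOME B. finite B \<and> (\<forall>u\<in>B. \<forall>v\<in>B. inner u v = (if u = v then 1 else 0)) \<and>
         (\<forall>x. (\<forall>u\<in>B. inner x u = 0) \<longleftrightarrow> x = 0))"

lemma mbasis: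
  shows finite_mbasis [simp]: "finite (mbasis :: 'a::model_space set)"
    and inner_mbasis: "\<lbrakk>u \<in> mbasis; v \<in> mbasis\<rbrakk> \<Longrightarrow> inner (u::'a) v = (if u = v then 1 else 0)"
    and inner_mbasis_eq_0D: "(\<And>u. u \<in> mbasis \<Longrightarrow> inner (x::'a) u = 0) \<Longrightarrow> x = 0"
proof -
  have "finite (mbasis :: 'a set) \<and>
      (\<forall>u\<in>mbasis::'a set. \<forall>v\<in>mbasis. inner u v = (if u = v then 1 else 0)) \<and>
      (\<forall>x::'a. (\<forall>u\<in>mbasis. inner x u = 0) \<longleftrightarrow> x = 0)"
    using someI_ex[OF ex_orthonormal_basis[where 'a='a]] unfolding mbasis_def .
  then show "finite (mbasis :: 'a set)"
    and "\<lbrakk>u \<in> mbasis; v \<in> mbasis\<rbrakk> \<Longrightarrow> inner (u::'a) v = (if u = v then 1 else 0)"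
    and "(\<And>u. u \<in> mbasis \<Longrightarrow> inner (x::'a) u = 0) \<Longrightarrow> x = 0"
    by auto
qed

lemma mbasis_expansion: "x = (\<Sum>b\<in>mbasis. (x \<bullet> b) *\<^sub>R b)" for x :: "'a::model_space"
proof -
  have "(x - (\<Sum>b\<in>mbasis. (x \<bullet> b) *\<^sub>R b)) \<bullet> u = 0" if u: "u \<in> mbasis" for u
  proof -
    have "(\<Sum>b\<in>mbasis. (x \<bullet> b) *\<^sub>R b) \<bullet> u = (\<Sum>b\<in>mbasis. (x \<bullet> b) * (b \<bullet> u))"
      by (simp add: inner_sum_left)
    also have "\<dots> = (\<Sum>b\<in>mbasis. if b = u then x \<bullet> b else 0)"
      by (rule sum.cong) (auto simp: inner_mbasis u)
    also have "\<dots> = x \<bullet> u"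
      using u by simp
    finally show ?thesis by (simp add: inner_diff_left)
  qed
  then have "x - (\<Sum>b\<in>mbasis. (x \<bullet> b) *\<^sub>R b) = 0"
    by (rule inner_mbasis_eq_0D)
  then show ?thesis by simp
qed

lemma linear_mbasis_expansion:
  fixes x :: "'a::model_space"
  assumes "linear f"
  shows "f x = (\<Sum>b\<in>mbasis. (x \<bullet> b) *\<^sub>R f b)"
proof -
  have "f x = f (\<Sum>b\<in>mbasis. (x \<bullet> b) *\<^sub>R b)"
    by (rule arg_cong[OF mbasis_expansion])
  also have "\<dots> = (\<Sum>b\<in>mbasis. (x \<bullet> b) *\<^sub>R f b)"
    by (simp add: linear_sum[OF assms] linear_cmul[OF assms])
  finally show ?thesis .
qed

lemma norm_le_sum_mbasis:
  fixes x :: "'a::model_space"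
  assumes "linear f"
  shows "norm (f x) \<le> (\<Sum>b\<in>mbasis. norm (f b)) * norm x"
proof -
  have "norm (f x) \<le> (\<Sum>b\<in>mbasis. norm ((x \<bullet> b) *\<^sub>R f b))"
    unfolding linear_mbasis_expansion[OF assms, of x] by (rule norm_sum)
  also have "\<dots> \<le> (\<Sum>b\<in>mbasis. norm (f b) * norm x)"
  proof (rule sum_mono)
    fix b :: 'a assume "b \<in> mbasis"
    then have "norm b = 1" by (simp add: norm_eq_sqrt_inner inner_mbasis)
    then have "\<bar>x \<bullet> b\<bar> \<le> norm x" using Cauchy_Schwarz_ineq2[of x b] by simp
    then show "norm ((x \<bullet> b) *\<^sub>R f b) \<le> norm (f b) * norm x"
      by (simp add: mult.commute[of "norm (f b)"] mult_right_mono)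
  qed
  finally show ?thesis by (simp add: sum_distrib_right)
qed

lemma linear_imp_bounded_linear:
  fixes f :: "'a::model_space \<Rightarrow> 'b::real_normed_vector"
  assumes "linear f"
  shows "bounded_linear f"
  using norm_le_sum_mbasis[OF assms]
  by (intro bounded_linear_intro[where K="\<Sum>b\<in>mbasis. norm (f b)"])
     (auto simp: linear_add[OF assms] linear_cmul[OF assms] mult.commute)

lemma complete_model_space: "complete (UNIV :: 'a::model_space set)"
proof (rule completeI)
  fix f :: "nat \<Rightarrow> 'a" assume C: "Cauchy f"
  have "convergent (\<lambda>n. f n \<bullet> b)" for b
    using C bounded_linear.Cauchy[OF bounded_linear_inner_left] real_Cauchy_convergent by blast
  then obtain l where l: "\<And>b. (\<lambda>n. f n \<bullet> b) \<longlonglongrightarrow> l b"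
    unfolding convergent_def by metis
  have "(\<lambda>n. \<Sum>b\<in>mbasis. (f n \<bullet> b) *\<^sub>R b) \<longlonglongrightarrow> (\<Sum>b\<in>mbasis. l b *\<^sub>R b)"
    by (intro tendsto_intros l)
  then show "\<exists>x\<in>UNIV. f \<longlonglongrightarrow> x"
    unfolding mbasis_expansion[symmetric] by auto
qed

text \<open>
  For surjectivity, \<open>A x = v\<close> is rewritten as the fixed point equation \<open>x = v + x - A x\<close>, whose right hand
  side is a contraction.
\<close>

lemma near_identity_imp_bij:
  fixes A :: "'a::model_space \<Rightarrow> 'a"
  assumes A: "linear A" and near: "\<And>x. norm (A x - x) \<le> norm x / 2"
  shows "bij A"
proof (rule bijI)
  show "inj A"
  proof (rule linear_injective_0[OF A, THEN iffD2], intro allI impI)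
    fix x assume "A x = 0"
    then show "x = 0" using near[of x] by simp
  qed
  show "surj A"
    unfolding surj_def
  proof
    fix v
    have "\<exists>!x\<in>UNIV. v + x - A x = x"
    proof (rule Banach_fix[OF complete_model_space, of "1/2"])
      fix x y
      have "dist (v + x - A x) (v + y - A y) = norm (A (x - y) - (x - y))"
        by (simp add: dist_norm linear_diff[OF A] norm_minus_commute algebra_simps)
      then show "dist (v + x - A x) (v + y - A y) \<le> 1 / 2 * dist x y"
        using near[of "x - y"] by (simp add: dist_norm)
    qed auto
    then show "\<exists>x. v = A x" by (metis add.commute add_diff_cancel_left' diff_add_cancel)
  qed
qed

lemma linear_right_inverse:
  fixes f :: "'a::real_vector \<Rightarrow> 'b::model_space"
  assumes "linear f" "surj f"
  obtains R where "linear R" "\<And>y. f (R y) = y"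
proof
  let ?R = "\<lambda>y. \<Sum>b\<in>mbasis. (y \<bullet> b) *\<^sub>R inv f b"
  show "linear ?R"
    by (intro linearI) (simp_all add: inner_add_left sum.distrib scaleR_add_left scaleR_sum_right)
  show "f (?R y) = y" for y
    by (simp add: linear_sum[OF assms(1)] linear_cmul[OF assms(1)] surj_f_inv_f[OF assms(2)]
        mbasis_expansion[symmetric])
qed


section \<open>Smooth functions on open sets\<close>

lemma higher_differentiable_on_cong:
  assumes "open W" "\<And>x. x \<in> W \<Longrightarrow> f x = g x" "higher_differentiable_on W f n"
  shows "higher_differentiable_on W g n"
  using assms(2,3)
proof (induction n arbitrary: f g)
  case 0 then show ?case using continuous_on_cong by fastforce
next
  case (Suc n)
  have D: "(g has_derivative frechet_derivative f (at x)) (at x)" if "x \<in> W" for x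
    using Suc.prems frechet_derivative_works has_derivative_transform_within_open[OF _ assms(1) that]
    by (metis that higher_differentiable_on.simps(2))
  then have "frechet_derivative f (at x) = frechet_derivative g (at x)" if "x \<in> W" for x
    using frechet_derivative_at that by blast
  then have "higher_differentiable_on W (\<lambda>x. frechet_derivative g (at x) v) n" for v
    using Suc.IH[of "\<lambda>x. frechet_derivative f (at x) v" "\<lambda>x. frechet_derivative g (at x) v"]
      Suc.prems by simp
  then show ?case using D by (auto simp: differentiable_def)
qed

lemma higher_differentiable_on_SucI:
  assumes "open W" "\<And>x. x \<in> W \<Longrightarrow> (f has_derivative f' x) (at x)"
    "\<And>v. higher_differentiable_on W (\<lambda>x. f' x v) n"
  shows "higher_differentiable_on W f (Suc n)"
  using assms frechet_derivative_at[OF assms(2)]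
  by (auto simp: differentiable_def intro!: higher_differentiable_on_cong[OF assms(1) _ assms(3)])

lemma higher_differentiable_on_SucD:
  "higher_differentiable_on W f (Suc n) \<Longrightarrow> higher_differentiable_on W f n"
proof (induction n arbitrary: f)
  case 0
  then show ?case
    by (auto intro!: continuous_at_imp_continuous_on differentiable_imp_continuous_within)
next
  case (Suc n) then show ?case by (metis higher_differentiable_on.simps(2))
qed

lemma higher_differentiable_on_has_derivative:
  "higher_differentiable_on W f (Suc n) \<Longrightarrow> x \<in> W \<Longrightarrow>
    (f has_derivative frechet_derivative f (at x)) (at x)"
  by (simp add: frechet_derivative_works)

lemma higher_differentiable_on_subset:
  "higher_differentiable_on W f n \<Longrightarrow> V \<subseteq> W \<Longrightarrow> higher_differentiable_on V f n"
proof (induction n arbitrary: f)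
  case 0 then show ?case by (auto intro: continuous_on_subset)
next
  case (Suc n) then show ?case by auto
qed

lemma higher_differentiable_on_const: "higher_differentiable_on W (\<lambda>_. c) n"
  by (induction n arbitrary: c) auto

lemma higher_differentiable_on_bounded_linear:
  assumes "open W" "bounded_linear L"
  shows "higher_differentiable_on W L n"
proof (cases n)
  case 0 then show ?thesis using assms(2) by (simp add: linear_continuous_on)
next
  case (Suc m)
  have "higher_differentiable_on W L (Suc m)"
    by (rule higher_differentiable_on_SucI[OF assms(1), of L "\<lambda>_. L"])
       (auto intro: bounded_linear_imp_has_derivative assms higher_differentiable_on_const)
  then show ?thesis using Suc by simp
qed

lemma higher_differentiable_on_add:
  assumes "open W"
  shows "\<lbrakk>higher_differentiable_on W f n; higher_differentiable_on W g n\<rbrakk> \<Longrightarrow>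
    higher_differentiable_on W (\<lambda>x. f x + g x) n"
proof (induction n arbitrary: f g)
  case 0 then show ?case by (auto intro: continuous_intros)
next
  case (Suc n)
  show ?case
  proof (rule higher_differentiable_on_SucI[OF assms])
    show "((\<lambda>x. f x + g x) has_derivative
      (\<lambda>v. frechet_derivative f (at x) v + frechet_derivative g (at x) v)) (at x)" if "x \<in> W" for x
      using Suc.prems that by (intro has_derivative_add) (simp_all add: frechet_derivative_works)
    show "higher_differentiable_on W
      (\<lambda>x. frechet_derivative f (at x) v + frechet_derivative g (at x) v) n" for v
      using Suc.prems by (intro Suc.IH) auto
  qed
qed

lemma higher_differentiable_on_scaleR:
  assumes "open W"
  shows "\<lbrakk>higher_differentiable_on W f n; higher_differentiable_on W g n\<rbrakk> \<Longrightarrow>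
    higher_differentiable_on W (\<lambda>x. f x *\<^sub>R g x) n"
proof (induction n arbitrary: f g)
  case 0 then show ?case by (auto intro: continuous_intros)
next
  case (Suc n)
  show ?case
  proof (rule higher_differentiable_on_SucI[OF assms])
    show "((\<lambda>x. f x *\<^sub>R g x) has_derivative
      (\<lambda>v. f x *\<^sub>R frechet_derivative g (at x) v + frechet_derivative f (at x) v *\<^sub>R g x)) (at x)"
      if "x \<in> W" for x
      using Suc.prems that by (intro has_derivative_scaleR) (simp_all add: frechet_derivative_works)
    show "higher_differentiable_on W
      (\<lambda>x. f x *\<^sub>R frechet_derivative g (at x) v + frechet_derivative f (at x) v *\<^sub>R g x) n" for v
      using Suc.prems
      by (intro higher_differentiable_on_add[OF assms] Suc.IH)
         (auto intro: higher_differentiable_on_SucD)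
  qed
qed

lemma higher_differentiable_on_sum:
  assumes "open W" "\<And>i. i \<in> I \<Longrightarrow> higher_differentiable_on W (f i) n"
  shows "higher_differentiable_on W (\<lambda>x. \<Sum>i\<in>I. f i x) n"
  using assms(2)
  by (induction I rule: infinite_finite_induct)
     (auto intro: higher_differentiable_on_const higher_differentiable_on_add[OF assms(1)])

lemma higher_differentiable_on_linear_compose:
  assumes "open W" "bounded_linear L"
  shows "higher_differentiable_on W f n \<Longrightarrow> higher_differentiable_on W (\<lambda>x. L (f x)) n"
proof (induction n arbitrary: f)
  case 0 then show ?case using bounded_linear.continuous_on[OF assms(2)] by auto
next
  case (Suc n)
  show ?case
    by (rule higher_differentiable_on_SucI[OF assms(1)])
       (use Suc in \<open>auto intro!: bounded_linear.has_derivative[OF assms(2)]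
          simp: frechet_derivative_works\<close>)
qed

text \<open>
  The chain rule expresses the derivative of the composition in a basis as a sum of products of
  \<open>C\<^sup>n\<close> functions, one factor being again a composition, so that the induction closes.
\<close>

lemma higher_differentiable_on_compose:
  assumes "open W" "open V"
  shows "\<lbrakk>higher_differentiable_on W f n; higher_differentiable_on V g n; f ` W \<subseteq> V\<rbrakk> \<Longrightarrow>
    higher_differentiable_on W (\<lambda>x. g (f x)) n"
proof (induction n arbitrary: g)
  case 0 then show ?case by (auto intro: continuous_on_compose2)
next
  case (Suc n)
  let ?D = "\<lambda>x v. \<Sum>b\<in>mbasis. (frechet_derivative f (at x) v \<bullet> b) *\<^sub>R frechet_derivative g (at (f x)) b"
  show ?case
  proof (rule higher_differentiable_on_SucI[OF assms(1)])
    fix x assume x: "x \<in> W"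
    have g: "(g has_derivative frechet_derivative g (at (f x))) (at (f x))"
      using Suc.prems x by (auto simp: frechet_derivative_works)
    have "((\<lambda>x. g (f x)) has_derivative
        (\<lambda>v. frechet_derivative g (at (f x)) (frechet_derivative f (at x) v))) (at x)"
      by (rule has_derivative_compose[of f _ x UNIV g, OF _ g])
        (use Suc.prems x in \<open>auto simp: frechet_derivative_works\<close>)
    also have "(\<lambda>v. frechet_derivative g (at (f x)) (frechet_derivative f (at x) v)) = ?D x"
      using linear_mbasis_expansion[OF has_derivative_linear[OF g]] by blast
    finally show "((\<lambda>x. g (f x)) has_derivative ?D x) (at x)" .
  next
    fix v
    show "higher_differentiable_on W (\<lambda>x. ?D x v) n"
    proof (intro higher_differentiable_on_sum[OF assms(1)] higher_differentiable_on_scaleR[OF assms(1)])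
      fix b :: 'b
      show "higher_differentiable_on W (\<lambda>x. frechet_derivative f (at x) v \<bullet> b) n"
        using Suc.prems(1)
        by (intro higher_differentiable_on_linear_compose[OF assms(1) bounded_linear_inner_left]) auto
      show "higher_differentiable_on W (\<lambda>x. frechet_derivative g (at (f x)) b) n"
        using Suc.prems higher_differentiable_on_SucD[OF Suc.prems(1)] by (intro Suc.IH) auto
    qed
  qed
qed

lemma smooth_on_imp_continuous_on: "smooth_on W f \<Longrightarrow> continuous_on W f"
  unfolding smooth_on_def by (metis higher_differentiable_on.simps(1))

lemma smooth_on_has_derivative:
  "smooth_on W f \<Longrightarrow> x \<in> W \<Longrightarrow> (f has_derivative frechet_derivative f (at x)) (at x)"
  unfolding smooth_on_def using higher_differentiable_on_has_derivative by blast

lemma smooth_on_linear_derivative: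
  "smooth_on W f \<Longrightarrow> x \<in> W \<Longrightarrow> linear (frechet_derivative f (at x))"
  using smooth_on_has_derivative has_derivative_linear by blast

lemma smooth_on_subset: "smooth_on W f \<Longrightarrow> V \<subseteq> W \<Longrightarrow> smooth_on V f"
  unfolding smooth_on_def using higher_differentiable_on_subset by blast

lemma smooth_on_cong:
  "open W \<Longrightarrow> (\<And>x. x \<in> W \<Longrightarrow> f x = g x) \<Longrightarrow> smooth_on W f \<Longrightarrow> smooth_on W g"
  unfolding smooth_on_def using higher_differentiable_on_cong by blast

lemma smooth_on_const: "smooth_on W (\<lambda>_. c)"
  unfolding smooth_on_def using higher_differentiable_on_const by blast

lemma smooth_on_bounded_linear: "open W \<Longrightarrow> bounded_linear L \<Longrightarrow> smooth_on W L"
  unfolding smooth_on_def using higher_differentiable_on_bounded_linear by blast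

lemma smooth_on_ident: "open W \<Longrightarrow> smooth_on W (\<lambda>x. x)"
  by (rule smooth_on_bounded_linear[OF _ bounded_linear_ident])

lemma smooth_on_add:
  "open W \<Longrightarrow> smooth_on W f \<Longrightarrow> smooth_on W g \<Longrightarrow> smooth_on W (\<lambda>x. f x + g x)"
  unfolding smooth_on_def using higher_differentiable_on_add by blast

lemma smooth_on_scaleR:
  "open W \<Longrightarrow> smooth_on W f \<Longrightarrow> smooth_on W g \<Longrightarrow> smooth_on W (\<lambda>x. f x *\<^sub>R g x)"
  unfolding smooth_on_def using higher_differentiable_on_scaleR by blast

lemma smooth_on_sum:
  "open W \<Longrightarrow> (\<And>i. i \<in> I \<Longrightarrow> smooth_on W (f i)) \<Longrightarrow> smooth_on W (\<lambda>x. \<Sum>i\<in>I. f i x)"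
  by (simp add: smooth_on_def higher_differentiable_on_sum)

lemma smooth_on_linear_compose:
  "open W \<Longrightarrow> bounded_linear L \<Longrightarrow> smooth_on W f \<Longrightarrow> smooth_on W (\<lambda>x. L (f x))"
  unfolding smooth_on_def using higher_differentiable_on_linear_compose by blast

lemma smooth_on_compose:
  "\<lbrakk>open W; open V; smooth_on W f; smooth_on V g; f ` W \<subseteq> V\<rbrakk> \<Longrightarrow> smooth_on W (\<lambda>x. g (f x))"
  unfolding smooth_on_def using higher_differentiable_on_compose by blast

lemma smooth_on_inner:
  "open W \<Longrightarrow> smooth_on W f \<Longrightarrow> smooth_on W (\<lambda>x. f x \<bullet> b)"
  by (rule smooth_on_linear_compose[OF _ bounded_linear_inner_left])

lemma smooth_on_diff:
  assumes "open W" "smooth_on W f" "smooth_on W g"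
  shows "smooth_on W (\<lambda>x. f x - g x)"
  using smooth_on_add[OF assms(1,2) smooth_on_scaleR[OF assms(1) smooth_on_const[of _ "-1"] assms(3)]]
  by simp

lemma smooth_on_Pair:
  assumes "open W" "smooth_on W f" "smooth_on W g"
  shows "smooth_on W (\<lambda>x. (f x, g x))"
proof -
  have 1: "bounded_linear (\<lambda>x. (x, 0::'c))" "bounded_linear (\<lambda>x. (0::'b, x))"
    using bounded_linear_Pair[OF bounded_linear_ident bounded_linear_zero]
      bounded_linear_Pair[OF bounded_linear_zero bounded_linear_ident] by simp_all
  show ?thesis
    using smooth_on_add[OF assms(1) smooth_on_linear_compose[OF assms(1) 1(1) assms(2)]
        smooth_on_linear_compose[OF assms(1) 1(2) assms(3)]]
    by simp
qed

text \<open>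
  This is smoothness of the tangent map of \<open>F\<close>, the base point and the vector both being variable.
\<close>

lemma smooth_on_derivative_apply:
  assumes "open W" "open V" "smooth_on V F" "smooth_on W f" "smooth_on W g" "f ` W \<subseteq> V"
  shows "smooth_on W (\<lambda>x. frechet_derivative F (at (f x)) (g x))"
proof (rule smooth_on_cong[OF assms(1)])
  show "(\<Sum>b\<in>mbasis. (g x \<bullet> b) *\<^sub>R frechet_derivative F (at (f x)) b) =
      frechet_derivative F (at (f x)) (g x)" if "x \<in> W" for x
    by (rule linear_mbasis_expansion[symmetric], rule smooth_on_linear_derivative[OF assms(3)])
      (use that assms(6) in auto)
  have "smooth_on V (\<lambda>x. frechet_derivative F (at x) b)" for b
    using assms(3) unfolding smooth_on_def by (metis higher_differentiable_on.simps(2))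
  then show "smooth_on W (\<lambda>x. \<Sum>b\<in>mbasis. (g x \<bullet> b) *\<^sub>R frechet_derivative F (at (f x)) b)"
    by (intro smooth_on_sum smooth_on_scaleR smooth_on_inner assms
        smooth_on_compose[OF assms(1,2,4) _ assms(6)])
qed


section \<open>Inverses of smooth families of linear maps\<close>

text \<open>
  The product rule at a zero of \<open>g\<close>, where the factor \<open>c\<close> only has to be continuous.  It is applied to
  a factor whose differentiability is still to be shown.
\<close>

lemma has_derivative_scaleR_vanishing:
  fixes c :: "'a::real_normed_vector \<Rightarrow> real"
  assumes c: "isCont c x" and g: "(g has_derivative D) (at x)" and "g x = 0"
  shows "((\<lambda>y. c y *\<^sub>R g y) has_derivative (\<lambda>h. c x *\<^sub>R D h)) (at x)"
  unfolding has_derivative_iff_norm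
proof
  have D: "bounded_linear D" using g by (rule has_derivative_bounded_linear)
  then show "bounded_linear (\<lambda>h. c x *\<^sub>R D h)" by (rule bounded_linear_const_scaleR)
  obtain K where K: "\<And>h. norm (D h) \<le> norm h * K" using bounded_linear.bounded[OF D] by blast
  let ?q = "\<lambda>y. norm (g y - g x - D (y - x)) / norm (y - x)"
  show "(\<lambda>y. norm (c y *\<^sub>R g y - c x *\<^sub>R g x - c x *\<^sub>R D (y - x)) / norm (y - x)) \<midarrow>x\<rightarrow> 0"
  proof (rule Lim_null_comparison)
    have "?q \<midarrow>x\<rightarrow> 0" using g unfolding has_derivative_iff_norm by blast
    then have "(\<lambda>y. \<bar>c y\<bar> * ?q y + \<bar>c y - c x\<bar> * K) \<midarrow>x\<rightarrow> \<bar>c x\<bar> * 0 + \<bar>c x - c x\<bar> * K"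
      using c unfolding isCont_def
      by (intro tendsto_add tendsto_mult tendsto_rabs tendsto_diff tendsto_const)
    then show "(\<lambda>y. \<bar>c y\<bar> * ?q y + \<bar>c y - c x\<bar> * K) \<midarrow>x\<rightarrow> 0" by simp
    have "norm (c y *\<^sub>R g y - c x *\<^sub>R g x - c x *\<^sub>R D (y - x)) / norm (y - x)
        \<le> \<bar>c y\<bar> * ?q y + \<bar>c y - c x\<bar> * K" if "y \<noteq> x" for y
    proof -
      have "c y *\<^sub>R g y - c x *\<^sub>R g x - c x *\<^sub>R D (y - x)
          = c y *\<^sub>R (g y - g x - D (y - x)) + (c y - c x) *\<^sub>R D (y - x)"
        by (simp add: assms(3) algebra_simps)
      then have "norm (c y *\<^sub>R g y - c x *\<^sub>R g x - c x *\<^sub>R D (y - x))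
          \<le> \<bar>c y\<bar> * norm (g y - g x - D (y - x)) + \<bar>c y - c x\<bar> * norm (D (y - x))"
        by (metis norm_scaleR norm_triangle_ineq)
      also have "\<dots> \<le> \<bar>c y\<bar> * norm (g y - g x - D (y - x)) + \<bar>c y - c x\<bar> * (norm (y - x) * K)"
        by (intro add_left_mono mult_left_mono K) simp
      finally show ?thesis using that by (simp add: field_simps)
    qed
    then show "\<forall>\<^sub>F y in at x. norm (norm (c y *\<^sub>R g y - c x *\<^sub>R g x - c x *\<^sub>R D (y - x)) / norm (y - x))
        \<le> \<bar>c y\<bar> * ?q y + \<bar>c y - c x\<bar> * K"
      by (auto simp: eventually_at_filter)
  qed
qed

context
  fixes W :: "'z::model_space set" and A :: "'z \<Rightarrow> 'a::model_space \<Rightarrow> 'a"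
  assumes W: "open W"
    and lin: "\<And>y. y \<in> W \<Longrightarrow> linear (A y)"
    and bij: "\<And>y. y \<in> W \<Longrightarrow> bij (A y)"
    and sm: "\<And>v. smooth_on W (\<lambda>y. A y v)"
begin

lemma linear_inverse_family:
  assumes "y \<in> W"
  shows "linear (inv (A y))"
proof (rule linearI)
  have s: "surj (A y)" and i: "inj (A y)" using bij[OF assms] by (auto simp: bij_def)
  show "inv (A y) (u + v) = inv (A y) u + inv (A y) v" for u v
    by (rule inv_f_eq[OF i]) (simp add: linear_add[OF lin[OF assms]] surj_f_inv_f[OF s])
  show "inv (A y) (r *\<^sub>R v) = r *\<^sub>R inv (A y) v" for r v
    by (rule inv_f_eq[OF i]) (simp add: linear_cmul[OF lin[OF assms]] surj_f_inv_f[OF s])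
qed

text \<open>
  The resolvent identity for \<open>inv (A y) - inv (A z)\<close>, written in a basis.  Continuity and the derivative
  of the inverse at \<open>z\<close> are both read off from it, because the factor \<open>inv (A z) (A y b - A z b)\<close> depends
  on \<open>y\<close> through \<open>A y\<close> alone and vanishes at \<open>z\<close>.
\<close>

lemma inverse_family_resolvent:
  assumes y: "y \<in> W" and z: "z \<in> W"
  shows "inv (A y) v = inv (A z) v
    - (\<Sum>b\<in>mbasis. (inv (A y) v \<bullet> b) *\<^sub>R inv (A z) (A y b - A z b))"
proof -
  let ?w = "inv (A y) v"
  have v: "A y ?w = v" using bij[OF y] by (simp add: bij_is_surj surj_f_inv_f)
  have "linear (\<lambda>w. inv (A z) (A y w - A z w))"
    using linear_compose[OF linear_compose_sub[OF lin[OF y] lin[OF z]] linear_inverse_family[OF z]]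
    by (simp add: o_def)
  then have "(\<Sum>b\<in>mbasis. (?w \<bullet> b) *\<^sub>R inv (A z) (A y b - A z b)) = inv (A z) (A y ?w - A z ?w)"
    using linear_mbasis_expansion[of "\<lambda>w. inv (A z) (A y w - A z w)" ?w] by simp
  also have "\<dots> = inv (A z) v - ?w"
    using bij[OF z] by (simp add: v linear_diff[OF linear_inverse_family[OF z]] bij_is_inj)
  finally show ?thesis by simp
qed

lemma inverse_family_increment_has_derivative:
  assumes z: "z \<in> W"
  shows "((\<lambda>y. inv (A z) (A y b - A z b)) has_derivative
    (\<lambda>h. inv (A z) (frechet_derivative (\<lambda>y. A y b) (at z) h))) (at z)"
proof -
  have "((\<lambda>y. A y b - A z b) has_derivative frechet_derivative (\<lambda>y. A y b) (at z)) (at z)"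
    using has_derivative_diff[OF smooth_on_has_derivative[OF sm[of b] z] has_derivative_const[of "A z b"]]
    by simp
  then show ?thesis
    by (rule bounded_linear.has_derivative[OF
          linear_imp_bounded_linear[OF linear_inverse_family[OF z]]])
qed

lemma isCont_inverse_family:
  assumes z: "z \<in> W"
  shows "isCont (\<lambda>y. inv (A y) v) z"
proof -
  let ?w = "\<lambda>y. inv (A y) v" and ?g = "\<lambda>b y. inv (A z) (A y b - A z b)"
  let ?e = "\<lambda>y. \<Sum>b\<in>mbasis. norm (?g b y)"
  have g: "isCont (?g b) z" for b
    using has_derivative_continuous[OF inverse_family_increment_has_derivative[OF z]] .
  have e: "?e \<midarrow>z\<rightarrow> 0"
  proof -
    have "(\<lambda>y. norm (?g b y)) \<midarrow>z\<rightarrow> norm (?g b z)" for b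
      using g[of b] unfolding isCont_def by (rule tendsto_norm)
    then have "?e \<midarrow>z\<rightarrow> (\<Sum>b\<in>mbasis. norm (?g b z))" by (rule tendsto_sum)
    then show ?thesis by (simp add: linear_0[OF linear_inverse_family[OF z]])
  qed
  have bound: "norm (?w y - ?w z) \<le> norm (?w y) * ?e y" if "y \<in> W" for y
  proof -
    have "norm (?w y - ?w z) = norm (\<Sum>b\<in>mbasis. (?w y \<bullet> b) *\<^sub>R ?g b y)"
      by (subst inverse_family_resolvent[OF that z]) (simp add: norm_minus_commute)
    also have "\<dots> \<le> (\<Sum>b\<in>mbasis. norm (?w y) * norm (?g b y))"
    proof (rule order_trans[OF norm_sum], rule sum_mono)
      fix b :: 'a assume "b \<in> mbasis"
      then have "norm b = 1" by (simp add: norm_eq_sqrt_inner inner_mbasis)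
      then have "\<bar>?w y \<bullet> b\<bar> \<le> norm (?w y)" using Cauchy_Schwarz_ineq2[of "?w y" b] by simp
      then show "norm ((?w y \<bullet> b) *\<^sub>R ?g b y) \<le> norm (?w y) * norm (?g b y)"
        by (simp add: mult_right_mono)
    qed
    finally show ?thesis by (simp add: sum_distrib_left)
  qed
  have "(\<lambda>y. ?w y - ?w z) \<midarrow>z\<rightarrow> 0"
  proof (rule Lim_null_comparison)
    show "(\<lambda>y. 2 * norm (?w z) * ?e y) \<midarrow>z\<rightarrow> 0"
      using tendsto_mult_right_zero[OF e] .
    have "\<forall>\<^sub>F y in at z. ?e y < 1 / 2" using e by (rule order_tendstoD) simp
    moreover have "\<forall>\<^sub>F y in at z. y \<in> W" using W z by (rule eventually_at_in_open')
    ultimately show "\<forall>\<^sub>F y in at z. norm (?w y - ?w z) \<le> 2 * norm (?w z) * ?e y"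
    proof eventually_elim
      case (elim y)
      have e0: "0 \<le> ?e y" by (simp add: sum_nonneg)
      have "norm (?w y) * ?e y \<le> norm (?w y) * (1 / 2)"
        using elim(1) by (intro mult_left_mono) auto
      then have "norm (?w y) \<le> 2 * norm (?w z)"
        using bound[OF elim(2)] norm_triangle_sub[of "?w y" "?w z"] by simp
      then have "norm (?w y) * ?e y \<le> 2 * norm (?w z) * ?e y"
        using e0 by (rule mult_right_mono)
      then show ?case using bound[OF elim(2)] by simp
    qed
  qed
  then show ?thesis unfolding isCont_def by (simp add: LIM_zero_iff)
qed

lemma inverse_family_has_derivative:
  assumes z: "z \<in> W"
  shows "((\<lambda>y. inv (A y) v) has_derivative (\<lambda>h. - (\<Sum>b\<in>mbasis.
    (inv (A z) v \<bullet> b) *\<^sub>R inv (A z) (frechet_derivative (\<lambda>y. A y b) (at z) h)))) (at z)"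
proof (rule has_derivative_transform_within_open[OF _ W z])
  show "((\<lambda>y. inv (A z) v - (\<Sum>b\<in>mbasis. (inv (A y) v \<bullet> b) *\<^sub>R inv (A z) (A y b - A z b)))
    has_derivative (\<lambda>h. - (\<Sum>b\<in>mbasis.
    (inv (A z) v \<bullet> b) *\<^sub>R inv (A z) (frechet_derivative (\<lambda>y. A y b) (at z) h)))) (at z)"
    by (rule has_derivative_eq_rhs[OF has_derivative_diff[OF has_derivative_const
          has_derivative_sum[OF has_derivative_scaleR_vanishing[OF _
              inverse_family_increment_has_derivative[OF z]]]]])
       (auto simp: linear_0[OF linear_inverse_family[OF z]] intro!: isCont_inverse_family[OF z]
          continuous_intros)
qed (rule inverse_family_resolvent[OF _ z, symmetric])

text \<open>
  The derivative of the inverse is a polynomial in values of the inverse and derivatives of \<open>A\<close>, so that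
  smoothness of order \<open>n\<close> implies smoothness of order \<open>n + 1\<close>.
\<close>

lemma smooth_on_inverse_family: "smooth_on W (\<lambda>y. inv (A y) v)"
proof -
  have "\<forall>v. higher_differentiable_on W (\<lambda>y. inv (A y) v) n" for n
  proof (induction n)
    case 0
    then show ?case by (auto intro!: continuous_at_imp_continuous_on isCont_inverse_family)
  next
    case (Suc n)
    let ?D = "\<lambda>b z h. frechet_derivative (\<lambda>y. A y b) (at z) h"
    have D: "higher_differentiable_on W (\<lambda>z. ?D b z h) n" for b h
      using sm[of b] unfolding smooth_on_def by (metis higher_differentiable_on.simps(2))
    show ?case
    proof
      fix v
      have lc: "\<And>L f. bounded_linear L \<Longrightarrow> higher_differentiable_on W f n \<Longrightarrow>
          higher_differentiable_on W (\<lambda>x. L (f x)) n"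
        by (rule higher_differentiable_on_linear_compose[OF W])
      show "higher_differentiable_on W (\<lambda>y. inv (A y) v) (Suc n)"
      proof (rule higher_differentiable_on_SucI[OF W])
        fix z assume z: "z \<in> W"
        have "(\<lambda>h. - (\<Sum>b\<in>mbasis. (inv (A z) v \<bullet> b) *\<^sub>R inv (A z) (?D b z h))) =
          (\<lambda>h. \<Sum>b\<in>mbasis. (inv (A z) v \<bullet> - b) *\<^sub>R (\<Sum>c\<in>mbasis. (?D b z h \<bullet> c) *\<^sub>R inv (A z) c))"
          by (simp add: linear_mbasis_expansion[OF linear_inverse_family[OF z], symmetric] sum_negf)
        then show "((\<lambda>y. inv (A y) v) has_derivative (\<lambda>h. \<Sum>b\<in>mbasis. (inv (A z) v \<bullet> - b) *\<^sub>R
            (\<Sum>c\<in>mbasis. (?D b z h \<bullet> c) *\<^sub>R inv (A z) c))) (at z)"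
          using inverse_family_has_derivative[OF z, of v] by simp
      next
        fix h
        show "higher_differentiable_on W (\<lambda>z. \<Sum>b\<in>mbasis. (inv (A z) v \<bullet> - b) *\<^sub>R
            (\<Sum>c\<in>mbasis. (?D b z h \<bullet> c) *\<^sub>R inv (A z) c)) n"
          using Suc by (intro higher_differentiable_on_sum[OF W] higher_differentiable_on_scaleR[OF W]
              lc[OF bounded_linear_inner_left] D) auto
      qed
    qed
  qed
  then show ?thesis unfolding smooth_on_def by blast
qed

end


section \<open>Lifting curves through a submersion\<close>

text \<open>
  The derivative is continuous in operator norm, and the mean value inequality is applied to \<open>F\<close> minus its
  derivative at \<open>x\<close>.
\<close>

lemma smooth_on_strictly_differentiable:
  fixes F :: "'a::model_space \<Rightarrow> 'b::model_space"
  assumes W: "open W" "x \<in> W" and F: "smooth_on W F" and "\<epsilon> > 0"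
  obtains r where "r > 0" "ball x r \<subseteq> W"
    "\<And>u u'. u \<in> ball x r \<Longrightarrow> u' \<in> ball x r \<Longrightarrow>
      norm (F u - F u' - frechet_derivative F (at x) (u - u')) \<le> \<epsilon> * norm (u - u')"
proof -
  let ?D = "\<lambda>u. frechet_derivative F (at u)"
  have "smooth_on W (\<lambda>u. ?D u b)" for b
    by (rule smooth_on_derivative_apply[OF W(1) W(1) F smooth_on_ident[OF W(1)] smooth_on_const]) auto
  then have "isCont (\<lambda>u. ?D u b) x" for b
    using smooth_on_imp_continuous_on W by (metis continuous_on_eq_continuous_at)
  then have "(\<lambda>u. \<Sum>b\<in>mbasis. norm (?D u b - ?D x b)) \<midarrow>x\<rightarrow> (\<Sum>b\<in>mbasis. norm (?D x b - ?D x b))"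
    unfolding isCont_def by (intro tendsto_intros)
  then have "\<forall>\<^sub>F u in at x. (\<Sum>b\<in>mbasis. norm (?D u b - ?D x b)) < \<epsilon>"
    using \<open>\<epsilon> > 0\<close> by (intro order_tendstoD) auto
  then have "\<forall>\<^sub>F u in nhds x. (\<Sum>b\<in>mbasis. norm (?D u b - ?D x b)) < \<epsilon>"
    using \<open>\<epsilon> > 0\<close> by (simp add: eventually_nhds_conv_at)
  moreover have "\<forall>\<^sub>F u in nhds x. u \<in> W" using W by (rule eventually_nhds_in_open)
  ultimately have "\<forall>\<^sub>F u in nhds x. u \<in> W \<and> (\<Sum>b\<in>mbasis. norm (?D u b - ?D x b)) < \<epsilon>"
    by eventually_elim simp
  then obtain r where r: "r > 0"
      "\<And>u. u \<in> ball x r \<Longrightarrow> u \<in> W \<and> (\<Sum>b\<in>mbasis. norm (?D u b - ?D x b)) < \<epsilon>"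
    unfolding eventually_nhds_metric by (metis dist_commute mem_ball)
  have linx: "bounded_linear (?D x)"
    using smooth_on_linear_derivative[OF F W(2)] by (rule linear_imp_bounded_linear)
  have "norm ((F u - ?D x u) - (F u' - ?D x u')) \<le> \<epsilon> * norm (u - u')"
    if u: "u \<in> ball x r" "u' \<in> ball x r" for u u'
  proof (rule differentiable_bound[of "ball x r" _ "\<lambda>u v. ?D u v - ?D x v"])
    fix y assume y: "y \<in> ball x r"
    show "((\<lambda>u. F u - ?D x u) has_derivative (\<lambda>v. ?D y v - ?D x v)) (at y within ball x r)"
      by (rule has_derivative_diff[OF has_derivative_at_withinI[OF smooth_on_has_derivative[OF F]]
            bounded_linear_imp_has_derivative[OF linx]]) (use r(2)[OF y] in blast)
    have lin: "linear (\<lambda>v. ?D y v - ?D x v)"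
      using r(2)[OF y] smooth_on_linear_derivative[OF F] W(2) by (intro linear_compose_sub) auto
    show "onorm (\<lambda>v. ?D y v - ?D x v) \<le> \<epsilon>"
    proof (rule onorm_bound)
      fix v
      have "norm (?D y v - ?D x v) \<le> (\<Sum>b\<in>mbasis. norm (?D y b - ?D x b)) * norm v"
        by (rule norm_le_sum_mbasis[OF lin])
      also have "\<dots> \<le> \<epsilon> * norm v" using r(2)[OF y] by (intro mult_right_mono) auto
      finally show "norm (?D y v - ?D x v) \<le> \<epsilon> * norm v" .
    qed (use \<open>\<epsilon> > 0\<close> in simp)
  qed (use u in auto)
  then have "norm (F u - F u' - ?D x (u - u')) \<le> \<epsilon> * norm (u - u')"
    if "u \<in> ball x r" "u' \<in> ball x r" for u u'
    using that by (simp add: linear_diff[OF bounded_linear.linear[OF linx]] algebra_simps)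
  moreover have "ball x r \<subseteq> W" using r(2) by blast
  ultimately show ?thesis
    using that r(1) by blast
qed

lemma has_vector_derivative_zero_comparison:
  fixes f :: "real \<Rightarrow> 'a::real_normed_vector" and g :: "real \<Rightarrow> 'b::real_normed_vector"
  assumes g: "(g has_vector_derivative 0) (at 0)" "g 0 = 0" and "f 0 = 0"
    and le: "\<forall>\<^sub>F t in nhds 0. norm (f t) \<le> C * norm (g t)"
  shows "(f has_vector_derivative 0) (at 0)"
proof -
  have "(\<lambda>t. norm (g t) / norm t) \<midarrow>0\<rightarrow> 0"
    using g unfolding has_vector_derivative_def has_derivative_iff_norm by simp
  then have "(\<lambda>t. C * (norm (g t) / norm t)) \<midarrow>0\<rightarrow> 0" by (rule tendsto_mult_right_zero)
  then have "(\<lambda>t. norm (f t) / norm t) \<midarrow>0\<rightarrow> 0"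
  proof (rule Lim_null_comparison[rotated])
    show "\<forall>\<^sub>F t in at 0. norm (norm (f t) / norm t) \<le> C * (norm (g t) / norm t)"
      using le by (auto simp: eventually_at_filter divide_right_mono elim!: eventually_mono)
  qed
  then show ?thesis
    using assms(3) unfolding has_vector_derivative_def has_derivative_iff_norm by simp
qed

text \<open>
  With a linear right inverse \<open>R\<close> of the derivative, the curve is sought in the form \<open>x + tv + R z(t)\<close>.  The
  equation for \<open>z(t)\<close> is a fixed point problem for a contraction on a ball whose radius is twice the
  error \<open>E t\<close> of the uncorrected curve \<open>x + tv\<close>.  As \<open>E t = o(t)\<close>, the correction does not change the
  velocity.
\<close>

lemma curve_lift:
  fixes F :: "'a::model_space \<Rightarrow> 'b::model_space"
  assumes W: "open W" "x \<in> W" and F: "smooth_on W F"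
    and surj: "surj (frechet_derivative F (at x))"
    and y: "y 0 = F x" "(y has_vector_derivative frechet_derivative F (at x) v) (at 0)"
  obtains c where "c 0 = x" "(c has_vector_derivative v) (at 0)"
    "\<forall>\<^sub>F t in nhds 0. c t \<in> W \<and> F (c t) = y t"
proof -
  let ?D = "frechet_derivative F (at x)"
  have linD: "linear ?D" by (rule smooth_on_linear_derivative[OF F W(2)])
  obtain R where R: "linear R" "\<And>y. ?D (R y) = y"
    using linear_right_inverse[OF linD surj] by blast
  have bR: "bounded_linear R" by (rule linear_imp_bounded_linear[OF R(1)])
  obtain K where K: "K > 0" "\<And>z. norm (R z) \<le> norm z * K"
    using bounded_linear.pos_bounded[OF bR] by blast
  obtain r where r: "r > 0" "ball x r \<subseteq> W" and strict: "\<And>u u'. u \<in> ball x r \<Longrightarrow> u' \<in> ball x r \<Longrightarrow>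
      norm (F u - F u' - ?D (u - u')) \<le> (1 / (2 * K)) * norm (u - u')"
    using smooth_on_strictly_differentiable[OF W F, of "1 / (2 * K)"] K(1) by auto
  define E where "E t = F (x + t *\<^sub>R v) - y t" for t
  have E0: "E 0 = 0" by (simp add: E_def y)
  have dE: "(E has_vector_derivative 0) (at 0)"
  proof -
    have "((\<lambda>t. x + t *\<^sub>R v) has_vector_derivative v) (at 0)"
      by (auto intro!: derivative_eq_intros)
    moreover have "(F has_derivative ?D) (at (x + 0 *\<^sub>R v))"
      using smooth_on_has_derivative[OF F W(2)] by simp
    ultimately have "((\<lambda>t. F (x + t *\<^sub>R v)) has_vector_derivative ?D v) (at 0)"
      using vector_derivative_diff_chain_within[of "\<lambda>t. x + t *\<^sub>R v" v 0 UNIV F ?D]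
      by (simp add: o_def has_derivative_at_withinI)
    from has_vector_derivative_diff[OF this y(2)] show ?thesis by (simp add: E_def[abs_def])
  qed
  have small: "\<forall>\<^sub>F t in nhds 0. norm (t *\<^sub>R v) + K * (2 * norm (E t)) < r"
  proof -
    have "isCont E 0"
      using dE has_vector_derivative_continuous by blast
    then have "((\<lambda>t. norm (t *\<^sub>R v) + K * (2 * norm (E t))) \<longlongrightarrow> 0) (at 0)"
      unfolding isCont_def E0 by (auto intro!: tendsto_eq_intros)
    then have "\<forall>\<^sub>F t in at 0. norm (t *\<^sub>R v) + K * (2 * norm (E t)) < r"
      using r(1) by (rule order_tendstoD)
    then show ?thesis using r(1) by (simp add: eventually_nhds_conv_at E0)
  qed
  have fix_point: "\<exists>z. norm z \<le> 2 * norm (E t) \<and> x + t *\<^sub>R v + R z \<in> W \<and> F (x + t *\<^sub>R v + R z) = y t"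
    if t: "norm (t *\<^sub>R v) + K * (2 * norm (E t)) < r" for t
  proof -
    let ?S = "cball (0::'b) (2 * norm (E t))" and ?u = "\<lambda>z. x + t *\<^sub>R v + R z"
    let ?T = "\<lambda>z. z - (F (?u z) - y t)"
    have u: "?u z \<in> ball x r" if "z \<in> ?S" for z
    proof -
      have "norm (t *\<^sub>R v + R z) \<le> norm (t *\<^sub>R v) + norm (R z)" by (rule norm_triangle_ineq)
      also have "norm (R z) \<le> K * (2 * norm (E t))"
        using K(2)[of z] that K(1) by (simp add: mult.commute mult_left_mono order_trans)
      finally have "norm (t *\<^sub>R v + R z) < r" using t by simp
      then show ?thesis by (metis add.assoc add_diff_cancel_left' dist_commute dist_norm mem_ball)
    qed
    have lip: "norm (?T z - ?T z') \<le> 1 / 2 * norm (z - z')" if "z \<in> ?S" "z' \<in> ?S" for z z'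
    proof -
      have "?D (?u z - ?u z') = z - z'"
        using R by (simp add: linear_diff[OF R(1), symmetric])
      then have "?T z - ?T z' = - (F (?u z) - F (?u z') - ?D (?u z - ?u z'))"
        by simp
      then have "norm (?T z - ?T z') = norm (F (?u z) - F (?u z') - ?D (?u z - ?u z'))"
        by (simp only: norm_minus_cancel)
      also have "\<dots> \<le> 1 / (2 * K) * norm (?u z - ?u z')"
        by (rule strict[OF u[OF that(1)] u[OF that(2)]])
      also have "\<dots> = 1 / (2 * K) * norm (R (z - z'))" by (simp add: linear_diff[OF R(1)])
      also have "\<dots> \<le> 1 / (2 * K) * (norm (z - z') * K)"
        using K by (intro mult_left_mono) auto
      finally show ?thesis using K(1) by simp
    qed
    have T0: "?T 0 = - E t" by (simp add: E_def linear_0[OF R(1)])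
    have "\<exists>!z\<in>?S. ?T z = z"
    proof (rule Banach_fix[of _ "1/2"])
      show "complete ?S"
        using complete_Int_closed[OF complete_model_space closed_cball, of "0::'b" "2 * norm (E t)"] by simp
      show "?T ` ?S \<subseteq> ?S"
      proof
        fix q assume "q \<in> ?T ` ?S"
        then obtain z where z: "z \<in> ?S" "q = ?T z" by blast
        have "norm (?T z) \<le> norm (?T z - ?T 0) + norm (?T 0)"
          by (metis diff_add_cancel norm_triangle_ineq)
        also have "\<dots> \<le> 1 / 2 * norm z + norm (E t)"
          using lip[OF z(1), of 0] by (simp only: T0) simp
        also have "\<dots> \<le> 2 * norm (E t)" using z by simp
        finally show "q \<in> ?S" using z by simp
      qed
    qed (use lip in \<open>auto simp: dist_norm\<close>)
    then obtain z where "z \<in> ?S" "?T z = z" by blast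
    then show ?thesis using u[of z] r(2) by (intro exI[of _ z]) auto
  qed
  define z where "z t = (SOME z. norm z \<le> 2 * norm (E t) \<and> x + t *\<^sub>R v + R z \<in> W \<and>
      F (x + t *\<^sub>R v + R z) = y t)" for t
  have z: "\<forall>\<^sub>F t in nhds 0. norm (z t) \<le> 2 * norm (E t) \<and> x + t *\<^sub>R v + R (z t) \<in> W \<and>
      F (x + t *\<^sub>R v + R (z t)) = y t"
    using small by (rule eventually_mono) (unfold z_def, rule someI_ex, rule fix_point)
  have z0: "z 0 = 0" using eventually_nhds_x_imp_x[OF z] by (simp add: E0)
  have dRz: "((\<lambda>t. R (z t)) has_vector_derivative 0) (at 0)"
  proof (rule has_vector_derivative_zero_comparison[OF dE E0])
    show "R (z 0) = 0" by (simp add: z0 linear_0[OF R(1)])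
    have "norm (R (z t)) \<le> 2 * K * norm (E t)" if "norm (z t) \<le> 2 * norm (E t)" for t
      using order_trans[OF K(2) mult_right_mono[OF that, of K]] K(1) by (simp add: algebra_simps)
    then show "\<forall>\<^sub>F t in nhds 0. norm (R (z t)) \<le> 2 * K * norm (E t)"
      using z by (auto elim: eventually_mono)
  qed
  show ?thesis
  proof (rule that[of "\<lambda>t. x + t *\<^sub>R v + R (z t)"])
    show "((\<lambda>t. x + t *\<^sub>R v + R (z t)) has_vector_derivative v) (at 0)"
      by (auto intro!: derivative_eq_intros dRz)
    show "\<forall>\<^sub>F t in nhds 0. x + t *\<^sub>R v + R (z t) \<in> W \<and> F (x + t *\<^sub>R v + R (z t)) = y t"
      using z by eventually_elim simp
  qed (simp add: z0 linear_0[OF R(1)])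
qed


section \<open>Charts and tangent vectors\<close>

text \<open>
  The local part of the definition of a smooth manifold, on which the calculus of differentials is based.
  It is isolated because it passes to products chart by chart.
\<close>

definition charted_space :: "('a, 'e::model_space) manifold \<Rightarrow> bool" where
  "charted_space M \<longleftrightarrow>
     (\<forall>(U, \<phi>)\<in>atlas M. U \<subseteq> carrier M \<and> inj_on \<phi> U \<and> open (\<phi> ` U)) \<and>
     (\<forall>(U, \<phi>)\<in>atlas M. \<forall>(V, \<psi>)\<in>atlas M.
        open (\<phi> ` (U \<inter> V)) \<and> smooth_on (\<phi> ` (U \<inter> V)) (\<lambda>x. \<psi> (inv_into U \<phi> x))) \<and>
     (\<forall>p\<in>carrier M. chart_at M p \<in> atlas M \<and> p \<in> fst (chart_at M p))"

abbreviation chart_deriv :: "('a, 'e::model_space) manifold \<Rightarrow> 'a set \<Rightarrow> ('a \<Rightarrow> 'e) \<Rightarrow> 'a \<Rightarrow> 'e \<Rightarrow> 'e" where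
  "chart_deriv M U \<phi> p \<equiv> differential_on M model_manifold U \<phi> p"

abbreviation transition :: "'a set \<Rightarrow> ('a \<Rightarrow> 'e) \<Rightarrow> ('a \<Rightarrow> 'e) \<Rightarrow> 'e \<Rightarrow> 'e" where
  "transition U \<phi> \<psi> \<equiv> (\<lambda>x. \<psi> (inv_into U \<phi> x))"

lemma charted_spaceI:
  assumes "\<And>U \<phi>. (U, \<phi>) \<in> atlas M \<Longrightarrow> U \<subseteq> carrier M \<and> inj_on \<phi> U \<and> open (\<phi> ` U)"
    and "\<And>U \<phi> V \<psi>. (U, \<phi>) \<in> atlas M \<Longrightarrow> (V, \<psi>) \<in> atlas M \<Longrightarrow>
      open (\<phi> ` (U \<inter> V)) \<and> smooth_on (\<phi> ` (U \<inter> V)) (transition U \<phi> \<psi>)"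
    and "\<And>p. p \<in> carrier M \<Longrightarrow> chart_at M p \<in> atlas M \<and> p \<in> fst (chart_at M p)"
  shows "charted_space M"
  using assms unfolding charted_space_def by auto

lemma smooth_manifold_imp_charted_space: "smooth_manifold M \<Longrightarrow> charted_space M"
  unfolding smooth_manifold_def charted_space_def by (elim conjE) (intro conjI; assumption)

lemma
  assumes "charted_space M" "(U, \<phi>) \<in> atlas M"
  shows chart_subset_carrier: "U \<subseteq> carrier M"
    and chart_inj_on: "inj_on \<phi> U"
    and chart_open_image: "open (\<phi> ` U)"
  using assms unfolding charted_space_def by auto

lemma
  assumes "charted_space M" "(U, \<phi>) \<in> atlas M" "(V, \<psi>) \<in> atlas M"
  shows chart_open_overlap: "open (\<phi> ` (U \<inter> V))"
    and smooth_on_transition: "smooth_on (\<phi> ` (U \<inter> V)) (transition U \<phi> \<psi>)"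
  using assms unfolding charted_space_def by (blast dest: bspec)+

lemma chart_at_cases:
  assumes "charted_space M" "p \<in> carrier M"
  obtains U \<phi> where "chart_at M p = (U, \<phi>)" "(U, \<phi>) \<in> atlas M" "p \<in> U"
  using assms unfolding charted_space_def by (metis prod.collapse)

lemma transition_image:
  assumes "charted_space M" "(U, \<phi>) \<in> atlas M" "p \<in> U"
  shows "inv_into U \<phi> (\<phi> p) = p"
  using chart_inj_on[OF assms(1,2)] assms(3) by simp

lemma transition_has_derivative:
  assumes "charted_space M" "(U, \<phi>) \<in> atlas M" "(V, \<psi>) \<in> atlas M" "p \<in> U" "p \<in> V"
  shows "(transition U \<phi> \<psi> has_derivative frechet_derivative (transition U \<phi> \<psi>) (at (\<phi> p))) (at (\<phi> p))"
  using smooth_on_has_derivative[OF smooth_on_transition[OF assms(1-3)]] assms(4,5) by blast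

text \<open>
  The chain rule for \<open>\<zeta>\<phi>\<inverse> = (\<zeta>\<psi>\<inverse>)(\<psi>\<phi>\<inverse>)\<close>.
\<close>

lemma transition_cocycle:
  assumes M: "charted_space M" and U: "(U, \<phi>) \<in> atlas M" and V: "(V, \<psi>) \<in> atlas M"
    and Z: "(Z, \<zeta>) \<in> atlas M" and p: "p \<in> U" "p \<in> V" "p \<in> Z"
  shows "frechet_derivative (transition U \<phi> \<zeta>) (at (\<phi> p)) =
    frechet_derivative (transition V \<psi> \<zeta>) (at (\<psi> p)) \<circ> frechet_derivative (transition U \<phi> \<psi>) (at (\<phi> p))"
proof -
  let ?D = "frechet_derivative (transition V \<psi> \<zeta>) (at (\<psi> p)) \<circ>
    frechet_derivative (transition U \<phi> \<psi>) (at (\<phi> p))"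
  have "((transition V \<psi> \<zeta> \<circ> transition U \<phi> \<psi>) has_derivative ?D) (at (\<phi> p))"
    by (rule diff_chain_at[OF transition_has_derivative[OF M U V p(1,2)]])
       (use transition_has_derivative[OF M V Z p(2,3)] transition_image[OF M U p(1)] in simp)
  then have "(transition U \<phi> \<zeta> has_derivative ?D) (at (\<phi> p))"
  proof (rule has_derivative_transform_within_open[OF _ chart_open_overlap[OF M U V]])
    fix x assume "x \<in> \<phi> ` (U \<inter> V)"
    then show "(transition V \<psi> \<zeta> \<circ> transition U \<phi> \<psi>) x = transition U \<phi> \<zeta> x"
      using transition_image[OF M U] transition_image[OF M V] by auto
  qed (use p in auto)
  then show ?thesis by (rule frechet_derivative_at[symmetric])
qed

lemma transition_derivative_self:
  assumes M: "charted_space M" and U: "(U, \<phi>) \<in> atlas M" and p: "p \<in> U"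
  shows "frechet_derivative (transition U \<phi> \<phi>) (at (\<phi> p)) = id"
proof -
  have "((\<lambda>x. x) has_derivative (\<lambda>x. x)) (at (\<phi> p))" by (rule has_derivative_ident)
  then have "(transition U \<phi> \<phi> has_derivative (\<lambda>x. x)) (at (\<phi> p))"
    by (rule has_derivative_transform_within_open[OF _ chart_open_image[OF M U]])
       (use p in \<open>auto simp: f_inv_into_f\<close>)
  then show ?thesis using frechet_derivative_at by (fastforce simp: id_def)
qed

lemma chart_deriv_eq:
  assumes M: "charted_space M" and U: "(U, \<phi>) \<in> atlas M" and p: "p \<in> U"
    and p0: "chart_at M p = (U0, \<phi>0)"
  shows "chart_deriv M U \<phi> p = frechet_derivative (transition U0 \<phi>0 \<phi>) (at (\<phi>0 p))"
proof -
  have U0: "(U0, \<phi>0) \<in> atlas M" "p \<in> U0"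
    using chart_at_cases[OF M, of p] chart_subset_carrier[OF M U] p p0 by auto
  have "at (\<phi>0 p) within \<phi>0 ` (U0 \<inter> U) = at (\<phi>0 p)"
    by (rule at_within_open[OF _ chart_open_overlap[OF M U0(1) U]]) (use U0 p in blast)
  then show ?thesis
    unfolding differential_on_def p0 by (simp add: model_manifold_def)
qed

text \<open>
  A tangent vector at \<open>p\<close> is represented in the selected chart at \<open>p\<close>, which varies wildly with \<open>p\<close>.
  Its images under the differentials of a fixed chart behave well, and this is the rule that compares two
  fixed charts.
\<close>

lemma chart_deriv_change:
  assumes M: "charted_space M" and U: "(U, \<phi>) \<in> atlas M" and V: "(V, \<psi>) \<in> atlas M"
    and p: "p \<in> U" "p \<in> V"
  shows "chart_deriv M V \<psi> p v =
    frechet_derivative (transition U \<phi> \<psi>) (at (\<phi> p)) (chart_deriv M U \<phi> p v)"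
proof -
  obtain U0 \<phi>0 where p0: "chart_at M p = (U0, \<phi>0)" "(U0, \<phi>0) \<in> atlas M" "p \<in> U0"
    using chart_at_cases[OF M, of p] chart_subset_carrier[OF M U] p by auto
  show ?thesis
    unfolding chart_deriv_eq[OF M U p(1) p0(1)] chart_deriv_eq[OF M V p(2) p0(1)]
    using transition_cocycle[OF M p0(2) U V p0(3) p] by simp
qed

lemma chart_deriv_chart_at:
  assumes M: "charted_space M" and p: "p \<in> carrier M" and p0: "chart_at M p = (U0, \<phi>0)"
  shows "chart_deriv M U0 \<phi>0 p = id"
proof -
  have U0: "(U0, \<phi>0) \<in> atlas M" "p \<in> U0"
    using chart_at_cases[OF M p] p0 by auto
  show ?thesis
    using chart_deriv_eq[OF M U0 p0] transition_derivative_self[OF M U0] by simp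
qed

lemma linear_chart_deriv:
  assumes M: "charted_space M" and U: "(U, \<phi>) \<in> atlas M" and p: "p \<in> U"
  shows "linear (chart_deriv M U \<phi> p)"
proof -
  obtain U0 \<phi>0 where p0: "chart_at M p = (U0, \<phi>0)" "(U0, \<phi>0) \<in> atlas M" "p \<in> U0"
    using chart_at_cases[OF M, of p] chart_subset_carrier[OF M U] p by auto
  show ?thesis
    unfolding chart_deriv_eq[OF M U p p0(1)]
    using transition_has_derivative[OF M p0(2) U p0(3) p] has_derivative_linear by blast
qed

lemma bij_chart_deriv:
  assumes M: "charted_space M" and U: "(U, \<phi>) \<in> atlas M" and p: "p \<in> U"
  shows "bij (chart_deriv M U \<phi> p)"
proof -
  obtain U0 \<phi>0 where p0: "chart_at M p = (U0, \<phi>0)" "(U0, \<phi>0) \<in> atlas M" "p \<in> U0"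
    using chart_at_cases[OF M, of p] chart_subset_carrier[OF M U] p by auto
  let ?D = "frechet_derivative (transition U0 \<phi>0 \<phi>) (at (\<phi>0 p))"
    and ?E = "frechet_derivative (transition U \<phi> \<phi>0) (at (\<phi> p))"
  have "?E \<circ> ?D = id" "?D \<circ> ?E = id"
    using transition_cocycle[OF M p0(2) U p0(2) p0(3) p p0(3)]
      transition_cocycle[OF M U p0(2) U p p0(3) p]
      transition_derivative_self[OF M p0(2,3)] transition_derivative_self[OF M U p] by auto
  then show ?thesis unfolding chart_deriv_eq[OF M U p p0(1)] by (metis o_bij)
qed

lemma smooth_map_on_image: "smooth_map_on M N S f \<Longrightarrow> p \<in> S \<Longrightarrow> f p \<in> carrier N"
  unfolding smooth_map_on_def by blast

lemma smooth_map_on_cong: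
  fixes f :: "'a \<Rightarrow> 'c" and M :: "('a, 'b::model_space) manifold" and N :: "('c, 'd::model_space) manifold"
  assumes "smooth_map_on M N S f" "\<And>p. p \<in> S \<Longrightarrow> f p = g p"
  shows "smooth_map_on M N S g"
proof -
  have eq: "(\<forall>q\<in>U \<inter> S. \<phi> q \<in> W \<longrightarrow> g q \<in> V \<and> \<psi> (g q) = F (\<phi> q)) =
      (\<forall>q\<in>U \<inter> S. \<phi> q \<in> W \<longrightarrow> f q \<in> V \<and> \<psi> (f q) = F (\<phi> q))"
    for U :: "'a set" and \<phi> :: "'a \<Rightarrow> 'b" and V W and \<psi> :: "'c \<Rightarrow> 'd" and F
    using assms(2) by auto
  have "g ` S = f ` S" using assms(2) by auto
  with assms(1) show ?thesis unfolding smooth_map_on_def eq by simp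
qed

text \<open>
  The charts in the definition of smoothness may be prescribed: the given local extension is composed with
  transition maps on both sides, and its domain is shrunk so that these are defined.
\<close>

lemma smooth_map_on_charts:
  assumes M: "charted_space M" and N: "charted_space N" and f: "smooth_map_on M N S f" and p: "p \<in> S"
    and U: "(U, \<phi>) \<in> atlas M" "p \<in> U" and V: "(V, \<psi>) \<in> atlas N" "f p \<in> V"
  obtains W F where "\<phi> p \<in> W" "open W" "W \<subseteq> \<phi> ` U" "smooth_on W F"
    "\<And>q. \<lbrakk>q \<in> U; q \<in> S; \<phi> q \<in> W\<rbrakk> \<Longrightarrow> f q \<in> V \<and> \<psi> (f q) = F (\<phi> q)"
proof -
  have "\<exists>(U, \<phi>)\<in>atlas M. \<exists>(V, \<psi>)\<in>atlas N. \<exists>W F.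
        p \<in> U \<and> \<phi> p \<in> W \<and> open W \<and> W \<subseteq> \<phi> ` U \<and> smooth_on W F \<and>
        (\<forall>q\<in>U \<inter> S. \<phi> q \<in> W \<longrightarrow> f q \<in> V \<and> \<psi> (f q) = F (\<phi> q))"
    using f p unfolding smooth_map_on_def by blast
  then obtain U1 \<phi>1 V1 \<psi>1 W1 F1 where
    1: "(U1, \<phi>1) \<in> atlas M" "(V1, \<psi>1) \<in> atlas N" "p \<in> U1" "\<phi>1 p \<in> W1" "open W1"
      "W1 \<subseteq> \<phi>1 ` U1" "smooth_on W1 F1"
      "\<And>q. \<lbrakk>q \<in> U1; q \<in> S; \<phi>1 q \<in> W1\<rbrakk> \<Longrightarrow> f q \<in> V1 \<and> \<psi>1 (f q) = F1 (\<phi>1 q)"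
    by blast
  let ?T = "transition U \<phi> \<phi>1" and ?R = "transition V1 \<psi>1 \<psi>"
  let ?W2 = "W1 \<inter> F1 -` (\<psi>1 ` (V1 \<inter> V))"
  let ?W = "\<phi> ` (U \<inter> U1) \<inter> ?T -` ?W2"
  have W2: "open ?W2"
    by (intro continuous_open_preimage smooth_on_imp_continuous_on 1 chart_open_overlap[OF N 1(2) V(1)])
  have oU: "open (\<phi> ` (U \<inter> U1))" by (rule chart_open_overlap[OF M U(1) 1(1)])
  have W: "open ?W"
    by (rule continuous_open_preimage[OF smooth_on_imp_continuous_on[OF
            smooth_on_transition[OF M U(1) 1(1)]] oU W2])
  have T: "?T (\<phi> q) = \<phi>1 q" if "q \<in> U" for q using transition_image[OF M U(1) that] by simp
  have R: "?R (\<psi>1 y) = \<psi> y" if "y \<in> V1" for y using transition_image[OF N 1(2) that] by simp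
  show ?thesis
  proof (rule that[of ?W "\<lambda>x. ?R (F1 (?T x))"])
    show "\<phi> p \<in> ?W"
      using U(2) 1 T[OF U(2)] 1(8)[OF 1(3) p 1(4)] V(2)
      by (auto intro!: image_eqI[of _ \<psi>1 "f p"])
    show "smooth_on ?W (\<lambda>x. ?R (F1 (?T x)))"
    proof (rule smooth_on_compose[OF W chart_open_overlap[OF N 1(2) V(1)] _
            smooth_on_transition[OF N 1(2) V(1)]])
      show "smooth_on ?W (\<lambda>x. F1 (?T x))"
        by (rule smooth_on_compose[OF W 1(5) _ 1(7)])
          (auto intro: smooth_on_subset[OF smooth_on_transition[OF M U(1) 1(1)]])
    qed auto
    fix q assume q: "q \<in> U" "q \<in> S" "\<phi> q \<in> ?W"
    have q1: "\<phi>1 q \<in> W1" "F1 (\<phi>1 q) \<in> \<psi>1 ` (V1 \<inter> V)" using q(3) T[OF q(1)] by auto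
    have "q \<in> U1" using q(1,3) chart_inj_on[OF M U(1)] by (auto simp: inj_on_def)
    then have fq: "f q \<in> V1" "\<psi>1 (f q) = F1 (\<phi>1 q)" using 1(8) q(2) q1(1) by auto
    then have "f q \<in> V" using q1(2) chart_inj_on[OF N 1(2)] by (auto simp: inj_on_def)
    then show "f q \<in> V \<and> \<psi> (f q) = ?R (F1 (?T (\<phi> q)))"
      using T[OF q(1)] fq R[OF fq(1)] by simp
  qed (use W in auto)
qed

lemma differential_on_has_derivative:
  assumes M: "charted_space M" and N: "charted_space N" and f: "smooth_map_on M N S f" and p: "p \<in> S"
    and U: "chart_at M p = (U, \<phi>)" and V: "chart_at N (f p) = (V, \<psi>)"
  shows "((\<lambda>x. \<psi> (f (inv_into U \<phi> x))) has_derivative differential_on M N S f p)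
    (at (\<phi> p) within \<phi> ` (U \<inter> S))"
proof -
  have "p \<in> carrier M" "f p \<in> carrier N"
    using f p unfolding smooth_map_on_def by auto
  then have U': "(U, \<phi>) \<in> atlas M" "p \<in> U" and V': "(V, \<psi>) \<in> atlas N" "f p \<in> V"
    using chart_at_cases[OF M] chart_at_cases[OF N] U V by (metis prod.inject)+
  obtain W F where W: "\<phi> p \<in> W" "open W" "W \<subseteq> \<phi> ` U" "smooth_on W F"
    "\<And>q. \<lbrakk>q \<in> U; q \<in> S; \<phi> q \<in> W\<rbrakk> \<Longrightarrow> f q \<in> V \<and> \<psi> (f q) = F (\<phi> q)"
    using smooth_map_on_charts[OF M N f p U' V'] by blast
  have "(F has_derivative frechet_derivative F (at (\<phi> p))) (at (\<phi> p) within \<phi> ` (U \<inter> S))"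
    using smooth_on_has_derivative[OF W(4,1)] by (rule has_derivative_at_withinI)
  then have "((\<lambda>x. \<psi> (f (inv_into U \<phi> x))) has_derivative frechet_derivative F (at (\<phi> p)))
    (at (\<phi> p) within \<phi> ` (U \<inter> S))"
  proof (rule has_derivative_transform_eventually)
    have "\<forall>\<^sub>F x in at (\<phi> p) within \<phi> ` (U \<inter> S). x \<in> W"
      using W(1,2) eventually_at_topological by blast
    moreover have "\<forall>\<^sub>F x in at (\<phi> p) within \<phi> ` (U \<inter> S). x \<in> \<phi> ` (U \<inter> S)"
      by (auto simp: eventually_at_filter)
    ultimately show "\<forall>\<^sub>F x in at (\<phi> p) within \<phi> ` (U \<inter> S). F x = \<psi> (f (inv_into U \<phi> x))"
      by eventually_elim (use W(5) transition_image[OF M U'(1)] in auto)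
    show "F (\<phi> p) = \<psi> (f (inv_into U \<phi> (\<phi> p)))"
      using W(5)[OF U'(2) p W(1)] transition_image[OF M U'] by simp
  qed (use U'(2) p in blast)
  then show ?thesis
    unfolding differential_on_def U V by (auto simp: frechet_derivative_works[symmetric] differentiable_def)
qed

lemma linear_differential_on:
  assumes M: "charted_space M" and N: "charted_space N" and f: "smooth_map_on M N S f" and p: "p \<in> S"
  shows "linear (differential_on M N S f p)"
  using differential_on_has_derivative[OF assms] has_derivative_linear by (metis surj_pair)

text \<open>
  The velocity at time \<open>0\<close>.  The curve need not be differentiable or even continuous at other times, and
  all conditions on curves below are imposed near time \<open>0\<close> only.
\<close>

definition has_velocity :: "('a, 'e::model_space) manifold \<Rightarrow> (real \<Rightarrow> 'a) \<Rightarrow> 'a \<Rightarrow> 'e \<Rightarrow> bool" where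
  "has_velocity M c p v \<longleftrightarrow> c 0 = p \<and> p \<in> carrier M \<and>
     (\<exists>(U, \<phi>)\<in>atlas M. p \<in> U \<and> (\<forall>\<^sub>F t in nhds 0. c t \<in> U) \<and>
       ((\<lambda>t. \<phi> (c t)) has_vector_derivative chart_deriv M U \<phi> p v) (at 0))"

lemma has_vector_derivative_compose_at:
  assumes "(c has_vector_derivative v) (at t)" "(F has_derivative D) (at (c t))"
  shows "((\<lambda>t. F (c t)) has_vector_derivative D v) (at t)"
  using vector_derivative_diff_chain_within[of c v t UNIV F D] assms
  by (simp add: o_def has_derivative_at_withinI)

lemma has_vector_derivative_tendsto_nhds:
  assumes "(f has_vector_derivative v) (at t)"
  shows "(f \<longlongrightarrow> f t) (nhds t)"
  using has_vector_derivative_continuous[OF assms] tendsto_at_iff_tendsto_nhds[of f t]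
  by (simp add: isCont_def)

lemma has_vector_derivative_cong_nhds:
  assumes "(f has_vector_derivative v) (at t)" "\<forall>\<^sub>F s in nhds t. f s = g s"
  shows "(g has_vector_derivative v) (at t)"
  using assms(1) unfolding has_vector_derivative_def
proof (rule has_derivative_transform_eventually)
  show "\<forall>\<^sub>F s in at t. f s = g s"
    using assms(2) by (auto simp: eventually_at_filter elim: eventually_mono)
qed (use eventually_nhds_x_imp_x[OF assms(2)] in auto)

lemma has_velocity_chart:
  assumes M: "charted_space M" and c: "has_velocity M c p v" and V: "(V, \<psi>) \<in> atlas M" "p \<in> V"
  shows "\<forall>\<^sub>F t in nhds 0. c t \<in> V"
    and "((\<lambda>t. \<psi> (c t)) has_vector_derivative chart_deriv M V \<psi> p v) (at 0)"
proof -
  obtain U \<phi> where U: "(U, \<phi>) \<in> atlas M" "p \<in> U" "\<forall>\<^sub>F t in nhds 0. c t \<in> U"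
    "((\<lambda>t. \<phi> (c t)) has_vector_derivative chart_deriv M U \<phi> p v) (at 0)" and c0: "c 0 = p"
    using c unfolding has_velocity_def by blast
  have "((\<lambda>t. \<phi> (c t)) \<longlongrightarrow> \<phi> p) (nhds 0)"
    using has_vector_derivative_tendsto_nhds[OF U(4)] by (simp add: c0)
  then have "\<forall>\<^sub>F t in nhds 0. \<phi> (c t) \<in> \<phi> ` (U \<inter> V)"
    by (rule topological_tendstoD[OF _ chart_open_overlap[OF M U(1) V(1)]]) (use U(2) V(2) in blast)
  with U(3) have ev: "\<forall>\<^sub>F t in nhds 0. c t \<in> U \<and> c t \<in> V"
    by eventually_elim (use chart_inj_on[OF M U(1)] in \<open>auto simp: inj_on_def\<close>)
  then show "\<forall>\<^sub>F t in nhds 0. c t \<in> V" by (rule eventually_mono) simp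
  have "((\<lambda>t. transition U \<phi> \<psi> (\<phi> (c t))) has_vector_derivative chart_deriv M V \<psi> p v) (at 0)"
    unfolding chart_deriv_change[OF M U(1) V(1) U(2) V(2)]
    by (rule has_vector_derivative_compose_at[OF U(4)])
       (use transition_has_derivative[OF M U(1) V(1) U(2) V(2)] c0 in simp)
  then show "((\<lambda>t. \<psi> (c t)) has_vector_derivative chart_deriv M V \<psi> p v) (at 0)"
    by (rule has_vector_derivative_cong_nhds)
       (use ev in \<open>eventually_elim, simp add: transition_image[OF M U(1)]\<close>)
qed

lemma has_velocityI:
  assumes "charted_space M" "(U, \<phi>) \<in> atlas M" "p \<in> U" "c 0 = p" "\<forall>\<^sub>F t in nhds 0. c t \<in> U"
    "((\<lambda>t. \<phi> (c t)) has_vector_derivative chart_deriv M U \<phi> p v) (at 0)"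
  shows "has_velocity M c p v"
  using assms chart_subset_carrier[OF assms(1,2)] unfolding has_velocity_def by blast

lemma has_velocity_unique:
  assumes M: "charted_space M" and "has_velocity M c p v" "has_velocity M c p w"
  shows "v = w"
proof -
  obtain U \<phi> where U: "(U, \<phi>) \<in> atlas M" "p \<in> U"
    using assms(2) unfolding has_velocity_def by blast
  have "chart_deriv M U \<phi> p v = chart_deriv M U \<phi> p w"
    using has_velocity_chart(2)[OF M assms(2) U] has_velocity_chart(2)[OF M assms(3) U]
    by (rule vector_derivative_unique_at)
  then show ?thesis using bij_chart_deriv[OF M U] by (simp add: bij_def inj_eq)
qed

lemma has_velocity_cong:
  assumes M: "charted_space M" and c: "has_velocity M c p v" and ev: "\<forall>\<^sub>F t in nhds 0. c t = d t"
  shows "has_velocity M d p v"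
proof -
  obtain U \<phi> where U: "(U, \<phi>) \<in> atlas M" "p \<in> U"
    using c unfolding has_velocity_def by blast
  show ?thesis
  proof (rule has_velocityI[OF M U])
    show "d 0 = p" using c eventually_nhds_x_imp_x[OF ev] unfolding has_velocity_def by simp
    show "\<forall>\<^sub>F t in nhds 0. d t \<in> U"
      using has_velocity_chart(1)[OF M c U] ev by eventually_elim simp
    show "((\<lambda>t. \<phi> (d t)) has_vector_derivative chart_deriv M U \<phi> p v) (at 0)"
      using has_velocity_chart(2)[OF M c U] by (rule has_vector_derivative_cong_nhds)
        (use ev in \<open>eventually_elim, simp\<close>)
  qed
qed

text \<open>
  This is how an identity between points becomes an identity between tangent vectors.
\<close>

lemma has_velocity_eventually_unique:
  assumes "charted_space M" "has_velocity M c p v" "has_velocity M d p w" "\<forall>\<^sub>F t in nhds 0. c t = d t"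
  shows "v = w"
  using has_velocity_unique[OF assms(1) has_velocity_cong[OF assms(1,2,4)] assms(3)] .

lemma has_velocity_const:
  assumes M: "charted_space M" and p: "p \<in> carrier M"
  shows "has_velocity M (\<lambda>_. p) p 0"
proof -
  obtain U \<phi> where U: "(U, \<phi>) \<in> atlas M" "p \<in> U" using chart_at_cases[OF M p] by blast
  show ?thesis
    by (rule has_velocityI[OF M U]) (use U in \<open>auto simp: linear_0[OF linear_chart_deriv[OF M U]]\<close>)
qed

text \<open>
  The chain rule along a curve in \<open>S\<close>.  It holds for every linear map that is a derivative within \<open>S\<close>, in
  particular for the one that the definition of \<^const>\<open>differential_on\<close> happens to select.
\<close>

lemma differential_on_has_velocity:
  assumes M: "charted_space M" and N: "charted_space N" and f: "smooth_map_on M N S f"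
    and c: "has_velocity M c p v" and S: "\<forall>\<^sub>F t in nhds 0. c t \<in> S"
  shows "has_velocity N (\<lambda>t. f (c t)) (f p) (differential_on M N S f p v)"
proof -
  have c0: "c 0 = p" using c unfolding has_velocity_def by simp
  have p: "p \<in> S" using eventually_nhds_x_imp_x[OF S] c0 by simp
  have pM: "p \<in> carrier M" and fpN: "f p \<in> carrier N" using f p unfolding smooth_map_on_def by auto
  obtain U \<phi> where U: "chart_at M p = (U, \<phi>)" "(U, \<phi>) \<in> atlas M" "p \<in> U"
    using chart_at_cases[OF M pM] .
  obtain V \<psi> where V: "chart_at N (f p) = (V, \<psi>)" "(V, \<psi>) \<in> atlas N" "f p \<in> V"
    using chart_at_cases[OF N fpN] .
  obtain W F where W: "\<phi> p \<in> W" "open W" "W \<subseteq> \<phi> ` U" "smooth_on W F"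
    "\<And>q. \<lbrakk>q \<in> U; q \<in> S; \<phi> q \<in> W\<rbrakk> \<Longrightarrow> f q \<in> V \<and> \<psi> (f q) = F (\<phi> q)"
    using smooth_map_on_charts[OF M N f p U(2,3) V(2,3)] by blast
  have dc: "((\<lambda>t. \<phi> (c t)) has_vector_derivative v) (at 0)"
    using has_velocity_chart(2)[OF M c U(2,3)] chart_deriv_chart_at[OF M pM U(1)] by simp
  then have "((\<lambda>t. \<phi> (c t)) \<longlongrightarrow> \<phi> p) (nhds 0)"
    using has_vector_derivative_tendsto_nhds by (fastforce simp: c0)
  then have "\<forall>\<^sub>F t in nhds 0. \<phi> (c t) \<in> W"
    using W(1,2) by (simp add: topological_tendstoD)
  with S has_velocity_chart(1)[OF M c U(2,3)]
  have ev: "\<forall>\<^sub>F t in nhds 0. c t \<in> U \<inter> S \<and> f (c t) \<in> V"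
    by eventually_elim (use W(5) in auto)
  let ?A = "{t. c t \<in> U \<inter> S}"
  obtain Z where Z: "open Z" "0 \<in> Z" "Z \<subseteq> ?A"
    using ev unfolding eventually_nhds by blast
  have A: "at 0 within ?A = at (0::real)"
    using at_within_nhd[of 0 Z ?A UNIV] Z by blast
  have "(\<lambda>t. \<phi> (c t)) ` ?A \<subseteq> \<phi> ` (U \<inter> S)" by blast
  then have "((\<lambda>x. \<psi> (f (inv_into U \<phi> x))) has_derivative differential_on M N S f p)
      (at (\<phi> (c 0)) within (\<lambda>t. \<phi> (c t)) ` ?A)"
    using has_derivative_subset[OF differential_on_has_derivative[OF M N f p U(1) V(1)]]
    by (simp add: c0)
  then have "((\<lambda>t. \<psi> (f (inv_into U \<phi> (\<phi> (c t))))) has_vector_derivative differential_on M N S f p v)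
      (at 0 within ?A)"
    using vector_derivative_diff_chain_within[OF has_vector_derivative_at_within[OF dc, of ?A]]
    by (simp add: o_def)
  then have "((\<lambda>t. \<psi> (f (inv_into U \<phi> (\<phi> (c t))))) has_vector_derivative differential_on M N S f p v)
      (at 0)"
    unfolding A .
  then have "((\<lambda>t. \<psi> (f (c t))) has_vector_derivative differential_on M N S f p v) (at 0)"
    by (rule has_vector_derivative_cong_nhds)
       (use ev in \<open>eventually_elim, simp add: transition_image[OF M U(2)]\<close>)
  then show ?thesis
    by (intro has_velocityI[OF N V(2,3)])
       (use ev c0 chart_deriv_chart_at[OF N fpN V(1)] in \<open>auto elim: eventually_mono\<close>)
qed

lemma has_velocity_chart_curve:
  assumes M: "charted_space M" and U: "(U, \<phi>) \<in> atlas M" "p \<in> U"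
    and x: "x 0 = \<phi> p" "\<forall>\<^sub>F t in nhds 0. x t \<in> \<phi> ` U"
      "(x has_vector_derivative chart_deriv M U \<phi> p v) (at 0)"
  shows "has_velocity M (\<lambda>t. inv_into U \<phi> (x t)) p v"
proof (rule has_velocityI[OF M U])
  show "inv_into U \<phi> (x 0) = p" using x(1) transition_image[OF M U] by simp
  show "\<forall>\<^sub>F t in nhds 0. inv_into U \<phi> (x t) \<in> U"
    using x(2) by eventually_elim (rule inv_into_into)
  show "((\<lambda>t. \<phi> (inv_into U \<phi> (x t))) has_vector_derivative chart_deriv M U \<phi> p v) (at 0)"
    using x(3) by (rule has_vector_derivative_cong_nhds)
      (use x(2) in \<open>eventually_elim, simp add: f_inv_into_f\<close>)
qed

lemma has_velocity_exists:
  assumes M: "charted_space M" and p: "p \<in> carrier M"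
  obtains c where "has_velocity M c p v" "\<forall>\<^sub>F t in nhds 0. c t \<in> carrier M"
proof -
  obtain U \<phi> where U: "(U, \<phi>) \<in> atlas M" "p \<in> U" using chart_at_cases[OF M p] by blast
  let ?x = "\<lambda>t. \<phi> p + t *\<^sub>R chart_deriv M U \<phi> p v"
  have dx: "(?x has_vector_derivative chart_deriv M U \<phi> p v) (at 0)"
    by (auto intro!: derivative_eq_intros)
  have "(?x \<longlongrightarrow> \<phi> p) (nhds 0)"
    using has_vector_derivative_tendsto_nhds[OF dx] by simp
  then have "\<forall>\<^sub>F t in nhds 0. ?x t \<in> \<phi> ` U"
    by (rule topological_tendstoD[OF _ chart_open_image[OF M U(1)]]) (use U(2) in blast)
  then have c: "has_velocity M (\<lambda>t. inv_into U \<phi> (?x t)) p v"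
    by (intro has_velocity_chart_curve[OF M U] dx) simp
  show ?thesis
    by (rule that[OF c], rule eventually_mono[OF has_velocity_chart(1)[OF M c U]])
      (use chart_subset_carrier[OF M U(1)] in blast)
qed

text \<open>
  Tangency to an arbitrary subset, by curves.  On such vectors the differential within \<open>S\<close> does not depend
  on choices and can be computed from a local extension, see \<open>differential_on_in_charts\<close>.
\<close>

definition tangent_to :: "('a, 'e::model_space) manifold \<Rightarrow> 'a set \<Rightarrow> 'a \<Rightarrow> 'e \<Rightarrow> bool" where
  "tangent_to M S p v \<longleftrightarrow> (\<exists>c. has_velocity M c p v \<and> (\<forall>\<^sub>F t in nhds 0. c t \<in> S))"

lemma tangent_to_carrier:
  "charted_space M \<Longrightarrow> p \<in> carrier M \<Longrightarrow> tangent_to M (carrier M) p v"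
  unfolding tangent_to_def by (metis has_velocity_exists)

lemma differential_on_in_charts:
  assumes M: "charted_space M" and N: "charted_space N" and f: "smooth_map_on M N S f"
    and v: "tangent_to M S p v" and U: "(U, \<phi>) \<in> atlas M" "p \<in> U" and V: "(V, \<psi>) \<in> atlas N" "f p \<in> V"
    and W: "\<phi> p \<in> W" "open W" and F: "(F has_derivative D) (at (\<phi> p))"
      "\<And>q. \<lbrakk>q \<in> U; q \<in> S; \<phi> q \<in> W\<rbrakk> \<Longrightarrow> \<psi> (f q) = F (\<phi> q)"
  shows "chart_deriv N V \<psi> (f p) (differential_on M N S f p v) = D (chart_deriv M U \<phi> p v)"
proof -
  obtain c where c: "has_velocity M c p v" "\<forall>\<^sub>F t in nhds 0. c t \<in> S"
    using v unfolding tangent_to_def by blast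
  have c0: "c 0 = p" using c(1) unfolding has_velocity_def by simp
  have dc: "((\<lambda>t. \<phi> (c t)) has_vector_derivative chart_deriv M U \<phi> p v) (at 0)"
    by (rule has_velocity_chart(2)[OF M c(1) U])
  then have "((\<lambda>t. \<phi> (c t)) \<longlongrightarrow> \<phi> p) (nhds 0)"
    using has_vector_derivative_tendsto_nhds by (fastforce simp: c0)
  then have "\<forall>\<^sub>F t in nhds 0. \<phi> (c t) \<in> W"
    using W by (simp add: topological_tendstoD)
  with c(2) has_velocity_chart(1)[OF M c(1) U] have ev: "\<forall>\<^sub>F t in nhds 0. F (\<phi> (c t)) = \<psi> (f (c t))"
    by eventually_elim (simp add: F)
  have "((\<lambda>t. F (\<phi> (c t))) has_vector_derivative D (chart_deriv M U \<phi> p v)) (at 0)"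
    by (rule has_vector_derivative_compose_at[OF dc]) (simp add: c0 F)
  then have "((\<lambda>t. \<psi> (f (c t))) has_vector_derivative D (chart_deriv M U \<phi> p v)) (at 0)"
    by (rule has_vector_derivative_cong_nhds[OF _ ev])
  with has_velocity_chart(2)[OF N differential_on_has_velocity[OF M N f c] V] show ?thesis
    by (rule vector_derivative_unique_at)
qed

text \<open>
  The curve \<open>y\<close> in the base lifts to a curve whose velocity is any prescribed vector above the velocity of
  \<open>y\<close>; in charts this is \<open>curve_lift\<close>.
\<close>

lemma submersion_lift:
  assumes M: "charted_space M" and N: "charted_space N" and f: "submersion M N f"
    and p: "p \<in> carrier M" and y: "has_velocity N y (f p) (differential M N f p v)"
  obtains c where "has_velocity M c p v" "\<forall>\<^sub>F t in nhds 0. c t \<in> carrier M \<and> f (c t) = y t"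
proof -
  have sm: "smooth_map M N f" and surj: "surj (differential M N f p)"
    using f p unfolding submersion_def by auto
  have fp: "f p \<in> carrier N" using sm p unfolding smooth_map_on_def by blast
  obtain U \<phi> where U: "chart_at M p = (U, \<phi>)" "(U, \<phi>) \<in> atlas M" "p \<in> U"
    using chart_at_cases[OF M p] .
  obtain V \<psi> where V: "chart_at N (f p) = (V, \<psi>)" "(V, \<psi>) \<in> atlas N" "f p \<in> V"
    using chart_at_cases[OF N fp] .
  obtain W F where W: "\<phi> p \<in> W" "open W" "W \<subseteq> \<phi> ` U" "smooth_on W F"
    "\<And>q. \<lbrakk>q \<in> U; q \<in> carrier M; \<phi> q \<in> W\<rbrakk> \<Longrightarrow> f q \<in> V \<and> \<psi> (f q) = F (\<phi> q)"
    using smooth_map_on_charts[OF M N sm p U(2,3) V(2,3)] by blast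
  have T: "chart_deriv M U \<phi> p = id" "chart_deriv N V \<psi> (f p) = id"
    using chart_deriv_chart_at[OF M p U(1)] chart_deriv_chart_at[OF N fp V(1)] .
  have D: "frechet_derivative F (at (\<phi> p)) = differential M N f p"
  proof
    fix u show "frechet_derivative F (at (\<phi> p)) u = differential M N f p u"
      using differential_on_in_charts[OF M N sm tangent_to_carrier[OF M p] U(2,3) V(2,3) W(1,2)
          smooth_on_has_derivative[OF W(4,1)]] W(5) T by simp
  qed
  have y0: "y 0 = f p" using y unfolding has_velocity_def by simp
  obtain x where x: "x 0 = \<phi> p" "(x has_vector_derivative v) (at 0)"
    "\<forall>\<^sub>F t in nhds 0. x t \<in> W \<and> F (x t) = \<psi> (y t)"
  proof (rule curve_lift[OF W(2,1,4), of "\<lambda>t. \<psi> (y t)" v])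
    show "surj (frechet_derivative F (at (\<phi> p)))" using surj D by simp
    show "\<psi> (y 0) = F (\<phi> p)" using W(5)[OF U(3) p W(1)] y0 by simp
    show "((\<lambda>t. \<psi> (y t)) has_vector_derivative frechet_derivative F (at (\<phi> p)) v) (at 0)"
      using has_velocity_chart(2)[OF N y V(2,3)] D T by simp
  qed auto
  have xU: "\<forall>\<^sub>F t in nhds 0. x t \<in> \<phi> ` U" using x(3) by eventually_elim (use W(3) in auto)
  show ?thesis
  proof (rule that)
    show "has_velocity M (\<lambda>t. inv_into U \<phi> (x t)) p v"
      by (rule has_velocity_chart_curve[OF M U(2,3) x(1) xU]) (use x(2) T in simp)
    show "\<forall>\<^sub>F t in nhds 0. inv_into U \<phi> (x t) \<in> carrier M \<and> f (inv_into U \<phi> (x t)) = y t"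
      using x(3) xU has_velocity_chart(1)[OF N y V(2,3)]
    proof eventually_elim
      case (elim t)
      let ?c = "inv_into U \<phi> (x t)"
      have c: "?c \<in> U" "\<phi> ?c = x t" using elim(2) by (auto intro: inv_into_into f_inv_into_f)
      then have cM: "?c \<in> carrier M" using chart_subset_carrier[OF M U(2)] by blast
      with c W(5)[of ?c] elim(1) have "f ?c \<in> V" "\<psi> (f ?c) = \<psi> (y t)" by auto
      then have "f ?c = y t" using elim(3) chart_inj_on[OF N V(2)] by (simp add: inj_on_def)
      then show ?case using cM by simp
    qed
  qed
qed


section \<open>Products\<close>

lemma prod_chart_eq [simp]: "prod_chart (U, \<phi>) (V, \<psi>) = (U \<times> V, map_prod \<phi> \<psi>)"
  by (simp add: prod_chart_def)

lemma carrier_prod_manifold [simp]: "carrier (M \<times>\<^sub>M\<^sub>f N) = carrier M \<times> carrier N"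
  by (simp add: prod_manifold_def)

lemma atlas_prod_manifoldI:
  "(U, \<phi>) \<in> atlas M \<Longrightarrow> (V, \<psi>) \<in> atlas N \<Longrightarrow> (U \<times> V, map_prod \<phi> \<psi>) \<in> atlas (M \<times>\<^sub>M\<^sub>f N)"
  unfolding prod_manifold_def by (auto intro!: exI[of _ "(U, \<phi>)"] exI[of _ "(V, \<psi>)"])

lemma atlas_prod_manifoldE:
  assumes "c \<in> atlas (M \<times>\<^sub>M\<^sub>f N)"
  obtains U \<phi> V \<psi> where "c = (U \<times> V, map_prod \<phi> \<psi>)" "(U, \<phi>) \<in> atlas M" "(V, \<psi>) \<in> atlas N"
proof -
  obtain c1 c2 where c: "c = prod_chart c1 c2" "c1 \<in> atlas M" "c2 \<in> atlas N"
    using assms unfolding prod_manifold_def by auto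
  show ?thesis using that[of "fst c1" "fst c2" "snd c1" "snd c2"] c by (simp add: prod_chart_def)
qed

lemma inv_into_map_prod:
  assumes "inj_on \<phi> U" "inj_on \<psi> V" "z \<in> \<phi> ` U \<times> \<psi> ` V"
  shows "inv_into (U \<times> V) (map_prod \<phi> \<psi>) z = (inv_into U \<phi> (fst z), inv_into V \<psi> (snd z))"
  using assms by (intro inv_into_f_eq[OF map_prod_inj_on])
    (auto intro: inv_into_into simp: map_prod_def f_inv_into_f)

lemma charted_space_prod:
  assumes M: "charted_space M" and N: "charted_space N"
  shows "charted_space (M \<times>\<^sub>M\<^sub>f N)"
proof (rule charted_spaceI)
  fix A \<alpha> assume "(A, \<alpha>) \<in> atlas (M \<times>\<^sub>M\<^sub>f N)"
  then obtain U \<phi> V \<psi> where c: "(A, \<alpha>) = (U \<times> V, map_prod \<phi> \<psi>)" "(U, \<phi>) \<in> atlas M" "(V, \<psi>) \<in> atlas N"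
    by (rule atlas_prod_manifoldE)
  show "A \<subseteq> carrier (M \<times>\<^sub>M\<^sub>f N) \<and> inj_on \<alpha> A \<and> open (\<alpha> ` A)"
    using chart_subset_carrier[OF M c(2)] chart_subset_carrier[OF N c(3)]
      chart_inj_on[OF M c(2)] chart_inj_on[OF N c(3)]
      chart_open_image[OF M c(2)] chart_open_image[OF N c(3)] c(1)
    by (auto simp: map_prod_inj_on open_Times map_prod_surj_on[OF refl refl])
next
  fix A \<alpha> B \<beta> assume "(A, \<alpha>) \<in> atlas (M \<times>\<^sub>M\<^sub>f N)" "(B, \<beta>) \<in> atlas (M \<times>\<^sub>M\<^sub>f N)"
  then obtain U \<phi> V \<psi> U' \<phi>' V' \<psi>' where
    c: "(A, \<alpha>) = (U \<times> V, map_prod \<phi> \<psi>)" "(U, \<phi>) \<in> atlas M" "(V, \<psi>) \<in> atlas N" and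
    d: "(B, \<beta>) = (U' \<times> V', map_prod \<phi>' \<psi>')" "(U', \<phi>') \<in> atlas M" "(V', \<psi>') \<in> atlas N"
    by (elim atlas_prod_manifoldE) blast
  let ?A = "\<phi> ` (U \<inter> U')" and ?B = "\<psi> ` (V \<inter> V')"
  have im: "map_prod \<phi> \<psi> ` (U \<times> V \<inter> U' \<times> V') = ?A \<times> ?B"
    unfolding Times_Int_Times by (rule map_prod_surj_on[OF refl refl])
  have op: "open ?A" "open ?B" "open (?A \<times> ?B)"
    using chart_open_overlap[OF M c(2) d(2)] chart_open_overlap[OF N c(3) d(3)]
    by (auto intro: open_Times)
  have 1: "smooth_on (?A \<times> ?B) (\<lambda>z. transition U \<phi> \<phi>' (fst z))"
    by (rule smooth_on_compose[OF op(3,1) smooth_on_bounded_linear[OF op(3) bounded_linear_fst]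
          smooth_on_transition[OF M c(2) d(2)]]) auto
  have 2: "smooth_on (?A \<times> ?B) (\<lambda>z. transition V \<psi> \<psi>' (snd z))"
    by (rule smooth_on_compose[OF op(3,2) smooth_on_bounded_linear[OF op(3) bounded_linear_snd]
          smooth_on_transition[OF N c(3) d(3)]]) auto
  have "smooth_on (?A \<times> ?B) (transition (U \<times> V) (map_prod \<phi> \<psi>) (map_prod \<phi>' \<psi>'))"
  proof (rule smooth_on_cong[OF op(3) _ smooth_on_Pair[OF op(3) 1 2]])
    fix z assume "z \<in> ?A \<times> ?B"
    then have "z \<in> \<phi> ` U \<times> \<psi> ` V" by auto
    from inv_into_map_prod[OF chart_inj_on[OF M c(2)] chart_inj_on[OF N c(3)] this]
    show "(transition U \<phi> \<phi>' (fst z), transition V \<psi> \<psi>' (snd z)) =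
        transition (U \<times> V) (map_prod \<phi> \<psi>) (map_prod \<phi>' \<psi>') z" by simp
  qed
  then show "open (\<alpha> ` (A \<inter> B)) \<and> smooth_on (\<alpha> ` (A \<inter> B)) (transition A \<alpha> \<beta>)"
    using op(3) c(1) d(1) im by simp
next
  fix z assume "z \<in> carrier (M \<times>\<^sub>M\<^sub>f N)"
  then obtain p q where z: "z = (p, q)" "p \<in> carrier M" "q \<in> carrier N" by auto
  obtain U \<phi> where U: "chart_at M p = (U, \<phi>)" "(U, \<phi>) \<in> atlas M" "p \<in> U"
    using chart_at_cases[OF M z(2)] .
  obtain V \<psi> where V: "chart_at N q = (V, \<psi>)" "(V, \<psi>) \<in> atlas N" "q \<in> V"
    using chart_at_cases[OF N z(3)] .
  have "chart_at (M \<times>\<^sub>M\<^sub>f N) z = (U \<times> V, map_prod \<phi> \<psi>)"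
    by (simp add: prod_manifold_def z(1) U(1) V(1))
  then show "chart_at (M \<times>\<^sub>M\<^sub>f N) z \<in> atlas (M \<times>\<^sub>M\<^sub>f N) \<and> z \<in> fst (chart_at (M \<times>\<^sub>M\<^sub>f N) z)"
    using atlas_prod_manifoldI[OF U(2) V(2)] U(3) V(3) z(1) by auto
qed

lemma has_velocity_Pair:
  assumes M: "charted_space M" and N: "charted_space N"
    and c: "has_velocity M c p v" and d: "has_velocity N d q w"
  shows "has_velocity (M \<times>\<^sub>M\<^sub>f N) (\<lambda>t. (c t, d t)) (p, q) (v, w)"
proof -
  have pq: "p \<in> carrier M" "q \<in> carrier N" "c 0 = p" "d 0 = q"
    using c d unfolding has_velocity_def by auto
  obtain U \<phi> where U: "chart_at M p = (U, \<phi>)" "(U, \<phi>) \<in> atlas M" "p \<in> U"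
    using chart_at_cases[OF M pq(1)] .
  obtain V \<psi> where V: "chart_at N q = (V, \<psi>)" "(V, \<psi>) \<in> atlas N" "q \<in> V"
    using chart_at_cases[OF N pq(2)] .
  have at: "chart_at (M \<times>\<^sub>M\<^sub>f N) (p, q) = (U \<times> V, map_prod \<phi> \<psi>)"
    by (simp add: prod_manifold_def U(1) V(1))
  show ?thesis
  proof (rule has_velocityI[OF charted_space_prod[OF M N] atlas_prod_manifoldI[OF U(2) V(2)]])
    show "\<forall>\<^sub>F t in nhds 0. (c t, d t) \<in> U \<times> V"
      using has_velocity_chart(1)[OF M c U(2,3)] has_velocity_chart(1)[OF N d V(2,3)]
      by eventually_elim simp
    have "((\<lambda>t. (\<phi> (c t), \<psi> (d t))) has_vector_derivative (v, w)) (at 0)"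
      using has_velocity_chart(2)[OF M c U(2,3)] has_velocity_chart(2)[OF N d V(2,3)]
        chart_deriv_chart_at[OF M pq(1) U(1)] chart_deriv_chart_at[OF N pq(2) V(1)]
      by (simp add: has_vector_derivative_Pair)
    then show "((\<lambda>t. map_prod \<phi> \<psi> (c t, d t)) has_vector_derivative
        chart_deriv (M \<times>\<^sub>M\<^sub>f N) (U \<times> V) (map_prod \<phi> \<psi>) (p, q) (v, w)) (at 0)"
      using chart_deriv_chart_at[OF charted_space_prod[OF M N] _ at] pq(1,2) by simp
  qed (use pq U(3) V(3) in auto)
qed

lemma chart_deriv_prod:
  assumes M: "charted_space M" and N: "charted_space N"
    and U: "(U, \<phi>) \<in> atlas M" "p \<in> U" and V: "(V, \<psi>) \<in> atlas N" "q \<in> V"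
  shows "chart_deriv (M \<times>\<^sub>M\<^sub>f N) (U \<times> V) (map_prod \<phi> \<psi>) (p, q) (v, w) =
    (chart_deriv M U \<phi> p v, chart_deriv N V \<psi> q w)"
proof -
  have pq: "p \<in> carrier M" "q \<in> carrier N"
    using U V chart_subset_carrier[OF M U(1)] chart_subset_carrier[OF N V(1)] by auto
  obtain c where c: "has_velocity M c p v" using has_velocity_exists[OF M pq(1)] by metis
  obtain d where d: "has_velocity N d q w" using has_velocity_exists[OF N pq(2)] by metis
  have "((\<lambda>t. map_prod \<phi> \<psi> (c t, d t)) has_vector_derivative
      chart_deriv (M \<times>\<^sub>M\<^sub>f N) (U \<times> V) (map_prod \<phi> \<psi>) (p, q) (v, w)) (at 0)"
    using has_velocity_chart(2)[OF charted_space_prod[OF M N] has_velocity_Pair[OF M N c d]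
        atlas_prod_manifoldI[OF U(1) V(1)]] U V by simp
  moreover have "((\<lambda>t. map_prod \<phi> \<psi> (c t, d t)) has_vector_derivative
      (chart_deriv M U \<phi> p v, chart_deriv N V \<psi> q w)) (at 0)"
    using has_vector_derivative_Pair[OF has_velocity_chart(2)[OF M c U] has_velocity_chart(2)[OF N d V]]
    by simp
  ultimately show ?thesis by (rule vector_derivative_unique_at)
qed

lemma carrier_model_manifold [simp]: "carrier model_manifold = UNIV"
  and atlas_model_manifold [simp]: "atlas model_manifold = {(UNIV, id)}"
  by (simp_all add: model_manifold_def)

lemma charted_space_model_manifold: "charted_space model_manifold"
  by (rule charted_spaceI)
    (auto simp: model_manifold_def inv_id intro: smooth_on_cong[OF open_UNIV _ smooth_on_ident])


section \<open>Germs of smooth functions along a subset\<close>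

text \<open>
  Smoothness at \<open>z\<close> along an arbitrary subset \<open>S\<close> of a model space, by local extension.  For subsets of a
  model space no charts intervene, so that these germs are closed under the usual operations.
\<close>

definition smooth_germ :: "'z::model_space set \<Rightarrow> 'z \<Rightarrow> ('z \<Rightarrow> 'e::model_space) \<Rightarrow> bool" where
  "smooth_germ S z f \<longleftrightarrow> z \<in> S \<and>
     (\<exists>W F. open W \<and> z \<in> W \<and> smooth_on W F \<and> (\<forall>y\<in>S \<inter> W. f y = F y))"

lemma smooth_germI:
  "\<lbrakk>z \<in> S; open W; z \<in> W; smooth_on W F; \<And>y. y \<in> S \<Longrightarrow> y \<in> W \<Longrightarrow> f y = F y\<rbrakk> \<Longrightarrow> smooth_germ S z f"
  unfolding smooth_germ_def by blast

lemma smooth_germE: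
  assumes "smooth_germ S z f"
  obtains W F where "z \<in> S" "open W" "z \<in> W" "smooth_on W F" "\<forall>y\<in>S \<inter> W. f y = F y"
  using assms unfolding smooth_germ_def by blast

lemma smooth_germ_eventually_subset:
  assumes "smooth_germ T z f" "z \<in> S" "\<forall>\<^sub>F y in nhds z. y \<in> S \<longrightarrow> y \<in> T \<and> f y = g y"
  shows "smooth_germ S z g"
proof -
  obtain W F where W: "z \<in> T" "open W" "z \<in> W" "smooth_on W F" "\<forall>y\<in>T \<inter> W. f y = F y"
    by (rule smooth_germE[OF assms(1)])
  obtain Z where Z: "open Z" "z \<in> Z" "\<And>y. y \<in> Z \<Longrightarrow> y \<in> S \<longrightarrow> y \<in> T \<and> f y = g y"
    using assms(3) unfolding eventually_nhds by blast
  have "smooth_on (W \<inter> Z) F" using smooth_on_subset[OF W(4)] by blast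
  then show ?thesis
    by (rule smooth_germI[OF assms(2) open_Int[OF W(2) Z(1)], rotated]) (use W Z in force)+
qed

lemma smooth_germ_cong:
  assumes "smooth_germ S z f" "\<forall>\<^sub>F y in nhds z. y \<in> S \<longrightarrow> f y = g y"
  shows "smooth_germ S z g"
proof (rule smooth_germ_eventually_subset[OF assms(1)])
  show "z \<in> S" using assms(1) unfolding smooth_germ_def by blast
  show "\<forall>\<^sub>F y in nhds z. y \<in> S \<longrightarrow> y \<in> S \<and> f y = g y" using assms(2) by eventually_elim simp
qed

lemma smooth_germ_open_vimage:
  assumes "smooth_germ S z f" "open V" "f z \<in> V"
  shows "\<forall>\<^sub>F y in nhds z. y \<in> S \<longrightarrow> f y \<in> V"
proof -
  obtain W F where W: "z \<in> S" "open W" "z \<in> W" "smooth_on W F" "\<forall>y\<in>S \<inter> W. f y = F y"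
    by (rule smooth_germE[OF assms(1)])
  have "open (W \<inter> F -` V)"
    by (rule continuous_open_preimage[OF smooth_on_imp_continuous_on[OF W(4)] W(2) assms(2)])
  then show ?thesis
    unfolding eventually_nhds using W assms(3) by (intro exI[of _ "W \<inter> F -` V"]) auto
qed

lemma smooth_germ_subset:
  "smooth_germ S z f \<Longrightarrow> T \<subseteq> S \<Longrightarrow> z \<in> T \<Longrightarrow> smooth_germ T z f"
  unfolding smooth_germ_def by blast

lemma smooth_germ_on_open:
  "open W \<Longrightarrow> smooth_on W f \<Longrightarrow> z \<in> S \<Longrightarrow> z \<in> W \<Longrightarrow> smooth_germ S z f"
  unfolding smooth_germ_def by blast

lemma smooth_germ_const: "z \<in> S \<Longrightarrow> smooth_germ S z (\<lambda>_. c)"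
  by (rule smooth_germ_on_open[OF open_UNIV smooth_on_const]) auto

lemma smooth_germ_ident: "z \<in> S \<Longrightarrow> smooth_germ S z (\<lambda>y. y)"
  by (rule smooth_germ_on_open[OF open_UNIV smooth_on_ident]) auto

lemma smooth_germ_compose:
  assumes "smooth_germ S z f" "open V" "smooth_on V G" "f z \<in> V"
  shows "smooth_germ S z (\<lambda>y. G (f y))"
proof -
  obtain W F where W: "z \<in> S" "open W" "z \<in> W" "smooth_on W F" "\<forall>y\<in>S \<inter> W. f y = F y"
    by (rule smooth_germE[OF assms(1)])
  have o: "open (W \<inter> F -` V)"
    by (rule continuous_open_preimage[OF smooth_on_imp_continuous_on[OF W(4)] W(2) assms(2)])
  show ?thesis
    by (rule smooth_germI[OF W(1) o _ smooth_on_compose[OF o assms(2) smooth_on_subset[OF W(4)] assms(3)]])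
      (use W assms(4) in auto)
qed

lemma smooth_germ_Pair:
  assumes "smooth_germ S z f" "smooth_germ S z g"
  shows "smooth_germ S z (\<lambda>y. (f y, g y))"
proof -
  obtain W F where W: "z \<in> S" "open W" "z \<in> W" "smooth_on W F" "\<forall>y\<in>S \<inter> W. f y = F y"
    by (rule smooth_germE[OF assms(1)])
  obtain Z G where Z: "z \<in> S" "open Z" "z \<in> Z" "smooth_on Z G" "\<forall>y\<in>S \<inter> Z. g y = G y"
    by (rule smooth_germE[OF assms(2)])
  have o: "open (W \<inter> Z)" using W(2) Z(2) by (rule open_Int)
  have "smooth_on (W \<inter> Z) F" "smooth_on (W \<inter> Z) G"
    using smooth_on_subset[OF W(4)] smooth_on_subset[OF Z(4)] by blast+
  then show ?thesis
    by (intro smooth_germI[OF W(1) o _ smooth_on_Pair[OF o]]) (simp_all add: W Z)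
qed

lemma smooth_germ_linear:
  "bounded_linear L \<Longrightarrow> smooth_germ S z f \<Longrightarrow> smooth_germ S z (\<lambda>y. L (f y))"
  by (rule smooth_germ_compose[OF _ open_UNIV smooth_on_bounded_linear[OF open_UNIV]]) auto

lemma smooth_germ_add:
  assumes "smooth_germ S z f" "smooth_germ S z g"
  shows "smooth_germ S z (\<lambda>y. f y + g y)"
  using smooth_germ_compose[OF smooth_germ_Pair[OF assms] open_UNIV
      smooth_on_add[OF open_UNIV smooth_on_bounded_linear[OF open_UNIV bounded_linear_fst]
        smooth_on_bounded_linear[OF open_UNIV bounded_linear_snd]]] by simp

lemma smooth_germ_diff:
  assumes "smooth_germ S z f" "smooth_germ S z g"
  shows "smooth_germ S z (\<lambda>y. f y - g y)"
  using smooth_germ_compose[OF smooth_germ_Pair[OF assms] open_UNIV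
      smooth_on_diff[OF open_UNIV smooth_on_bounded_linear[OF open_UNIV bounded_linear_fst]
        smooth_on_bounded_linear[OF open_UNIV bounded_linear_snd]]] by simp

lemma smooth_germ_scaleR:
  assumes "smooth_germ S z f" "smooth_germ S z g"
  shows "smooth_germ S z (\<lambda>y. f y *\<^sub>R g y)"
  using smooth_germ_compose[OF smooth_germ_Pair[OF assms] open_UNIV
      smooth_on_scaleR[OF open_UNIV smooth_on_bounded_linear[OF open_UNIV bounded_linear_fst]
        smooth_on_bounded_linear[OF open_UNIV bounded_linear_snd]]] by simp

lemma smooth_germ_sum:
  assumes "z \<in> S" "\<And>i. i \<in> I \<Longrightarrow> smooth_germ S z (f i)"
  shows "smooth_germ S z (\<lambda>y. \<Sum>i\<in>I. f i y)"
  using assms(2)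
  by (induction I rule: infinite_finite_induct)
     (auto intro: smooth_germ_const[OF assms(1)] smooth_germ_add)

lemma smooth_germ_derivative_apply:
  assumes f: "smooth_germ S z f" and g: "smooth_germ S z g" and V: "open V" "smooth_on V F" "f z \<in> V"
  shows "smooth_germ S z (\<lambda>y. frechet_derivative F (at (f y)) (g y))"
proof -
  have o: "open (V \<times> (UNIV :: 'b set))" using V(1) by (simp add: open_Times)
  have "smooth_on (V \<times> (UNIV :: 'b set)) (\<lambda>x. frechet_derivative F (at (fst x)) (snd x))"
    by (rule smooth_on_derivative_apply[OF o V(1,2) smooth_on_bounded_linear[OF o bounded_linear_fst]
          smooth_on_bounded_linear[OF o bounded_linear_snd]]) auto
  from smooth_germ_compose[OF smooth_germ_Pair[OF f g] o this] show ?thesis using V(3) by simp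
qed


section \<open>Plots and vector fields along plots\<close>

text \<open>
  A plot is a smooth map from a subset \<open>S\<close> of some model space to a manifold, near the point \<open>z\<close> of \<open>S\<close>.
\<close>

definition plot_at :: "('a, 'e::model_space) manifold \<Rightarrow> 'z::model_space set \<Rightarrow> 'z \<Rightarrow> ('z \<Rightarrow> 'a) \<Rightarrow> bool" where
  "plot_at N S z q \<longleftrightarrow>
     (\<exists>(V, \<psi>)\<in>atlas N. q z \<in> V \<and> (\<forall>\<^sub>F y in nhds z. y \<in> S \<longrightarrow> q y \<in> V) \<and> smooth_germ S z (\<lambda>y. \<psi> (q y)))"

text \<open>
  A smooth vector field \<open>w\<close> along the plot \<open>q\<close>, that is \<open>w y\<close> is tangent at \<open>q y\<close>.  Smoothness is measured
  by the differential of one fixed chart around \<open>q z\<close>; by \<open>field_at_chart\<close> any other would do.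
\<close>

definition field_at :: "('a, 'e::model_space) manifold \<Rightarrow> 'z::model_space set \<Rightarrow> 'z \<Rightarrow>
    ('z \<Rightarrow> 'a) \<Rightarrow> ('z \<Rightarrow> 'e) \<Rightarrow> bool" where
  "field_at N S z q w \<longleftrightarrow>
     (\<exists>(V, \<psi>)\<in>atlas N. q z \<in> V \<and> (\<forall>\<^sub>F y in nhds z. y \<in> S \<longrightarrow> q y \<in> V) \<and> smooth_germ S z (\<lambda>y. \<psi> (q y)) \<and>
        smooth_germ S z (\<lambda>y. chart_deriv N V \<psi> (q y) (w y)))"

lemma field_at_imp_plot_at: "field_at N S z q w \<Longrightarrow> plot_at N S z q"
  unfolding field_at_def plot_at_def by blast

lemma plot_at_in: "plot_at N S z q \<Longrightarrow> z \<in> S"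
  unfolding plot_at_def smooth_germ_def by blast

lemma plot_at_chart:
  assumes N: "charted_space N" and q: "plot_at N S z q" and V: "(V, \<psi>) \<in> atlas N" "q z \<in> V"
  shows "\<forall>\<^sub>F y in nhds z. y \<in> S \<longrightarrow> q y \<in> V" and "smooth_germ S z (\<lambda>y. \<psi> (q y))"
proof -
  obtain U \<phi> where U: "(U, \<phi>) \<in> atlas N" "q z \<in> U" "\<forall>\<^sub>F y in nhds z. y \<in> S \<longrightarrow> q y \<in> U"
    "smooth_germ S z (\<lambda>y. \<phi> (q y))"
    using q unfolding plot_at_def by blast
  have UV: "\<phi> (q z) \<in> \<phi> ` (U \<inter> V)" using U V by blast
  show ev: "\<forall>\<^sub>F y in nhds z. y \<in> S \<longrightarrow> q y \<in> V"
    using U(3) smooth_germ_open_vimage[OF U(4) chart_open_overlap[OF N U(1) V(1)] UV]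
    by eventually_elim (use chart_inj_on[OF N U(1)] in \<open>auto simp: inj_on_def\<close>)
  show "smooth_germ S z (\<lambda>y. \<psi> (q y))"
    by (rule smooth_germ_cong[OF smooth_germ_compose[OF U(4) chart_open_overlap[OF N U(1) V(1)]
            smooth_on_transition[OF N U(1) V(1)] UV]])
      (use U(3) in \<open>eventually_elim, simp add: transition_image[OF N U(1)]\<close>)
qed

lemma field_at_chart:
  assumes N: "charted_space N" and q: "field_at N S z q w" and V: "(V, \<psi>) \<in> atlas N" "q z \<in> V"
  shows "smooth_germ S z (\<lambda>y. chart_deriv N V \<psi> (q y) (w y))"
proof -
  obtain U \<phi> where U: "(U, \<phi>) \<in> atlas N" "q z \<in> U" "\<forall>\<^sub>F y in nhds z. y \<in> S \<longrightarrow> q y \<in> U"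
    "smooth_germ S z (\<lambda>y. \<phi> (q y))" "smooth_germ S z (\<lambda>y. chart_deriv N U \<phi> (q y) (w y))"
    using q unfolding field_at_def by blast
  have UV: "\<phi> (q z) \<in> \<phi> ` (U \<inter> V)" using U V by blast
  show ?thesis
    by (rule smooth_germ_cong[OF smooth_germ_derivative_apply[OF U(4,5)
            chart_open_overlap[OF N U(1) V(1)] smooth_on_transition[OF N U(1) V(1)] UV]])
      (use U(3) plot_at_chart(1)[OF N field_at_imp_plot_at[OF q] V] in
        \<open>eventually_elim, simp add: chart_deriv_change[OF N U(1) V(1)]\<close>)
qed

lemma field_atI:
  assumes "charted_space N" "plot_at N S z q" "(V, \<psi>) \<in> atlas N" "q z \<in> V"
    "smooth_germ S z (\<lambda>y. chart_deriv N V \<psi> (q y) (w y))"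
  shows "field_at N S z q w"
  unfolding field_at_def using assms plot_at_chart[OF assms(1-4)] by blast

lemma plot_at_cases:
  assumes "plot_at N S z q"
  obtains V \<psi> where "(V, \<psi>) \<in> atlas N" "q z \<in> V"
  using assms unfolding plot_at_def by blast

lemma plot_at_subset:
  assumes "plot_at N S z q" "T \<subseteq> S" "z \<in> T"
  shows "plot_at N T z q"
proof -
  obtain U \<phi> where U: "(U, \<phi>) \<in> atlas N" "q z \<in> U" "\<forall>\<^sub>F y in nhds z. y \<in> S \<longrightarrow> q y \<in> U"
    "smooth_germ S z (\<lambda>y. \<phi> (q y))"
    using assms(1) unfolding plot_at_def by blast
  have "\<forall>\<^sub>F y in nhds z. y \<in> T \<longrightarrow> q y \<in> U"
    using U(3) by eventually_elim (use assms(2) in blast)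
  then show ?thesis
    unfolding plot_at_def using U smooth_germ_subset[OF U(4) assms(2,3)] by blast
qed

lemma plot_at_cong:
  assumes "plot_at N S z q" "\<And>y. y \<in> S \<Longrightarrow> q y = r y"
  shows "plot_at N S z r"
proof -
  obtain U \<phi> where U: "(U, \<phi>) \<in> atlas N" "q z \<in> U" "\<forall>\<^sub>F y in nhds z. y \<in> S \<longrightarrow> q y \<in> U"
    "smooth_germ S z (\<lambda>y. \<phi> (q y))"
    using assms(1) unfolding plot_at_def by blast
  have "\<forall>\<^sub>F y in nhds z. y \<in> S \<longrightarrow> r y \<in> U"
    using U(3) by eventually_elim (use assms(2) in auto)
  moreover have "smooth_germ S z (\<lambda>y. \<phi> (r y))"
    using U(4) by (rule smooth_germ_cong) (simp add: assms(2))
  ultimately show ?thesis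
    unfolding plot_at_def using U(1,2) assms(2)[OF plot_at_in[OF assms(1)]] by force
qed

lemma field_at_cong:
  assumes N: "charted_space N" and w: "field_at N S z q w"
    and "\<And>y. y \<in> S \<Longrightarrow> q y = r y" "\<And>y. y \<in> S \<Longrightarrow> w y = v y"
  shows "field_at N S z r v"
proof -
  have q: "plot_at N S z q" using w by (rule field_at_imp_plot_at)
  obtain V \<psi> where V: "(V, \<psi>) \<in> atlas N" "q z \<in> V" using plot_at_cases[OF q] .
  show ?thesis
    by (rule field_atI[OF N plot_at_cong[OF q] V(1)], fact, simp add: assms(3)[symmetric] plot_at_in[OF q] V(2),
        rule smooth_germ_cong[OF field_at_chart[OF N w V]]) (simp add: assms(3,4))
qed

lemma plot_at_open:
  assumes N: "charted_space N" and q: "plot_at N S z q" and U: "open_in N U" "q z \<in> U"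
  shows "\<forall>\<^sub>F y in nhds z. y \<in> S \<longrightarrow> q y \<in> U"
proof -
  obtain V \<psi> where V: "(V, \<psi>) \<in> atlas N" "q z \<in> V" using plot_at_cases[OF q] .
  have o: "open (\<psi> ` (V \<inter> U))" using U(1) V(1) unfolding open_in_def by blast
  have "\<psi> (q z) \<in> \<psi> ` (V \<inter> U)" using U(2) V(2) by blast
  from smooth_germ_open_vimage[OF plot_at_chart(2)[OF N q V] o this] plot_at_chart(1)[OF N q V]
  show ?thesis
    by eventually_elim (use chart_inj_on[OF N V(1)] in \<open>auto simp: inj_on_def\<close>)
qed

lemma plot_at_smooth_map:
  assumes M: "charted_space M" and N: "charted_space N" and f: "smooth_map_on M N R f"
    and q: "plot_at M S z q" "\<And>y. y \<in> S \<Longrightarrow> q y \<in> R"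
  shows "plot_at N S z (\<lambda>y. f (q y))"
proof -
  have qz: "q z \<in> R" using q plot_at_in by blast
  have fz: "f (q z) \<in> carrier N" using f qz unfolding smooth_map_on_def by blast
  obtain U \<phi> where U: "(U, \<phi>) \<in> atlas M" "q z \<in> U" using plot_at_cases[OF q(1)] .
  obtain V \<psi> where V: "(V, \<psi>) \<in> atlas N" "f (q z) \<in> V" using chart_at_cases[OF N fz] by blast
  obtain W F where W: "\<phi> (q z) \<in> W" "open W" "smooth_on W F"
    "\<And>p. \<lbrakk>p \<in> U; p \<in> R; \<phi> p \<in> W\<rbrakk> \<Longrightarrow> f p \<in> V \<and> \<psi> (f p) = F (\<phi> p)"
    using smooth_map_on_charts[OF M N f qz U V] by metis
  note qc = plot_at_chart[OF M q(1) U]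
  have ev: "\<forall>\<^sub>F y in nhds z. y \<in> S \<longrightarrow> f (q y) \<in> V \<and> \<psi> (f (q y)) = F (\<phi> (q y))"
    using qc(1) smooth_germ_open_vimage[OF qc(2) W(2,1)]
    by eventually_elim (use W(4) q(2) in auto)
  have "smooth_germ S z (\<lambda>y. \<psi> (f (q y)))"
    by (rule smooth_germ_cong[OF smooth_germ_compose[OF qc(2) W(2,3,1)]])
      (use ev in \<open>eventually_elim, simp\<close>)
  moreover have "\<forall>\<^sub>F y in nhds z. y \<in> S \<longrightarrow> f (q y) \<in> V" using ev by eventually_elim simp
  ultimately show ?thesis unfolding plot_at_def using V by blast
qed

text \<open>
  In charts the differential of \<open>f\<close> on vectors tangent to \<open>R\<close> is the derivative of a local extension of \<open>f\<close>,
  which is smooth in the point and in the vector.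
\<close>

lemma field_at_differential:
  assumes M: "charted_space M" and N: "charted_space N" and f: "smooth_map_on M N R f"
    and w: "field_at M S z q w" and tan: "\<And>y. y \<in> S \<Longrightarrow> q y \<in> R \<and> tangent_to M R (q y) (w y)"
  shows "field_at N S z (\<lambda>y. f (q y)) (\<lambda>y. differential_on M N R f (q y) (w y))"
proof -
  note q = field_at_imp_plot_at[OF w]
  have qz: "q z \<in> R" using tan plot_at_in[OF q] by blast
  have fz: "f (q z) \<in> carrier N" using f qz unfolding smooth_map_on_def by blast
  obtain U \<phi> where U: "(U, \<phi>) \<in> atlas M" "q z \<in> U" using plot_at_cases[OF q(1)] .
  obtain V \<psi> where V: "(V, \<psi>) \<in> atlas N" "f (q z) \<in> V" using chart_at_cases[OF N fz] by blast
  obtain W F where W: "\<phi> (q z) \<in> W" "open W" "smooth_on W F"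
    "\<And>p. \<lbrakk>p \<in> U; p \<in> R; \<phi> p \<in> W\<rbrakk> \<Longrightarrow> f p \<in> V \<and> \<psi> (f p) = F (\<phi> p)"
    using smooth_map_on_charts[OF M N f qz U V] by metis
  note qc = plot_at_chart[OF M q(1) U]
  have "smooth_germ S z (\<lambda>y. chart_deriv N V \<psi> (f (q y)) (differential_on M N R f (q y) (w y)))"
  proof (rule smooth_germ_cong[OF smooth_germ_derivative_apply[OF qc(2) field_at_chart[OF M w U] W(2,3,1)]])
    show "\<forall>\<^sub>F y in nhds z. y \<in> S \<longrightarrow> frechet_derivative F (at (\<phi> (q y))) (chart_deriv M U \<phi> (q y) (w y)) =
        chart_deriv N V \<psi> (f (q y)) (differential_on M N R f (q y) (w y))"
      using qc(1) smooth_germ_open_vimage[OF qc(2) W(2,1)]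
    proof eventually_elim
      case (elim y)
      show ?case
        by (rule impI, rule differential_on_in_charts[OF M N f _ U(1) _ V(1) _ _ W(2)
              smooth_on_has_derivative[OF W(3)], symmetric])
          (use elim tan W(4) in auto)
    qed
  qed
  with plot_at_smooth_map[OF M N f q] tan V show ?thesis by (intro field_atI[OF N]) auto
qed

lemma field_at_diff:
  assumes N: "charted_space N" and v: "field_at N S z q v" and w: "field_at N S z q w"
  shows "field_at N S z q (\<lambda>y. v y - w y)"
proof -
  note q = field_at_imp_plot_at[OF v]
  obtain V \<psi> where V: "(V, \<psi>) \<in> atlas N" "q z \<in> V" using plot_at_cases[OF q] .
  have "smooth_germ S z (\<lambda>y. chart_deriv N V \<psi> (q y) (v y - w y))"
    by (rule smooth_germ_cong[OF smooth_germ_diff[OF field_at_chart[OF N v V] field_at_chart[OF N w V]]])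
      (use plot_at_chart(1)[OF N q V] in
        \<open>eventually_elim, simp add: linear_diff[OF linear_chart_deriv[OF N V(1)]]\<close>)
  then show ?thesis by (rule field_atI[OF N q V])
qed

lemma field_at_zero:
  assumes N: "charted_space N" and q: "plot_at N S z q"
  shows "field_at N S z q (\<lambda>_. 0)"
proof -
  obtain V \<psi> where V: "(V, \<psi>) \<in> atlas N" "q z \<in> V" using plot_at_cases[OF q] .
  have "smooth_germ S z (\<lambda>y. chart_deriv N V \<psi> (q y) 0)"
    by (rule smooth_germ_cong[OF smooth_germ_const[OF plot_at_in[OF q], of 0]])
      (use plot_at_chart(1)[OF N q V] in
        \<open>eventually_elim, simp add: linear_0[OF linear_chart_deriv[OF N V(1)]]\<close>)
  then show ?thesis by (rule field_atI[OF N q V])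
qed

lemma field_at_lincomb:
  assumes N: "charted_space N" and q: "plot_at N S z q"
    and c: "\<And>i. i \<in> I \<Longrightarrow> smooth_germ S z (c i)" and v: "\<And>i. i \<in> I \<Longrightarrow> field_at N S z q (v i)"
  shows "field_at N S z q (\<lambda>y. \<Sum>i\<in>I. c i y *\<^sub>R v i y)"
proof -
  obtain V \<psi> where V: "(V, \<psi>) \<in> atlas N" "q z \<in> V" using plot_at_cases[OF q] .
  have "smooth_germ S z (\<lambda>y. chart_deriv N V \<psi> (q y) (\<Sum>i\<in>I. c i y *\<^sub>R v i y))"
  proof (rule smooth_germ_cong[OF smooth_germ_sum[OF plot_at_in[OF q]
        smooth_germ_scaleR[OF c field_at_chart[OF N v V]]]])
    show "\<forall>\<^sub>F y in nhds z. y \<in> S \<longrightarrow> (\<Sum>i\<in>I. c i y *\<^sub>R chart_deriv N V \<psi> (q y) (v i y)) =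
        chart_deriv N V \<psi> (q y) (\<Sum>i\<in>I. c i y *\<^sub>R v i y)"
      using plot_at_chart(1)[OF N q V] by eventually_elim
        (simp add: linear_sum[OF linear_chart_deriv[OF N V(1)]] linear_cmul[OF linear_chart_deriv[OF N V(1)]])
  qed auto
  then show ?thesis by (rule field_atI[OF N q V])
qed

lemma plot_at_Pair:
  assumes "plot_at M S z p" "plot_at N S z q"
  shows "plot_at (M \<times>\<^sub>M\<^sub>f N) S z (\<lambda>y. (p y, q y))"
proof -
  obtain U \<phi> where U: "(U, \<phi>) \<in> atlas M" "p z \<in> U" "\<forall>\<^sub>F y in nhds z. y \<in> S \<longrightarrow> p y \<in> U"
    "smooth_germ S z (\<lambda>y. \<phi> (p y))"
    using assms(1) unfolding plot_at_def by blast
  obtain V \<psi> where V: "(V, \<psi>) \<in> atlas N" "q z \<in> V" "\<forall>\<^sub>F y in nhds z. y \<in> S \<longrightarrow> q y \<in> V"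
    "smooth_germ S z (\<lambda>y. \<psi> (q y))"
    using assms(2) unfolding plot_at_def by blast
  have "\<forall>\<^sub>F y in nhds z. y \<in> S \<longrightarrow> (p y, q y) \<in> U \<times> V"
    using U(3) V(3) by eventually_elim simp
  moreover have "smooth_germ S z (\<lambda>y. map_prod \<phi> \<psi> (p y, q y))"
    using smooth_germ_Pair[OF U(4) V(4)] by simp
  ultimately show ?thesis
    unfolding plot_at_def using atlas_prod_manifoldI[OF U(1) V(1)] U(2) V(2)
    by (intro bexI[of _ "(U \<times> V, map_prod \<phi> \<psi>)"]) auto
qed

lemma field_at_Pair:
  assumes M: "charted_space M" and N: "charted_space N"
    and v: "field_at M S z p v" and w: "field_at N S z q w"
  shows "field_at (M \<times>\<^sub>M\<^sub>f N) S z (\<lambda>y. (p y, q y)) (\<lambda>y. (v y, w y))"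
proof -
  note p = field_at_imp_plot_at[OF v] and q = field_at_imp_plot_at[OF w]
  obtain U \<phi> where U: "(U, \<phi>) \<in> atlas M" "p z \<in> U" using plot_at_cases[OF p] .
  obtain V \<psi> where V: "(V, \<psi>) \<in> atlas N" "q z \<in> V" using plot_at_cases[OF q] .
  show ?thesis
  proof (rule field_atI[OF charted_space_prod[OF M N] plot_at_Pair[OF p q] atlas_prod_manifoldI[OF U(1) V(1)]])
    show "smooth_germ S z (\<lambda>y. chart_deriv (M \<times>\<^sub>M\<^sub>f N) (U \<times> V) (map_prod \<phi> \<psi>) (p y, q y) (v y, w y))"
      by (rule smooth_germ_cong[OF smooth_germ_Pair[OF field_at_chart[OF M v U] field_at_chart[OF N w V]]])
        (use plot_at_chart(1)[OF M p U] plot_at_chart(1)[OF N q V] in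
          \<open>eventually_elim, simp add: chart_deriv_prod[OF M N U(1) _ V(1)]\<close>)
  qed (use U V in simp)
qed

lemma
  assumes "plot_at (M \<times>\<^sub>M\<^sub>f N) S z q"
  shows plot_at_fst: "plot_at M S z (\<lambda>y. fst (q y))"
    and plot_at_snd: "plot_at N S z (\<lambda>y. snd (q y))"
proof -
  obtain A \<alpha> where A: "(A, \<alpha>) \<in> atlas (M \<times>\<^sub>M\<^sub>f N)" "q z \<in> A" "\<forall>\<^sub>F y in nhds z. y \<in> S \<longrightarrow> q y \<in> A"
    "smooth_germ S z (\<lambda>y. \<alpha> (q y))"
    using assms(1) unfolding plot_at_def by blast
  obtain U \<phi> V \<psi> where UV: "(A, \<alpha>) = (U \<times> V, map_prod \<phi> \<psi>)" "(U, \<phi>) \<in> atlas M" "(V, \<psi>) \<in> atlas N"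
    using atlas_prod_manifoldE[OF A(1)] .
  have "\<forall>\<^sub>F y in nhds z. y \<in> S \<longrightarrow> fst (q y) \<in> U" "\<forall>\<^sub>F y in nhds z. y \<in> S \<longrightarrow> snd (q y) \<in> V"
    using A(3) UV(1) by (auto elim!: eventually_mono)
  moreover have "smooth_germ S z (\<lambda>y. \<phi> (fst (q y)))" "smooth_germ S z (\<lambda>y. \<psi> (snd (q y)))"
    using smooth_germ_linear[OF bounded_linear_fst A(4)] smooth_germ_linear[OF bounded_linear_snd A(4)] UV(1)
    by auto
  moreover have "fst (q z) \<in> U" "snd (q z) \<in> V" using A(2) UV(1) by auto
  ultimately show "plot_at M S z (\<lambda>y. fst (q y))" "plot_at N S z (\<lambda>y. snd (q y))"
    unfolding plot_at_def using UV(2,3) by blast+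
qed

lemma plot_at_model_manifold_iff: "plot_at model_manifold S z f \<longleftrightarrow> smooth_germ S z f"
  unfolding plot_at_def by simp

lemma plot_at_const:
  assumes M: "charted_space M" and p: "p \<in> carrier M" and z: "z \<in> S"
  shows "plot_at M S z (\<lambda>_. p)"
proof -
  obtain U \<phi> where "(U, \<phi>) \<in> atlas M" "p \<in> U" using chart_at_cases[OF M p] by blast
  then show ?thesis unfolding plot_at_def using smooth_germ_const[OF z] by auto
qed

lemma plot_at_inv_into:
  assumes U: "(U, \<phi>) \<in> atlas M" "inj_on \<phi> U" and p: "p \<in> U" "p \<in> S"
  shows "plot_at M (\<phi> ` (U \<inter> S)) (\<phi> p) (inv_into U \<phi>)"
proof -
  have inv: "inv_into U \<phi> (\<phi> p') = p'" if "p' \<in> U" for p' using U(2) that by simp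
  have z: "\<phi> p \<in> \<phi> ` (U \<inter> S)" using p by blast
  have "smooth_germ (\<phi> ` (U \<inter> S)) (\<phi> p) (\<lambda>y. \<phi> (inv_into U \<phi> y))"
    by (rule smooth_germ_cong[OF smooth_germ_ident[OF z]]) (use inv in \<open>auto intro!: always_eventually\<close>)
  moreover have "\<forall>\<^sub>F y in nhds (\<phi> p). y \<in> \<phi> ` (U \<inter> S) \<longrightarrow> inv_into U \<phi> y \<in> U"
    using inv by (intro always_eventually) auto
  ultimately show ?thesis
    unfolding plot_at_def using U(1) inv[OF p(1)] p(1) by (intro bexI[of _ "(U, \<phi>)"]) auto
qed

text \<open>
  All that is required of the atlas of the source of a map in order to test smoothness on plots.  Total
  spaces satisfy it by inspection, without comparison of their charts.
\<close>

definition chart_cover :: "('a, 'e::model_space) manifold \<Rightarrow> bool" where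
  "chart_cover M \<longleftrightarrow> (\<forall>p\<in>carrier M. \<exists>(U, \<phi>)\<in>atlas M. p \<in> U \<and> inj_on \<phi> U \<and> open (\<phi> ` U))"

lemma charted_space_imp_chart_cover: "charted_space M \<Longrightarrow> chart_cover M"
  unfolding chart_cover_def
proof
  fix p assume M: "charted_space M" and p: "p \<in> carrier M"
  obtain U \<phi> where U: "(U, \<phi>) \<in> atlas M" "p \<in> U" using chart_at_cases[OF M p] by blast
  then show "\<exists>(U, \<phi>)\<in>atlas M. p \<in> U \<and> inj_on \<phi> U \<and> open (\<phi> ` U)"
    using chart_inj_on[OF M U(1)] chart_open_image[OF M U(1)] by blast
qed

lemma chart_cover_prod:
  assumes "chart_cover M" "chart_cover N"
  shows "chart_cover (M \<times>\<^sub>M\<^sub>f N)"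
  unfolding chart_cover_def
proof
  fix r assume "r \<in> carrier (M \<times>\<^sub>M\<^sub>f N)"
  then obtain p q where r: "r = (p, q)" "p \<in> carrier M" "q \<in> carrier N" by auto
  obtain U \<phi> where U: "(U, \<phi>) \<in> atlas M" "p \<in> U" "inj_on \<phi> U" "open (\<phi> ` U)"
    using assms(1) r(2) unfolding chart_cover_def by blast
  obtain V \<psi> where V: "(V, \<psi>) \<in> atlas N" "q \<in> V" "inj_on \<psi> V" "open (\<psi> ` V)"
    using assms(2) r(3) unfolding chart_cover_def by blast
  have "inj_on (map_prod \<phi> \<psi>) (U \<times> V)" "open (map_prod \<phi> \<psi> ` (U \<times> V))"
    using U V by (auto simp: map_prod_inj_on open_Times map_prod_surj_on[OF refl refl])
  then show "\<exists>(U, \<phi>)\<in>atlas (M \<times>\<^sub>M\<^sub>f N). r \<in> U \<and> inj_on \<phi> U \<and> open (\<phi> ` U)"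
    using atlas_prod_manifoldI[OF U(1) V(1)] U(2) V(2) r(1)
    by (intro bexI[of _ "(U \<times> V, map_prod \<phi> \<psi>)"]) auto
qed

text \<open>
  The inverse of a chart is itself a plot.  The test on this plot is the existence of a local extension in
  that chart.
\<close>

lemma smooth_map_onI_plots:
  fixes Q :: "('a, 'z::model_space) manifold"
  assumes S: "S \<subseteq> carrier Q" "f ` S \<subseteq> carrier N"
    and cover: "chart_cover Q"
    and plots: "\<And>T (z::'z) q. plot_at Q T z q \<Longrightarrow> (\<And>y. y \<in> T \<Longrightarrow> q y \<in> S) \<Longrightarrow> plot_at N T z (\<lambda>y. f (q y))"
  shows "smooth_map_on Q N S f"
  unfolding smooth_map_on_def
proof (intro conjI ballI S)
  fix p assume p: "p \<in> S"
  obtain U \<phi> where U: "(U, \<phi>) \<in> atlas Q" "p \<in> U" "inj_on \<phi> U" "open (\<phi> ` U)"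
    using cover p S(1) unfolding chart_cover_def by blast
  let ?T = "\<phi> ` (U \<inter> S)" and ?q = "inv_into U \<phi>"
  have inv: "?q (\<phi> p') = p'" if "p' \<in> U" for p' using U(3) that by simp
  have "plot_at Q ?T (\<phi> p) ?q" by (rule plot_at_inv_into[OF U(1,3,2) p])
  then have "plot_at N ?T (\<phi> p) (\<lambda>y. f (?q y))"
    by (rule plots) (use inv in auto)
  then obtain V \<psi> where V: "(V, \<psi>) \<in> atlas N" "\<forall>\<^sub>F y in nhds (\<phi> p). y \<in> ?T \<longrightarrow> f (?q y) \<in> V"
    "smooth_germ ?T (\<phi> p) (\<lambda>y. \<psi> (f (?q y)))"
    unfolding plot_at_def by blast
  obtain Z where Z: "open Z" "\<phi> p \<in> Z" "\<And>y. y \<in> Z \<Longrightarrow> y \<in> ?T \<Longrightarrow> f (?q y) \<in> V"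
    using V(2) unfolding eventually_nhds by blast
  obtain W F where W: "open W" "\<phi> p \<in> W" "smooth_on W F"
    "\<forall>y\<in>?T \<inter> W. \<psi> (f (?q y)) = F y"
    by (rule smooth_germE[OF V(3)])
  let ?W = "W \<inter> Z \<inter> \<phi> ` U"
  have "\<phi> p \<in> ?W" "open ?W" "?W \<subseteq> \<phi> ` U" "smooth_on ?W F"
    using W Z U(2,4) by (auto intro: smooth_on_subset)
  moreover have "\<forall>r\<in>U \<inter> S. \<phi> r \<in> ?W \<longrightarrow> f r \<in> V \<and> \<psi> (f r) = F (\<phi> r)"
  proof (intro ballI impI)
    fix r assume r: "r \<in> U \<inter> S" "\<phi> r \<in> ?W"
    then have "\<phi> r \<in> ?T" by blast
    then show "f r \<in> V \<and> \<psi> (f r) = F (\<phi> r)"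
      using bspec[OF W(4), of "\<phi> r"] Z(3)[of "\<phi> r"] r inv[of r] by auto
  qed
  ultimately show "\<exists>(U, \<phi>)\<in>atlas Q. \<exists>(V, \<psi>)\<in>atlas N. \<exists>W F. p \<in> U \<and> \<phi> p \<in> W \<and> open W \<and>
      W \<subseteq> \<phi> ` U \<and> smooth_on W F \<and> (\<forall>q\<in>U \<inter> S. \<phi> q \<in> W \<longrightarrow> f q \<in> V \<and> \<psi> (f q) = F (\<phi> q))"
    using U(2) by (intro bexI[OF _ U(1)] bexI[OF _ V(1)] case_prodI exI[of _ ?W] exI[of _ F]) simp
qed


section \<open>Pullbacks of tangent bundles\<close>

lemma chart_domain_open_in:
  assumes "charted_space M" "(U, \<phi>) \<in> atlas M"
  shows "open_in M U"
  unfolding open_in_def using chart_subset_carrier[OF assms] chart_open_overlap[OF assms(1) _ assms(2)] by blast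

lemma open_in_vimage:
  assumes P: "charted_space P" and N: "charted_space N" and a: "smooth_map P N a" and U: "open_in N U"
  shows "open_in P {p \<in> carrier P. a p \<in> U}"
  unfolding open_in_def
proof (intro conjI ballI, blast, clarify)
  fix A \<alpha> assume A: "(A, \<alpha>) \<in> atlas P"
  let ?B = "{p \<in> carrier P. a p \<in> U}"
  note inj = chart_inj_on[OF P A]
  have "\<exists>T. open T \<and> x \<in> T \<and> T \<subseteq> \<alpha> ` (A \<inter> ?B)" if x: "x \<in> \<alpha> ` (A \<inter> ?B)" for x
  proof -
    obtain p where p: "x = \<alpha> p" "p \<in> A" "p \<in> carrier P" "a p \<in> U" using x by blast
    have sub: "A \<inter> carrier P = A" using chart_subset_carrier[OF P A] by blast
    have "plot_at P (\<alpha> ` A) x (inv_into A \<alpha>)"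
      using plot_at_inv_into[OF A inj p(2,3)] unfolding sub p(1) .
    then have pl: "plot_at N (\<alpha> ` A) x (\<lambda>y. a (inv_into A \<alpha> y))"
      by (rule plot_at_smooth_map[OF P N a]) (use inj chart_subset_carrier[OF P A] in auto)
    have ax: "a (inv_into A \<alpha> x) \<in> U" using p inj by simp
    have "\<forall>\<^sub>F y in nhds x. y \<in> \<alpha> ` A"
      using chart_open_image[OF P A] p by (intro eventually_nhds_in_open) auto
    with plot_at_open[OF N pl U ax] have "\<forall>\<^sub>F y in nhds x. y \<in> \<alpha> ` (A \<inter> ?B)"
      by eventually_elim (use inj chart_subset_carrier[OF P A] in auto)
    then show ?thesis unfolding eventually_nhds by blast
  qed
  then show "open (\<alpha> ` (A \<inter> ?B))" using open_subopen by blast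
qed

context
  fixes P :: "('p, 'k::model_space) manifold" and N :: "('x, 'd::model_space) manifold" and a :: "'p \<Rightarrow> 'x"
  assumes P: "charted_space P" and N: "charted_space N" and a: "smooth_map P N a"
begin

abbreviation (input) "pulled_back_tangent \<equiv> pullback_bundle P a (tangent_bundle N)"

lemma pulled_back_tangentE:
  assumes "T \<in> pulled_back_tangent"
  obtains U \<phi> where "T = ({p \<in> carrier P. a p \<in> U}, \<lambda>p. chart_deriv N U \<phi> (a p))" "(U, \<phi>) \<in> atlas N"
  using assms unfolding pullback_bundle_def tangent_bundle_def by auto

lemma pulled_back_tangentI:
  "(U, \<phi>) \<in> atlas N \<Longrightarrow>
    ({p \<in> carrier P. a p \<in> U}, \<lambda>p. chart_deriv N U \<phi> (a p)) \<in> pulled_back_tangent"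
  unfolding pullback_bundle_def tangent_bundle_def by auto

lemma anchor_in: "p \<in> carrier P \<Longrightarrow> a p \<in> carrier N"
  using a unfolding smooth_map_on_def by blast

text \<open>
  The transition map takes the vector with given coordinates in one chart to its coordinates in another, and
  smoothness of a vector field does not depend on the chart.
\<close>

lemma pulled_back_transition_smooth:
  assumes U: "(U, \<phi>) \<in> atlas N" and V: "(V, \<psi>) \<in> atlas N"
  shows "smooth_map_on (P \<times>\<^sub>M\<^sub>f model_manifold) model_manifold
    (({p \<in> carrier P. a p \<in> U} \<inter> {p \<in> carrier P. a p \<in> V}) \<times> UNIV)
    (\<lambda>(p, v). chart_deriv N V \<psi> (a p) (inv (chart_deriv N U \<phi> (a p)) v))"
proof (rule smooth_map_onI_plots)
  show "chart_cover (P \<times>\<^sub>M\<^sub>f (model_manifold :: ('d, 'd) manifold))"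
    by (intro chart_cover_prod charted_space_imp_chart_cover P charted_space_model_manifold)
next
  fix T :: "('k \<times> 'd) set" and z and q :: "'k \<times> 'd \<Rightarrow> 'p \<times> 'd"
  assume q: "plot_at (P \<times>\<^sub>M\<^sub>f model_manifold) T z q"
    and S: "\<And>y. y \<in> T \<Longrightarrow> q y \<in> ({p \<in> carrier P. a p \<in> U} \<inter> {p \<in> carrier P. a p \<in> V}) \<times> UNIV"
  let ?p = "\<lambda>y. fst (q y)" and ?w = "\<lambda>y. inv (chart_deriv N U \<phi> (a (fst (q y)))) (snd (q y))"
  have S': "?p y \<in> carrier P" "a (?p y) \<in> U" "a (?p y) \<in> V" if "y \<in> T" for y
    using S[OF that] by auto
  have ap: "plot_at N T z (\<lambda>y. a (?p y))"
    by (rule plot_at_smooth_map[OF P N a plot_at_fst[OF q]]) (rule S')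
  have z: "z \<in> T" using plot_at_in[OF q] .
  have e: "smooth_germ T z (\<lambda>y. snd (q y))"
    using plot_at_snd[OF q] plot_at_model_manifold_iff by blast
  have "field_at N T z (\<lambda>y. a (?p y)) ?w"
  proof (rule field_atI[OF N ap U S'(2)[OF z]], rule smooth_germ_cong[OF e], intro always_eventually allI impI)
    fix y assume "y \<in> T"
    then have "surj (chart_deriv N U \<phi> (a (?p y)))"
      using bij_chart_deriv[OF N U S'(2)] by (simp add: bij_is_surj)
    then show "snd (q y) = chart_deriv N U \<phi> (a (?p y)) (?w y)" by (simp add: surj_f_inv_f)
  qed
  from field_at_chart[OF N this V S'(3)[OF z]]
  show "plot_at model_manifold T z
      (\<lambda>y. (case q y of (p, v) \<Rightarrow> chart_deriv N V \<psi> (a p) (inv (chart_deriv N U \<phi> (a p)) v)))"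
    unfolding plot_at_model_manifold_iff by (simp add: case_prod_beta)
qed auto

lemma vector_bundle_pulled_back_tangent: "vector_bundle P pulled_back_tangent"
  unfolding vector_bundle_def
proof (intro conjI)
  show "\<forall>(U, \<Phi>)\<in>pulled_back_tangent. open_in P U \<and> (\<forall>p\<in>U. linear (\<Phi> p) \<and> bij (\<Phi> p))"
  proof (intro ballI, clarify)
    fix U' \<Phi> assume "(U', \<Phi>) \<in> pulled_back_tangent"
    then obtain U \<phi> where U: "(U', \<Phi>) = ({p \<in> carrier P. a p \<in> U}, \<lambda>p. chart_deriv N U \<phi> (a p))"
      "(U, \<phi>) \<in> atlas N" by (rule pulled_back_tangentE)
    show "open_in P U' \<and> (\<forall>p\<in>U'. linear (\<Phi> p) \<and> bij (\<Phi> p))"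
      using U(1) open_in_vimage[OF P N a chart_domain_open_in[OF N U(2)]]
        linear_chart_deriv[OF N U(2)] bij_chart_deriv[OF N U(2)] by auto
  qed
  show "(\<Union>(U, \<Phi>)\<in>pulled_back_tangent. U) = carrier P"
  proof (intro equalityI subsetI)
    fix p assume "p \<in> (\<Union>(U, \<Phi>)\<in>pulled_back_tangent. U)"
    then show "p \<in> carrier P" by (auto elim!: pulled_back_tangentE)
  next
    fix p assume p: "p \<in> carrier P"
    obtain U \<phi> where "(U, \<phi>) \<in> atlas N" "a p \<in> U" using chart_at_cases[OF N anchor_in[OF p]] by blast
    then show "p \<in> (\<Union>(U, \<Phi>)\<in>pulled_back_tangent. U)"
      using p by (auto intro!: bexI[OF _ pulled_back_tangentI])
  qed
  show "\<forall>(U, \<Phi>)\<in>pulled_back_tangent. \<forall>(V, \<Psi>)\<in>pulled_back_tangent.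
      smooth_map_on (P \<times>\<^sub>M\<^sub>f model_manifold) model_manifold
          ((U \<inter> V) \<times> UNIV) (\<lambda>(p, v). \<Psi> p (inv (\<Phi> p) v))"
  proof (intro ballI, clarify)
    fix U' \<Phi> V' \<Psi> assume E: "(U', \<Phi>) \<in> pulled_back_tangent" "(V', \<Psi>) \<in> pulled_back_tangent"
    obtain U \<phi> where U: "(U', \<Phi>) = ({p \<in> carrier P. a p \<in> U}, \<lambda>p. chart_deriv N U \<phi> (a p))"
      "(U, \<phi>) \<in> atlas N" by (rule pulled_back_tangentE[OF E(1)])
    obtain V \<psi> where V: "(V', \<Psi>) = ({p \<in> carrier P. a p \<in> V}, \<lambda>p. chart_deriv N V \<psi> (a p))"
      "(V, \<psi>) \<in> atlas N" by (rule pulled_back_tangentE[OF E(2)])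
    show "smooth_map_on (P \<times>\<^sub>M\<^sub>f model_manifold) model_manifold
          ((U' \<inter> V') \<times> UNIV) (\<lambda>(p, v). \<Psi> p (inv (\<Phi> p) v))"
      using pulled_back_transition_smooth[OF U(2) V(2)] U(1) V(1) by simp
  qed
qed

lemma atlas_total_space:
  "atlas (total_space P E) = {total_chart c T |c T. c \<in> atlas P \<and> T \<in> E}"
  by (simp add: total_space_def)

lemma atlas_total_spaceE:
  assumes "(B, \<beta>) \<in> atlas (total_space P pulled_back_tangent)"
  obtains A \<alpha> U \<phi> where "(A, \<alpha>) \<in> atlas P" "(U, \<phi>) \<in> atlas N"
    "B = (A \<inter> {p \<in> carrier P. a p \<in> U}) \<times> UNIV" "\<beta> = (\<lambda>(p, v). (\<alpha> p, chart_deriv N U \<phi> (a p) v))"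
proof -
  obtain c T where c: "(B, \<beta>) = total_chart c T" "c \<in> atlas P" and T: "T \<in> pulled_back_tangent"
    using assms unfolding atlas_total_space by blast
  obtain U \<phi> where U: "T = ({p \<in> carrier P. a p \<in> U}, \<lambda>p. chart_deriv N U \<phi> (a p))" "(U, \<phi>) \<in> atlas N"
    by (rule pulled_back_tangentE[OF T])
  show ?thesis
    using that[of "fst c" "snd c" U \<phi>] c U by (simp add: total_chart_def)
qed

lemma atlas_total_spaceI:
  assumes "(A, \<alpha>) \<in> atlas P" "(U, \<phi>) \<in> atlas N"
  shows "((A \<inter> {p \<in> carrier P. a p \<in> U}) \<times> UNIV, \<lambda>(p, v). (\<alpha> p, chart_deriv N U \<phi> (a p) v))
      \<in> atlas (total_space P pulled_back_tangent)"
proof -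
  have "total_chart (A, \<alpha>) ({p \<in> carrier P. a p \<in> U}, \<lambda>p. chart_deriv N U \<phi> (a p))
      \<in> atlas (total_space P pulled_back_tangent)"
    unfolding atlas_total_space using assms(1) pulled_back_tangentI[OF assms(2)] by blast
  then show ?thesis by (simp add: total_chart_def)
qed

lemma carrier_total_space: "carrier (total_space P pulled_back_tangent) = carrier P \<times> UNIV"
  by (simp add: total_space_def)

lemma chart_cover_total_space: "chart_cover (total_space P pulled_back_tangent)"
  unfolding chart_cover_def
proof
  fix r assume "r \<in> carrier (total_space P pulled_back_tangent)"
  then obtain p v where r: "r = (p, v)" "p \<in> carrier P" by (auto simp: carrier_total_space)
  obtain A \<alpha> where A: "(A, \<alpha>) \<in> atlas P" "p \<in> A" using chart_at_cases[OF P r(2)] by blast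
  obtain U \<phi> where U: "(U, \<phi>) \<in> atlas N" "a p \<in> U" using chart_at_cases[OF N anchor_in[OF r(2)]] by blast
  let ?B = "A \<inter> {p \<in> carrier P. a p \<in> U}" and ?\<beta> = "\<lambda>(p, v). (\<alpha> p, chart_deriv N U \<phi> (a p) v)"
  have bij: "bij (chart_deriv N U \<phi> (a p))" if "p \<in> ?B" for p using bij_chart_deriv[OF N U(1)] that by blast
  have "inj_on ?\<beta> (?B \<times> UNIV)"
  proof (rule inj_onI, clarify)
    fix p v p' v' assume p: "p \<in> A" "p \<in> carrier P" "a p \<in> U" "p' \<in> A"
      and eq: "\<alpha> p = \<alpha> p'" "chart_deriv N U \<phi> (a p) v = chart_deriv N U \<phi> (a p') v'"
    have "p = p'" using chart_inj_on[OF P A(1)] p eq(1) by (simp add: inj_on_def)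
    then show "p = p' \<and> v = v'" using eq(2) bij[of p] p by (auto simp: bij_def inj_eq)
  qed
  moreover have "?\<beta> ` (?B \<times> UNIV) = \<alpha> ` ?B \<times> UNIV"
  proof (intro equalityI subsetI)
    fix x assume "x \<in> \<alpha> ` ?B \<times> (UNIV :: 'd set)"
    then obtain p w where x: "x = (\<alpha> p, w)" "p \<in> ?B" by auto
    then obtain v where "w = chart_deriv N U \<phi> (a p) v" using bij[of p] by (meson bij_def surjD)
    then show "x \<in> ?\<beta> ` (?B \<times> UNIV)" using x by (auto intro!: image_eqI[of _ _ "(p, v)"])
  qed auto
  moreover have "open (\<alpha> ` ?B)"
    using open_in_vimage[OF P N a chart_domain_open_in[OF N U(1)]] A(1) unfolding open_in_def by blast
  ultimately have "inj_on ?\<beta> (?B \<times> UNIV) \<and> open (?\<beta> ` (?B \<times> UNIV))"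
    by (simp add: open_Times)
  then show "\<exists>(U, \<phi>)\<in>atlas (total_space P pulled_back_tangent). r \<in> U \<and> inj_on \<phi> U \<and> open (\<phi> ` U)"
    using A U r by (intro bexI[OF _ atlas_total_spaceI[OF A(1) U(1)]]) auto
qed

text \<open>
  A chart of the total space combines a chart \<open>\<alpha>\<close> of the base and the differential of an unrelated chart
  \<open>\<phi>\<close> of \<open>N\<close>.  The second component of a plot in such a chart is the coordinate expression of a vector field
  along the image of the base plot under \<open>a\<close>.
\<close>

lemma plot_at_total_spaceD:
  assumes q: "plot_at (total_space P pulled_back_tangent) S z q"
  shows "plot_at P S z (\<lambda>y. fst (q y))" and "field_at N S z (\<lambda>y. a (fst (q y))) (\<lambda>y. snd (q y))"
proof -
  obtain B \<beta> where B: "(B, \<beta>) \<in> atlas (total_space P pulled_back_tangent)" "q z \<in> B"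
    "\<forall>\<^sub>F y in nhds z. y \<in> S \<longrightarrow> q y \<in> B" "smooth_germ S z (\<lambda>y. \<beta> (q y))"
    using q unfolding plot_at_def by blast
  obtain A \<alpha> U \<phi> where A: "(A, \<alpha>) \<in> atlas P" "(U, \<phi>) \<in> atlas N"
    and B': "B = (A \<inter> {p \<in> carrier P. a p \<in> U}) \<times> UNIV" "\<beta> = (\<lambda>(p, v). (\<alpha> p, chart_deriv N U \<phi> (a p) v))"
    by (rule atlas_total_spaceE[OF B(1)])
  have g: "smooth_germ S z (\<lambda>y. \<alpha> (fst (q y)))"
    "smooth_germ S z (\<lambda>y. chart_deriv N U \<phi> (a (fst (q y))) (snd (q y)))"
    using smooth_germ_linear[OF bounded_linear_fst B(4)] smooth_germ_linear[OF bounded_linear_snd B(4)]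
    by (simp_all add: B' case_prod_beta)
  have ev: "\<forall>\<^sub>F y in nhds z. y \<in> S \<longrightarrow> fst (q y) \<in> A \<inter> {p \<in> carrier P. a p \<in> U}"
    using B(3) by eventually_elim (auto simp: B')
  have qz: "fst (q z) \<in> A" "a (fst (q z)) \<in> U" "fst (q z) \<in> carrier P" using B(2) by (auto simp: B')
  have "\<forall>\<^sub>F y in nhds z. y \<in> S \<longrightarrow> fst (q y) \<in> A" using ev by eventually_elim auto
  then show p: "plot_at P S z (\<lambda>y. fst (q y))"
    unfolding plot_at_def using A(1) qz g(1) by blast
  let ?T = "{y \<in> S. fst (q y) \<in> carrier P}"
  have zT: "z \<in> ?T" using plot_at_in[OF p] qz by simp
  have T: "\<forall>\<^sub>F y in nhds z. y \<in> S \<longrightarrow> y \<in> ?T" using ev by eventually_elim auto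
  have ap: "plot_at N ?T z (\<lambda>y. a (fst (q y)))"
    by (rule plot_at_smooth_map[OF P N a plot_at_subset[OF p _ zT]]) auto
  have "smooth_germ S z (\<lambda>y. \<phi> (a (fst (q y))))"
    by (rule smooth_germ_eventually_subset[OF plot_at_chart(2)[OF N ap A(2) qz(2)] plot_at_in[OF p]])
      (use T in \<open>eventually_elim, simp\<close>)
  moreover have "\<forall>\<^sub>F y in nhds z. y \<in> S \<longrightarrow> a (fst (q y)) \<in> U" using ev by eventually_elim auto
  ultimately show "field_at N S z (\<lambda>y. a (fst (q y))) (\<lambda>y. snd (q y))"
    unfolding field_at_def using A(2) qz(2) g(2) by blast
qed

lemma plot_at_total_spaceI:
  assumes p: "plot_at P S z p" and w: "field_at N S z (\<lambda>y. a (p y)) w"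
  shows "plot_at (total_space P pulled_back_tangent) S z (\<lambda>y. (p y, w y))"
proof -
  note ap = field_at_imp_plot_at[OF w]
  obtain A \<alpha> where A: "(A, \<alpha>) \<in> atlas P" "p z \<in> A" using plot_at_cases[OF p] .
  obtain U \<phi> where U: "(U, \<phi>) \<in> atlas N" "a (p z) \<in> U" using plot_at_cases[OF ap] by blast
  let ?B = "(A \<inter> {p \<in> carrier P. a p \<in> U}) \<times> (UNIV :: 'd set)"
    and ?\<beta> = "\<lambda>(p, v). (\<alpha> p, chart_deriv N U \<phi> (a p) v)"
  have "\<forall>\<^sub>F y in nhds z. y \<in> S \<longrightarrow> (p y, w y) \<in> ?B"
    using plot_at_chart(1)[OF P p A] plot_at_chart(1)[OF N ap U]
    by eventually_elim (use chart_subset_carrier[OF P A(1)] in auto)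
  moreover have "smooth_germ S z (\<lambda>y. ?\<beta> (p y, w y))"
    using smooth_germ_Pair[OF plot_at_chart(2)[OF P p A] field_at_chart[OF N w U]] by simp
  moreover have "(p z, w z) \<in> ?B" using A U chart_subset_carrier[OF P A(1)] by auto
  ultimately show ?thesis
    unfolding plot_at_def by (intro bexI[OF _ atlas_total_spaceI[OF A(1) U(1)]]) simp
qed

end

lemma smooth_map_id:
  assumes M: "charted_space M"
  shows "smooth_map M M (\<lambda>p. p)"
  by (rule smooth_map_onI_plots) (auto intro: charted_space_imp_chart_cover[OF M])

text \<open>
  This makes the results on pulled back tangent bundles available for \<open>TP\<close> itself.
\<close>

lemma tangent_bundle_eq_pullback:
  assumes M: "charted_space M"
  shows "tangent_bundle M = pullback_bundle M (\<lambda>p. p) (tangent_bundle M)"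
proof -
  note id = M M smooth_map_id[OF M]
  have U: "{p \<in> carrier M. p \<in> U} = U" if "(U, \<phi>) \<in> atlas M" for U \<phi>
    using chart_subset_carrier[OF M that] by blast
  show ?thesis
  proof (intro equalityI subsetI)
    fix T assume "T \<in> tangent_bundle M"
    then obtain V \<psi> where V: "T = (V, \<lambda>p. chart_deriv M V \<psi> p)" "(V, \<psi>) \<in> atlas M"
      unfolding tangent_bundle_def by blast
    then show "T \<in> pullback_bundle M (\<lambda>p. p) (tangent_bundle M)"
      using pulled_back_tangentI[OF id V(2)] U[OF V(2)] by simp
  next
    fix T assume T: "T \<in> pullback_bundle M (\<lambda>p. p) (tangent_bundle M)"
    obtain V \<psi> where V: "T = ({p \<in> carrier M. p \<in> V}, \<lambda>p. chart_deriv M V \<psi> p)" "(V, \<psi>) \<in> atlas M"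
      by (rule pulled_back_tangentE[OF id T])
    then show "T \<in> tangent_bundle M"
      using U[OF V(2)] unfolding tangent_bundle_def by auto
  qed
qed


section \<open>Horizontal lifts\<close>

text \<open>
  Applied to the differential of a submersion at \<open>g\<close> and the horizontal space \<open>H g\<close>.
\<close>

lemma bij_betw_complement_kernel:
  assumes D: "linear D" "surj D" and K: "subspace K" "K \<inter> {w. D w = 0} = {0}"
    and dec: "\<And>w. \<exists>y\<in>K. \<exists>z\<in>{w. D w = 0}. w = y + z"
  shows "bij_betw D K UNIV"
  unfolding bij_betw_def
proof
  show "inj_on D K"
  proof (rule inj_onI)
    fix x y assume xy: "x \<in> K" "y \<in> K" "D x = D y"
    then have "x - y \<in> K \<inter> {w. D w = 0}" using subspace_diff[OF K(1)] by (simp add: linear_diff[OF D(1)])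
    then have "x - y = 0" using K(2) by blast
    then show "x = y" by simp
  qed
  show "D ` K = UNIV"
  proof (intro equalityI subsetI, simp)
    fix v
    obtain w where w: "v = D w" using D(2) by (meson surjD)
    obtain y z where "y \<in> K" "D z = 0" "w = y + z" using dec[of w] by blast
    then show "v \<in> D ` K" using w by (auto simp: linear_add[OF D(1)])
  qed
qed

context
  fixes M :: "('g, 'e::model_space) manifold" and N :: "('x, 'd::model_space) manifold"
    and s :: "'g \<Rightarrow> 'x" and H :: "'g \<Rightarrow> 'e set"
  assumes M: "charted_space M" and N: "charted_space N" and s: "submersion M N s"
    and sub: "subbundle M (tangent_bundle M) H"
    and compl: "\<And>g. g \<in> carrier M \<Longrightarrow>
      (let V = {w. differential M N s g w = 0} in H g \<inter> V = {0} \<and> (\<forall>w. \<exists>y\<in>H g. \<exists>z\<in>V. w = y + z))"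
begin

abbreviation (input) "subm_deriv \<equiv> differential M N s"
abbreviation (input) "hlift g \<equiv> the_inv_into (H g) (subm_deriv g)"

lemma subbundle_trivialization:
  assumes "g \<in> carrier M"
  obtains U and \<Phi> :: "'g \<Rightarrow> 'e \<Rightarrow> 'e" and W where "g \<in> U" "open_in M U" "subspace W"
    "\<forall>q\<in>U. linear (\<Phi> q) \<and> bij (\<Phi> q) \<and> (\<forall>e. inv (\<Phi> q) e \<in> H q \<longleftrightarrow> e \<in> W)"
    "\<forall>(V, \<psi>)\<in>atlas M. smooth_map_on (M \<times>\<^sub>M\<^sub>f model_manifold) model_manifold
        ((U \<inter> V) \<times> UNIV) (\<lambda>(p, v). chart_deriv M V \<psi> p (inv (\<Phi> p) v))"
proof -
  obtain U \<Phi> W where U: "g \<in> U" "vector_bundle M (insert (U, \<Phi>) (tangent_bundle M))" "subspace W"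
    "\<forall>q\<in>U. \<Phi> q ` H q = W"
    using bspec[OF sub[unfolded subbundle_def] assms] by blast
  let ?E = "insert (U, \<Phi>) (tangent_bundle M)"
  have "\<forall>(U, \<Phi>)\<in>?E. open_in M U \<and> (\<forall>p\<in>U. linear (\<Phi> p) \<and> bij (\<Phi> p))"
    using U(2) unfolding vector_bundle_def by (elim conjE)
  from bspec[OF this insertI1] have o: "open_in M U"
    and b: "\<And>q. q \<in> U \<Longrightarrow> linear (\<Phi> q) \<and> bij (\<Phi> q)" by simp_all
  have sm: "smooth_map_on (M \<times>\<^sub>M\<^sub>f model_manifold) model_manifold
        ((U \<inter> V) \<times> UNIV) (\<lambda>(p, v). chart_deriv M V \<psi> p (inv (\<Phi> p) v))" if "(V, \<psi>) \<in> atlas M" for V \<psi>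
  proof -
    have "(V, \<lambda>p. chart_deriv M V \<psi> p) \<in> tangent_bundle M" using that unfolding tangent_bundle_def by blast
    then have in': "(V, \<lambda>p. chart_deriv M V \<psi> p) \<in> insert (U, \<Phi>) (tangent_bundle M)" by (rule insertI2)
    have "\<forall>(U', \<Phi>')\<in>?E. \<forall>(V, \<Psi>)\<in>?E. smooth_map_on (M \<times>\<^sub>M\<^sub>f model_manifold) model_manifold
          ((U' \<inter> V) \<times> UNIV) (\<lambda>(p, v). \<Psi> p (inv (\<Phi>' p) v))"
      using U(2) unfolding vector_bundle_def by (elim conjE)
    from bspec[OF bspec[OF this insertI1, unfolded prod.case] in'] show ?thesis unfolding prod.case .
  qed
  have "inv (\<Phi> q) e \<in> H q \<longleftrightarrow> e \<in> W" if q: "q \<in> U" for q e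
  proof
    assume "inv (\<Phi> q) e \<in> H q"
    then have "\<Phi> q (inv (\<Phi> q) e) \<in> W" using bspec[OF U(4) q] by blast
    then show "e \<in> W" using b[OF q] by (simp add: bij_is_surj surj_f_inv_f)
  next
    assume "e \<in> W"
    then obtain h where "h \<in> H q" "e = \<Phi> q h" using bspec[OF U(4) q] by blast
    then show "inv (\<Phi> q) e \<in> H q" using b[OF q] by (simp add: bij_is_inj)
  qed
  then have "\<forall>q\<in>U. linear (\<Phi> q) \<and> bij (\<Phi> q) \<and> (\<forall>e. inv (\<Phi> q) e \<in> H q \<longleftrightarrow> e \<in> W)"
    using b by simp
  moreover have "\<forall>(V, \<psi>)\<in>atlas M. smooth_map_on (M \<times>\<^sub>M\<^sub>f model_manifold) model_manifold
        ((U \<inter> V) \<times> UNIV) (\<lambda>(p, v). chart_deriv M V \<psi> p (inv (\<Phi> p) v))"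
    by (intro ballI, clarify, rule sm)
  ultimately show ?thesis by (rule that[OF U(1) o U(3)])
qed

lemma smooth_source: "smooth_map M N s"
  using s unfolding submersion_def by blast

lemma linear_subm_deriv: "g \<in> carrier M \<Longrightarrow> linear (subm_deriv g)"
  by (rule linear_differential_on[OF M N smooth_source])

lemma subspace_horizontal:
  assumes "g \<in> carrier M"
  shows "subspace (H g)"
proof -
  obtain U and \<Phi> :: "'g \<Rightarrow> 'e \<Rightarrow> 'e" and W where U: "g \<in> U" "open_in M U" "subspace W"
    "\<forall>q\<in>U. linear (\<Phi> q) \<and> bij (\<Phi> q) \<and> (\<forall>e. inv (\<Phi> q) e \<in> H q \<longleftrightarrow> e \<in> W)"
    "\<forall>(V, \<psi>)\<in>atlas M. smooth_map_on (M \<times>\<^sub>M\<^sub>f model_manifold) model_manifold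
        ((U \<inter> V) \<times> UNIV) (\<lambda>(p, v). chart_deriv M V \<psi> p (inv (\<Phi> p) v))"
    by (rule subbundle_trivialization[OF assms])
  have b: "linear (\<Phi> g)" "bij (\<Phi> g)" and HW: "\<And>e. inv (\<Phi> g) e \<in> H g \<longleftrightarrow> e \<in> W"
    using bspec[OF U(4,1)] by auto
  have "H g = \<Phi> g -` W"
    using HW[of "\<Phi> g _"] b(2) by (auto simp: bij_is_inj)
  then show ?thesis using linear_subspace_vimage[OF b(1) U(3)] by simp
qed

lemma bij_betw_horizontal: "g \<in> carrier M \<Longrightarrow> bij_betw (subm_deriv g) (H g) UNIV"
  using compl[of g] s unfolding submersion_def Let_def
  by (intro bij_betw_complement_kernel linear_subm_deriv subspace_horizontal) auto

lemma hlift_in: "g \<in> carrier M \<Longrightarrow> hlift g v \<in> H g"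
  using bij_betw_horizontal[of g] by (auto simp: bij_betw_def intro: the_inv_into_into)

lemma subm_deriv_hlift: "g \<in> carrier M \<Longrightarrow> subm_deriv g (hlift g v) = v"
  using bij_betw_horizontal[of g] by (auto simp: bij_betw_def intro: f_the_inv_into_f)

lemma hlift_unique: "g \<in> carrier M \<Longrightarrow> h \<in> H g \<Longrightarrow> subm_deriv g h = v \<Longrightarrow> hlift g v = h"
  using bij_betw_horizontal[of g] by (auto simp: bij_betw_def intro: the_inv_into_f_f)

lemma linear_hlift:
  assumes g: "g \<in> carrier M"
  shows "linear (hlift g)"
proof (rule linearI)
  show "hlift g (u + v) = hlift g u + hlift g v" for u v
    by (rule hlift_unique[OF g]) (auto simp: linear_add[OF linear_subm_deriv[OF g]] subm_deriv_hlift[OF g]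
        intro: subspace_add[OF subspace_horizontal[OF g]] hlift_in[OF g])
  show "hlift g (r *\<^sub>R v) = r *\<^sub>R hlift g v" for r v
    by (rule hlift_unique[OF g]) (auto simp: linear_cmul[OF linear_subm_deriv[OF g]] subm_deriv_hlift[OF g]
        intro: subspace_scale[OF subspace_horizontal[OF g]] hlift_in[OF g])
qed

text \<open>
  Over a trivialization of \<open>H\<close>, constant vectors give smooth horizontal fields \<open>h b\<close>, which are chosen so that
  they project to a basis at \<open>z\<close>.  Let \<open>A y\<close> be the linear map that sends the basis to the coordinates of the
  projections of the \<open>h b y\<close>.  It is the identity at \<open>z\<close>, hence invertible nearby with smooth inverse, and the
  horizontal lift of \<open>v\<close> is the combination of the \<open>h b\<close> whose coefficients are the components of
  \<open>inv (A y)\<close> applied to the coordinates of \<open>v\<close>.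
\<close>

lemma field_at_hlift:
  assumes g: "plot_at M S z g" and gM: "\<And>y. y \<in> S \<Longrightarrow> g y \<in> carrier M"
    and v: "field_at N S z (\<lambda>y. s (g y)) v"
  shows "field_at M S z g (\<lambda>y. hlift (g y) (v y))"
proof -
  have z: "z \<in> S" by (rule plot_at_in[OF g])
  obtain V \<psi> where V: "(V, \<psi>) \<in> atlas M" "g z \<in> V" using plot_at_cases[OF g] .
  obtain Y \<eta> where Y: "(Y, \<eta>) \<in> atlas N" "s (g z) \<in> Y" using plot_at_cases[OF field_at_imp_plot_at[OF v]] .
  obtain U and \<Phi> :: "'g \<Rightarrow> 'e \<Rightarrow> 'e" and K where U: "g z \<in> U" "open_in M U" "subspace K"
    "\<forall>q\<in>U. linear (\<Phi> q) \<and> bij (\<Phi> q) \<and> (\<forall>e. inv (\<Phi> q) e \<in> H q \<longleftrightarrow> e \<in> K)"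
    "\<forall>(V, \<psi>)\<in>atlas M. smooth_map_on (M \<times>\<^sub>M\<^sub>f model_manifold) model_manifold
        ((U \<inter> V) \<times> UNIV) (\<lambda>(p, v). chart_deriv M V \<psi> p (inv (\<Phi> p) v))"
    by (rule subbundle_trivialization[OF gM[OF z]])
  define T where "T = {y \<in> S. g y \<in> U \<inter> V}"
  have zT: "z \<in> T" using z U(1) V(2) by (simp add: T_def)
  have evT: "\<forall>\<^sub>F y in nhds z. y \<in> S \<longrightarrow> y \<in> T"
    using plot_at_open[OF M g U(2,1)] plot_at_chart(1)[OF M g V] by eventually_elim (simp add: T_def)
  have gT: "plot_at M T z g" by (rule plot_at_subset[OF g _ zT]) (auto simp: T_def)
  have frame: "field_at M T z g (\<lambda>y. inv (\<Phi> (g y)) e)" for e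
  proof -
    have "plot_at (M \<times>\<^sub>M\<^sub>f model_manifold) T z (\<lambda>y. (g y, e))"
      using plot_at_Pair[OF gT] smooth_germ_const[OF zT] plot_at_model_manifold_iff by blast
    then have "plot_at model_manifold T z
        (\<lambda>y. (\<lambda>(p, v). chart_deriv M V \<psi> p (inv (\<Phi> p) v)) (g y, e))"
      by (rule plot_at_smooth_map[OF charted_space_prod[OF M charted_space_model_manifold]
            charted_space_model_manifold bspec[OF U(5) V(1), simplified]]) (auto simp: T_def)
    then have "smooth_germ T z (\<lambda>y. chart_deriv M V \<psi> (g y) (inv (\<Phi> (g y)) e))"
      unfolding plot_at_model_manifold_iff by simp
    then show ?thesis by (rule field_atI[OF M gT V])
  qed
  define \<epsilon> where "\<epsilon> b = \<Phi> (g z) (hlift (g z) (inv (chart_deriv N Y \<eta> (s (g z))) b))" for b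
  define h where "h b y = inv (\<Phi> (g y)) (\<epsilon> b)" for b y
  have hz: "h b z = hlift (g z) (inv (chart_deriv N Y \<eta> (s (g z))) b)" for b
    using bspec[OF U(4,1)] unfolding h_def \<epsilon>_def by (simp add: bij_is_inj)
  have \<epsilon>: "\<epsilon> b \<in> K" for b
    using bspec[OF U(4,1)] hlift_in[OF gM[OF z]] hz[of b] unfolding h_def by metis
  have hH: "h b y \<in> H (g y)" if "y \<in> T" for b y
    using bspec[OF U(4), of "g y"] that \<epsilon> unfolding h_def T_def by simp
  have hfield: "field_at M T z g (h b)" for b unfolding h_def by (rule frame)
  define m where "m b y = chart_deriv N Y \<eta> (s (g y)) (subm_deriv (g y) (h b y))" for b y
  have dh: "field_at N T z (\<lambda>y. s (g y)) (\<lambda>y. subm_deriv (g y) (h b y))" for b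
    by (rule field_at_differential[OF M N smooth_source hfield])
      (use gM tangent_to_carrier[OF M] in \<open>auto simp: T_def\<close>)
  have m: "smooth_germ T z (m b)" for b
    unfolding m_def by (rule field_at_chart[OF N dh Y])
  have mz: "m b z = b" for b
    unfolding m_def hz subm_deriv_hlift[OF gM[OF z]]
    using bij_chart_deriv[OF N Y] by (simp add: bij_is_surj surj_f_inv_f)
  have "\<forall>b. \<exists>W F. open W \<and> z \<in> W \<and> smooth_on W F \<and> (\<forall>y\<in>T \<inter> W. m b y = F y)"
    using m unfolding smooth_germ_def by (intro allI) blast
  from choice[OF this] obtain W where
    "\<forall>b. \<exists>F. open (W b) \<and> z \<in> W b \<and> smooth_on (W b) F \<and> (\<forall>y\<in>T \<inter> W b. m b y = F y)" ..
  from choice[OF this] obtain F where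
    WF: "\<forall>b. open (W b) \<and> z \<in> W b \<and> smooth_on (W b) (F b) \<and> (\<forall>y\<in>T \<inter> W b. m b y = F b y)" ..
  then have W: "\<And>b. open (W b)" "\<And>b. z \<in> W b" "\<And>b. smooth_on (W b) (F b)"
    "\<And>b y. y \<in> T \<Longrightarrow> y \<in> W b \<Longrightarrow> m b y = F b y"
    by auto
  \<comment> \<open>The coordinates \<open>m b\<close> are known along \<open>T\<close> only; inverting a smooth family requires an open set, so
    their local extensions \<open>F b\<close> are inverted.\<close>
  define W1 where "W1 = (\<Inter>b\<in>mbasis. W b)"
  have W1: "open W1" "z \<in> W1" "\<And>b. b \<in> mbasis \<Longrightarrow> smooth_on W1 (F b)"
    unfolding W1_def using W(1,2) by (auto intro: smooth_on_subset[OF W(3)])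
  have cont: "continuous_on W1 (\<lambda>y. \<Sum>b\<in>mbasis. norm (F b y - b))"
    by (intro continuous_intros smooth_on_imp_continuous_on W1(3))
  define W0 where "W0 = W1 \<inter> (\<lambda>y. \<Sum>b\<in>mbasis. norm (F b y - b)) -` {..<1/2}"
  have Fz: "F b z = b" for b using W(4)[OF zT W(2)] mz by simp
  have W0: "open W0" "z \<in> W0" "W0 \<subseteq> W1"
    unfolding W0_def using continuous_open_preimage[OF cont W1(1), of "{..<1/2}"] W1(2) by (auto simp: Fz)
  define A where "A y x = (\<Sum>b\<in>mbasis. (x \<bullet> b) *\<^sub>R F b y)" for y and x :: 'd
  have linA: "linear (A y)" for y
    unfolding A_def
    by (intro linearI) (simp_all add: inner_add_left sum.distrib scaleR_add_left scaleR_sum_right)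
  have A_basis: "A y b = F b y" if "b \<in> mbasis" for y b
  proof -
    have "A y b = (\<Sum>b'\<in>mbasis. if b' = b then F b' y else 0)"
      unfolding A_def by (rule sum.cong) (auto simp: inner_mbasis that)
    then show ?thesis using that by simp
  qed
  have bijA: "bij (A y)" if "y \<in> W0" for y
  proof (rule near_identity_imp_bij[OF linA])
    fix x
    have "norm (A y x - x) \<le> (\<Sum>b\<in>mbasis. norm (A y b - b)) * norm x"
      by (rule norm_le_sum_mbasis[OF linear_compose_sub[OF linA linear_ident]])
    also have "(\<Sum>b\<in>mbasis. norm (A y b - b)) = (\<Sum>b\<in>mbasis. norm (F b y - b))"
      by (rule sum.cong) (auto simp: A_basis)
    also have "\<dots> * norm x \<le> 1 / 2 * norm x"
      using that unfolding W0_def by (intro mult_right_mono) auto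
    finally show "norm (A y x - x) \<le> norm x / 2" by simp
  qed
  have smA: "smooth_on W0 (\<lambda>y. A y x)" for x
    unfolding A_def using smooth_on_subset[OF W1(3) W0(3)]
    by (intro smooth_on_sum[OF W0(1)] smooth_on_scaleR[OF W0(1) smooth_on_const]) auto
  have smI: "smooth_on W0 (\<lambda>y. inv (A y) x)" for x
    by (rule smooth_on_inverse_family[OF W0(1) linA bijA smA])
  define k where "k y = chart_deriv N Y \<eta> (s (g y)) (v y)" for y
  have k: "smooth_germ T z k"
    unfolding k_def by (rule smooth_germ_subset[OF field_at_chart[OF N v Y] _ zT]) (auto simp: T_def)
  have \<kappa>: "smooth_germ T z (\<lambda>y. inv (A y) (k y) \<bullet> c)" for c
  proof (rule smooth_germ_linear[OF bounded_linear_inner_left], rule smooth_germ_cong)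
    show "smooth_germ T z (\<lambda>y. \<Sum>b\<in>mbasis. (k y \<bullet> b) *\<^sub>R inv (A y) b)"
      by (intro smooth_germ_sum[OF zT] smooth_germ_scaleR smooth_germ_on_open[OF W0(1) smI zT W0(2)]
          smooth_germ_linear[OF bounded_linear_inner_left k])
    have "\<forall>\<^sub>F y in nhds z. y \<in> W0" using W0(1,2) by (rule eventually_nhds_in_open)
    then show "\<forall>\<^sub>F y in nhds z. y \<in> T \<longrightarrow> (\<Sum>b\<in>mbasis. (k y \<bullet> b) *\<^sub>R inv (A y) b) = inv (A y) (k y)"
    proof eventually_elim
      case (elim y)
      show ?case
        using linear_mbasis_expansion[OF linear_inverse_family[OF W0(1) linA bijA smA elim]] by metis
    qed
  qed
  let ?w = "\<lambda>y. \<Sum>b\<in>mbasis. (inv (A y) (k y) \<bullet> b) *\<^sub>R h b y"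
  have w: "field_at M T z g ?w"
    by (rule field_at_lincomb[OF M gT \<kappa> hfield])
  have eq: "?w y = hlift (g y) (v y)" if y: "y \<in> T" "y \<in> W0" "s (g y) \<in> Y" for y
  proof -
    have gy: "g y \<in> carrier M" using y gM by (simp add: T_def)
    note lin = linear_subm_deriv[OF gy] and lin' = linear_chart_deriv[OF N Y(1) y(3)]
    have "chart_deriv N Y \<eta> (s (g y)) (subm_deriv (g y) (?w y)) = (\<Sum>b\<in>mbasis. (inv (A y) (k y) \<bullet> b) *\<^sub>R m b y)"
      by (simp add: m_def linear_sum[OF lin] linear_cmul[OF lin] linear_sum[OF lin'] linear_cmul[OF lin'])
    also have "\<dots> = A y (inv (A y) (k y))"
      unfolding A_def using y W0(3) W(4) by (intro sum.cong) (auto simp: W1_def)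
    also have "\<dots> = chart_deriv N Y \<eta> (s (g y)) (v y)"
      using bijA[OF y(2)] by (simp add: bij_is_surj surj_f_inv_f k_def)
    finally have "subm_deriv (g y) (?w y) = v y"
      using bij_chart_deriv[OF N Y(1) y(3)] by (simp add: bij_def inj_eq)
    moreover have "?w y \<in> H (g y)"
      by (intro subspace_sum subspace_scale subspace_horizontal gy hH y)
    ultimately show ?thesis by (intro hlift_unique[OF gy, symmetric])
  qed
  have "\<forall>\<^sub>F y in nhds z. y \<in> S \<longrightarrow> y \<in> T \<and> ?w y = hlift (g y) (v y)"
    using evT eventually_nhds_in_open[OF W0(1,2)] plot_at_chart(1)[OF N field_at_imp_plot_at[OF v] Y]
    by eventually_elim (use eq in blast)
  then have "smooth_germ S z (\<lambda>y. chart_deriv M V \<psi> (g y) (hlift (g y) (v y)))"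
    by (intro smooth_germ_eventually_subset[OF field_at_chart[OF M w V] z])
      (erule eventually_mono, simp)
  then show ?thesis by (rule field_atI[OF M g V])
qed

end


section \<open>The tangent action of a Lie groupoid\<close>

locale lie_groupoid_setting =
  fixes X :: "('g, 'e::model_space, 'x, 'd::model_space) groupoid"
  assumes lie: "lie_groupoid X"
begin

abbreviation "G \<equiv> arrows X"
abbreviation "X0 \<equiv> objects X"
abbreviation "s \<equiv> src X"
abbreviation "t \<equiv> tgt X"
abbreviation "one \<equiv> gunit X"
abbreviation "i \<equiv> ginv X"
abbreviation gmult (infixl \<open>\<odot>\<close> 70) where "g \<odot> h \<equiv> gcomp X g h"
abbreviation "ds \<equiv> differential G X0 s"
abbreviation "dt \<equiv> differential G X0 t"
abbreviation "di \<equiv> differential G G i"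
abbreviation "d1 \<equiv> differential X0 G one"

lemma charted_G: "charted_space G" and charted_X0: "charted_space X0"
  using lie unfolding lie_groupoid_def
  by - (elim conjE, erule smooth_manifold_imp_charted_space)+

lemma submersion_s: "submersion G X0 s" and submersion_t: "submersion G X0 t"
  using lie unfolding lie_groupoid_def by - (elim conjE, assumption)+

lemma smooth_s: "smooth_map G X0 s" and smooth_t: "smooth_map G X0 t"
  using submersion_s submersion_t unfolding submersion_def by blast+

lemma smooth_comp: "smooth_map_on (G \<times>\<^sub>M\<^sub>f G) G (composable X) (\<lambda>(g, h). g \<odot> h)"
  and smooth_one: "smooth_map X0 G one" and smooth_i: "smooth_map G G i"
  using lie unfolding lie_groupoid_def by - (elim conjE, assumption)+

lemma source_target_comp:
    "\<forall>(g, h)\<in>composable X. s (g \<odot> h) = s h \<and> t (g \<odot> h) = t g"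
  and associativity:
    "\<forall>g h k. (g, h) \<in> composable X \<and> (h, k) \<in> composable X \<longrightarrow> (g \<odot> h) \<odot> k = g \<odot> (h \<odot> k)"
  and source_target_one: "\<forall>x\<in>carrier X0. s (one x) = x \<and> t (one x) = x"
  and unit_inverse_laws: "\<forall>g\<in>carrier G. g \<odot> one (s g) = g \<and> one (t g) \<odot> g = g \<and>
        s (i g) = t g \<and> t (i g) = s g \<and> i g \<odot> g = one (s g) \<and> g \<odot> i g = one (t g)"
  using lie unfolding lie_groupoid_def by - (elim conjE, assumption)+

lemma composableI: "g \<in> carrier G \<Longrightarrow> h \<in> carrier G \<Longrightarrow> s g = t h \<Longrightarrow> (g, h) \<in> composable X"
  by (simp add: composable_def)

lemma composableD:
  assumes "(g, h) \<in> composable X"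
  shows "g \<in> carrier G" "h \<in> carrier G" "s g = t h"
  using assms by (simp_all add: composable_def)

lemma s_in: "g \<in> carrier G \<Longrightarrow> s g \<in> carrier X0"
  and t_in: "g \<in> carrier G \<Longrightarrow> t g \<in> carrier X0"
  and one_in: "x \<in> carrier X0 \<Longrightarrow> one x \<in> carrier G"
  and i_in: "g \<in> carrier G \<Longrightarrow> i g \<in> carrier G"
  using smooth_s smooth_t smooth_one smooth_i by (blast dest: smooth_map_on_image)+

lemma comp_in: "(g, h) \<in> composable X \<Longrightarrow> g \<odot> h \<in> carrier G"
  using smooth_map_on_image[OF smooth_comp, of "(g, h)"] by simp

lemma s_comp: "(g, h) \<in> composable X \<Longrightarrow> s (g \<odot> h) = s h"
  and t_comp: "(g, h) \<in> composable X \<Longrightarrow> t (g \<odot> h) = t g"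
  using source_target_comp by blast+

lemma comp_assoc:
  "(g, h) \<in> composable X \<Longrightarrow> (h, k) \<in> composable X \<Longrightarrow> (g \<odot> h) \<odot> k = g \<odot> (h \<odot> k)"
  using associativity by blast

lemma s_one: "x \<in> carrier X0 \<Longrightarrow> s (one x) = x"
  and t_one: "x \<in> carrier X0 \<Longrightarrow> t (one x) = x"
  using source_target_one by blast+

lemma
  assumes "g \<in> carrier G"
  shows comp_one_right: "g \<odot> one (s g) = g" and comp_one_left: "one (t g) \<odot> g = g"
    and s_i: "s (i g) = t g" and t_i: "t (i g) = s g"
    and comp_i_left: "i g \<odot> g = one (s g)" and comp_i_right: "g \<odot> i g = one (t g)"
  using bspec[OF unit_inverse_laws assms] by simp_all

text \<open>
  Since the groupoid laws determine inverses, the usual rules for inverses of products and units follow.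
\<close>

lemma inverse_unique:
  assumes gk: "(g, k) \<in> composable X" and "g \<odot> k = one (t g)"
  shows "k = i g"
proof -
  note g = composableD[OF gk]
  have ig: "(i g, g) \<in> composable X" using g by (intro composableI) (auto simp: i_in s_i)
  have "k = (i g \<odot> g) \<odot> k" using g comp_one_left[OF g(2)] by (simp add: comp_i_left)
  also have "\<dots> = i g \<odot> one (t g)" using comp_assoc[OF ig gk] assms(2) by simp
  also have "\<dots> = i g" using comp_one_right[OF i_in[OF g(1)]] s_i[OF g(1)] by simp
  finally show ?thesis .
qed

lemma i_i: "g \<in> carrier G \<Longrightarrow> i (i g) = g"
  using inverse_unique[of "i g" g] composableI[of "i g" g]
  by (simp add: i_in s_i t_i comp_i_left)

lemma i_one: "x \<in> carrier X0 \<Longrightarrow> i (one x) = one x"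
  using inverse_unique[of "one x" "one x"] composableI[of "one x" "one x"] comp_one_left[of "one x"]
  by (simp add: one_in s_one t_one)

lemma i_composable: "(g, h) \<in> composable X \<Longrightarrow> (i h, i g) \<in> composable X"
  by (auto simp: composable_def i_in s_i t_i)

lemma i_comp:
  assumes gh: "(g, h) \<in> composable X"
  shows "i (g \<odot> h) = i h \<odot> i g"
proof (rule inverse_unique[symmetric])
  note g = composableD[OF gh]
  note ihg = i_composable[OF gh]
  have hih: "(h, i h) \<in> composable X" using g by (intro composableI) (auto simp: i_in t_i)
  have h1: "(h, i h \<odot> i g) \<in> composable X"
    using g comp_in[OF ihg] t_comp[OF ihg] by (intro composableI) (auto simp: t_i)
  show "(g \<odot> h, i h \<odot> i g) \<in> composable X"
    using g comp_in[OF gh] comp_in[OF ihg] s_comp[OF gh] t_comp[OF ihg]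
    by (intro composableI) (auto simp: t_i)
  have "(g \<odot> h) \<odot> (i h \<odot> i g) = g \<odot> (h \<odot> (i h \<odot> i g))" by (rule comp_assoc[OF gh h1])
  also have "h \<odot> (i h \<odot> i g) = (h \<odot> i h) \<odot> i g" by (rule comp_assoc[OF hih ihg, symmetric])
  also have "\<dots> = i g"
    using comp_one_left[OF i_in[OF g(1)]] by (simp add: comp_i_right g t_i)
  finally show "(g \<odot> h) \<odot> (i h \<odot> i g) = one (t (g \<odot> h))"
    by (simp add: comp_i_right g t_comp[OF gh])
qed

lemma has_velocity_s: "has_velocity G c g \<beta> \<Longrightarrow> \<forall>\<^sub>F r in nhds 0. c r \<in> carrier G \<Longrightarrow>
    has_velocity X0 (\<lambda>r. s (c r)) (s g) (ds g \<beta>)"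
  and has_velocity_t: "has_velocity G c g \<beta> \<Longrightarrow> \<forall>\<^sub>F r in nhds 0. c r \<in> carrier G \<Longrightarrow>
    has_velocity X0 (\<lambda>r. t (c r)) (t g) (dt g \<beta>)"
  and has_velocity_i: "has_velocity G c g \<beta> \<Longrightarrow> \<forall>\<^sub>F r in nhds 0. c r \<in> carrier G \<Longrightarrow>
    has_velocity G (\<lambda>r. i (c r)) (i g) (di g \<beta>)"
  and has_velocity_one: "has_velocity X0 x y v \<Longrightarrow> \<forall>\<^sub>F r in nhds 0. x r \<in> carrier X0 \<Longrightarrow>
    has_velocity G (\<lambda>r. one (x r)) (one y) (d1 y v)"
  by (fact differential_on_has_velocity[OF charted_G charted_X0 smooth_s]
      differential_on_has_velocity[OF charted_G charted_X0 smooth_t]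
      differential_on_has_velocity[OF charted_G charted_G smooth_i]
      differential_on_has_velocity[OF charted_X0 charted_G smooth_one])+

lemma linear_ds: "g \<in> carrier G \<Longrightarrow> linear (ds g)"
  and linear_dt: "g \<in> carrier G \<Longrightarrow> linear (dt g)"
  and linear_di: "g \<in> carrier G \<Longrightarrow> linear (di g)"
  and linear_d1: "x \<in> carrier X0 \<Longrightarrow> linear (d1 x)"
  by (auto intro: linear_differential_on charted_G charted_X0 smooth_s smooth_t smooth_i smooth_one)

lemma ds_di: assumes g: "g \<in> carrier G" shows "ds (i g) (di g \<beta>) = dt g \<beta>"
  and dt_di: "dt (i g) (di g \<beta>) = ds g \<beta>"
proof -
  obtain c where c: "has_velocity G c g \<beta>" "\<forall>\<^sub>F r in nhds 0. c r \<in> carrier G"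
    using has_velocity_exists[OF charted_G g] .
  have ic: "\<forall>\<^sub>F r in nhds 0. i (c r) \<in> carrier G" using c(2) by eventually_elim (rule i_in)
  note vi = has_velocity_i[OF c]
  show "ds (i g) (di g \<beta>) = dt g \<beta>"
    by (rule has_velocity_eventually_unique[OF charted_X0 _ has_velocity_t[OF c]])
      (use has_velocity_s[OF vi ic] c(2) g in \<open>auto simp: s_i elim: eventually_mono\<close>)
  show "dt (i g) (di g \<beta>) = ds g \<beta>"
    by (rule has_velocity_eventually_unique[OF charted_X0 _ has_velocity_s[OF c]])
      (use has_velocity_t[OF vi ic] c(2) g in \<open>auto simp: t_i elim: eventually_mono\<close>)
qed

lemma
  assumes x: "x \<in> carrier X0"
  shows ds_d1: "ds (one x) (d1 x v) = v" and dt_d1: "dt (one x) (d1 x v) = v"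
    and di_d1: "di (one x) (d1 x v) = d1 x v"
proof -
  obtain c where c: "has_velocity X0 c x v" "\<forall>\<^sub>F r in nhds 0. c r \<in> carrier X0"
    using has_velocity_exists[OF charted_X0 x] .
  have ic: "\<forall>\<^sub>F r in nhds 0. one (c r) \<in> carrier G" using c(2) by eventually_elim (rule one_in)
  note vi = has_velocity_one[OF c]
  show "ds (one x) (d1 x v) = v"
    by (rule has_velocity_eventually_unique[OF charted_X0 _ c(1)])
      (use has_velocity_s[OF vi ic] c(2) x in \<open>auto simp: s_one elim: eventually_mono\<close>)
  show "dt (one x) (d1 x v) = v"
    by (rule has_velocity_eventually_unique[OF charted_X0 _ c(1)])
      (use has_velocity_t[OF vi ic] c(2) x in \<open>auto simp: t_one elim: eventually_mono\<close>)
  show "di (one x) (d1 x v) = d1 x v"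
    by (rule has_velocity_eventually_unique[OF charted_G _ vi])
      (use has_velocity_i[OF vi ic] c(2) x in \<open>auto simp: i_one elim: eventually_mono\<close>)
qed

end

locale lie_groupoid_action = lie_groupoid_setting X
  for X :: "('g, 'e::model_space, 'x, 'd::model_space) groupoid" +
  fixes P :: "('p, 'k::model_space) manifold" and a :: "'p \<Rightarrow> 'x" and act :: "'p \<Rightarrow> 'g \<Rightarrow> 'p"
  assumes action: "right_action X P a act"
begin

abbreviation "da \<equiv> differential P X0 a"
abbreviation "D \<equiv> act_domain X P a"
abbreviation "dact_at \<equiv> dact X P a act"

lemma charted_P: "charted_space P"
  and smooth_a: "smooth_map P X0 a"
  and smooth_act: "smooth_map_on (P \<times>\<^sub>M\<^sub>f G) P D (\<lambda>(p, g). act p g)"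
  using action unfolding right_action_def
  by - (elim conjE, (assumption | erule smooth_manifold_imp_charted_space))+

lemma action_laws:
  "\<forall>(p, g)\<in>D. a (act p g) = s g"
  "\<forall>p g h. (p, g) \<in> D \<and> (g, h) \<in> composable X \<longrightarrow> act (act p g) h = act p (g \<odot> h)"
  "\<forall>p\<in>carrier P. act p (one (a p)) = p"
  using action unfolding right_action_def by - (elim conjE, assumption)+

lemma a_act: "(p, g) \<in> D \<Longrightarrow> a (act p g) = s g"
  and act_act: "(p, g) \<in> D \<Longrightarrow> (g, h) \<in> composable X \<Longrightarrow> act (act p g) h = act p (g \<odot> h)"
  and act_one: "p \<in> carrier P \<Longrightarrow> act p (one (a p)) = p"
  using action_laws by blast+

lemma domainI: "p \<in> carrier P \<Longrightarrow> g \<in> carrier G \<Longrightarrow> a p = t g \<Longrightarrow> (p, g) \<in> D"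
  by (simp add: act_domain_def)

lemma domainD:
  assumes "(p, g) \<in> D"
  shows "p \<in> carrier P" "g \<in> carrier G" "a p = t g"
  using assms by (simp_all add: act_domain_def)

lemma act_in: "(p, g) \<in> D \<Longrightarrow> act p g \<in> carrier P"
  using smooth_map_on_image[OF smooth_act, of "(p, g)"] by simp

lemma a_in: "p \<in> carrier P \<Longrightarrow> a p \<in> carrier X0"
  using smooth_map_on_image[OF smooth_a] by blast

lemma domain_act: "(p, g) \<in> D \<Longrightarrow> (g, h) \<in> composable X \<Longrightarrow> (act p g, h) \<in> D"
  using a_act act_in by (auto simp: act_domain_def composable_def)

lemma domain_comp: "(p, g) \<in> D \<Longrightarrow> (g, h) \<in> composable X \<Longrightarrow> (p, g \<odot> h) \<in> D"
  using comp_in t_comp by (auto simp: act_domain_def)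

lemma linear_da: "p \<in> carrier P \<Longrightarrow> linear (da p)"
  by (rule linear_differential_on[OF charted_P charted_X0 smooth_a])

lemma has_velocity_a: "has_velocity P c p u \<Longrightarrow> \<forall>\<^sub>F r in nhds 0. c r \<in> carrier P \<Longrightarrow>
    has_velocity X0 (\<lambda>r. a (c r)) (a p) (da p u)"
  by (rule differential_on_has_velocity[OF charted_P charted_X0 smooth_a])

lemma has_velocity_act:
  assumes "has_velocity P c p u" "has_velocity G d g \<beta>" "\<forall>\<^sub>F r in nhds 0. (c r, d r) \<in> D"
  shows "has_velocity P (\<lambda>r. act (c r) (d r)) (act p g) (dact_at p g u \<beta>)"
  using differential_on_has_velocity[OF charted_space_prod[OF charted_P charted_G] charted_P smooth_act
      has_velocity_Pair[OF charted_P charted_G assms(1,2)] assms(3)]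
  unfolding dact_def by simp

lemma linear_dact: "(p, g) \<in> D \<Longrightarrow> linear (\<lambda>(u, \<beta>). dact_at p g u \<beta>)"
  using linear_differential_on[OF charted_space_prod[OF charted_P charted_G] charted_P smooth_act, of "(p, g)"]
  by (simp add: dact_def case_prod_unfold)

lemma dact_add: "(p, g) \<in> D \<Longrightarrow> dact_at p g (u + u') (\<beta> + \<beta>') = dact_at p g u \<beta> + dact_at p g u' \<beta>'"
  using linear_add[OF linear_dact, of p g "(u, \<beta>)" "(u', \<beta>')"] by simp

lemma dact_diff: "(p, g) \<in> D \<Longrightarrow> dact_at p g (u - u') (\<beta> - \<beta>') = dact_at p g u \<beta> - dact_at p g u' \<beta>'"
  using linear_diff[OF linear_dact, of p g "(u, \<beta>)" "(u', \<beta>')"] by simp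

lemma dact_scaleR: "(p, g) \<in> D \<Longrightarrow> dact_at p g (r *\<^sub>R u) (r *\<^sub>R \<beta>) = r *\<^sub>R dact_at p g u \<beta>"
  using linear_cmul[OF linear_dact, of p g r "(u, \<beta>)"] by simp

text \<open>
  A pair of vectors with \<open>da u = dt \<beta>\<close> is tangent to the fibre product on which the action is defined: any
  curve with velocity \<open>u\<close> is continued by lifting its anchor through the target map.
\<close>

lemma action_curves:
  assumes pg: "(p, g) \<in> D" and tan: "da p u = dt g \<beta>"
  obtains c d where "has_velocity P c p u" "has_velocity G d g \<beta>" "\<forall>\<^sub>F r in nhds 0. (c r, d r) \<in> D"
proof -
  note pg' = domainD[OF pg]
  obtain c where c: "has_velocity P c p u" "\<forall>\<^sub>F r in nhds 0. c r \<in> carrier P"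
    using has_velocity_exists[OF charted_P pg'(1)] .
  have "has_velocity X0 (\<lambda>r. a (c r)) (t g) (dt g \<beta>)"
    using has_velocity_a[OF c] pg'(3) tan by simp
  then obtain d where d: "has_velocity G d g \<beta>" "\<forall>\<^sub>F r in nhds 0. d r \<in> carrier G \<and> t (d r) = a (c r)"
    by (rule submersion_lift[OF charted_G charted_X0 submersion_t pg'(2)])
  have "\<forall>\<^sub>F r in nhds 0. (c r, d r) \<in> D"
    using c(2) d(2) by eventually_elim (simp add: domainI)
  then show ?thesis by (rule that[OF c(1) d(1)])
qed

lemma tangent_to_domain:
  assumes "(p, g) \<in> D" "da p u = dt g \<beta>"
  shows "tangent_to (P \<times>\<^sub>M\<^sub>f G) D (p, g) (u, \<beta>)"
proof -
  obtain c d where c: "has_velocity P c p u" "has_velocity G d g \<beta>" "\<forall>\<^sub>F r in nhds 0. (c r, d r) \<in> D"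
    using action_curves[OF assms] .
  then show ?thesis
    unfolding tangent_to_def using has_velocity_Pair[OF charted_P charted_G c(1,2)] by blast
qed

lemma da_dact:
  assumes pg: "(p, g) \<in> D" and tan: "da p u = dt g \<beta>"
  shows "da (act p g) (dact_at p g u \<beta>) = ds g \<beta>"
proof -
  obtain c d where c: "has_velocity P c p u" and d: "has_velocity G d g \<beta>"
    and D: "\<forall>\<^sub>F r in nhds 0. (c r, d r) \<in> D" using action_curves[OF assms] .
  have 1: "\<forall>\<^sub>F r in nhds 0. act (c r) (d r) \<in> carrier P" using D by eventually_elim (rule act_in)
  have 2: "\<forall>\<^sub>F r in nhds 0. d r \<in> carrier G" using D by eventually_elim (rule domainD)
  have 3: "\<forall>\<^sub>F r in nhds 0. a (act (c r) (d r)) = s (d r)" using D by eventually_elim (rule a_act)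
  show ?thesis
    using has_velocity_eventually_unique[OF charted_X0 has_velocity_a[OF has_velocity_act[OF c d D] 1] _ 3]
      has_velocity_s[OF d 2] a_act[OF pg] by simp
qed

lemma dact_one:
  assumes p: "p \<in> carrier P"
  shows "dact_at p (one (a p)) u (d1 (a p) (da p u)) = u"
proof -
  obtain c where c: "has_velocity P c p u" "\<forall>\<^sub>F r in nhds 0. c r \<in> carrier P"
    using has_velocity_exists[OF charted_P p] .
  have "\<forall>\<^sub>F r in nhds 0. a (c r) \<in> carrier X0" using c(2) by eventually_elim (rule a_in)
  note d = has_velocity_one[OF has_velocity_a[OF c] this]
  have D: "\<forall>\<^sub>F r in nhds 0. (c r, one (a (c r))) \<in> D"
    using c(2) by eventually_elim (simp add: domainI one_in t_one a_in)
  have "\<forall>\<^sub>F r in nhds 0. act (c r) (one (a (c r))) = c r" using c(2) by eventually_elim (rule act_one)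
  from has_velocity_eventually_unique[OF charted_P has_velocity_act[OF c(1) d D] _ this] c(1)
  show ?thesis by (simp add: act_one[OF p])
qed

lemma field_at_dact:
  assumes u: "field_at P S z p u" and \<beta>: "field_at G S z g \<beta>"
    and dom: "\<And>y. y \<in> S \<Longrightarrow> (p y, g y) \<in> D" and tan: "\<And>y. y \<in> S \<Longrightarrow> da (p y) (u y) = dt (g y) (\<beta> y)"
  shows "field_at P S z (\<lambda>y. act (p y) (g y)) (\<lambda>y. dact_at (p y) (g y) (u y) (\<beta> y))"
  using field_at_differential[OF charted_space_prod[OF charted_P charted_G] charted_P smooth_act
      field_at_Pair[OF charted_P charted_G u \<beta>]] dom tan tangent_to_domain
  by (simp add: dact_def)

end

context lie_groupoid_setting
begin

text \<open>
  A groupoid acts on its own arrows by composition, with the source map as anchor.  The rules for \<open>\<beta>.\<alpha>\<close> that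
  only involve the right factor are therefore instances of those for \<open>u.\<beta>\<close>.
\<close>

lemma self_action: "lie_groupoid_action X G s (gcomp X)"
proof -
  have "act_domain X G s = composable X" by (auto simp: act_domain_def composable_def)
  then show ?thesis
    using lie smooth_s by unfold_locales (auto simp: right_action_def lie_groupoid_def)
qed

interpretation self: lie_groupoid_action X G s "gcomp X" by (rule self_action)

lemma self_domain [simp]: "act_domain X G s = composable X"
  by (auto simp: act_domain_def composable_def)

lemma self_dact [simp]: "dact X G s (gcomp X) = dcomp X"
  by (intro ext) (simp add: dact_def dcomp_def)

lemmas has_velocity_comp = self.has_velocity_act[simplified]
  and dcomp_add = self.dact_add[simplified]
  and dcomp_diff = self.dact_diff[simplified]
  and dcomp_scaleR = self.dact_scaleR[simplified]
  and comp_curves = self.action_curves[simplified]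
  and ds_dcomp = self.da_dact[simplified]
  and dcomp_one = self.dact_one[simplified]
  and field_at_dcomp = self.field_at_dact[simplified]

lemma dt_dcomp:
  assumes gh: "(g, h) \<in> composable X" and tan: "ds g \<beta> = dt h \<alpha>"
  shows "dt (g \<odot> h) (dcomp X g h \<beta> \<alpha>) = dt g \<beta>"
proof -
  obtain c d where c: "has_velocity G c g \<beta>" and d: "has_velocity G d h \<alpha>"
    and D: "\<forall>\<^sub>F r in nhds 0. (c r, d r) \<in> composable X" using comp_curves[OF assms] .
  have 1: "\<forall>\<^sub>F r in nhds 0. c r \<odot> d r \<in> carrier G" using D by eventually_elim (rule comp_in)
  have 2: "\<forall>\<^sub>F r in nhds 0. c r \<in> carrier G" using D by eventually_elim (rule composableD)
  have 3: "\<forall>\<^sub>F r in nhds 0. t (c r \<odot> d r) = t (c r)" using D by eventually_elim (rule t_comp)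
  show ?thesis
    using has_velocity_eventually_unique[OF charted_X0 has_velocity_t[OF has_velocity_comp[OF c d D] 1] _ 3]
      has_velocity_t[OF c 2] t_comp[OF gh] by simp
qed

lemma di_dcomp:
  assumes gh: "(g, h) \<in> composable X" and tan: "ds g \<beta> = dt h \<alpha>"
  shows "di (g \<odot> h) (dcomp X g h \<beta> \<alpha>) = dcomp X (i h) (i g) (di h \<alpha>) (di g \<beta>)"
proof -
  obtain c d where c: "has_velocity G c g \<beta>" and d: "has_velocity G d h \<alpha>"
    and D: "\<forall>\<^sub>F r in nhds 0. (c r, d r) \<in> composable X" using comp_curves[OF assms] .
  have 1: "\<forall>\<^sub>F r in nhds 0. c r \<odot> d r \<in> carrier G" using D by eventually_elim (rule comp_in)
  have 2: "\<forall>\<^sub>F r in nhds 0. c r \<in> carrier G" "\<forall>\<^sub>F r in nhds 0. d r \<in> carrier G"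
    using D by (eventually_elim, blast dest: composableD)+
  have D': "\<forall>\<^sub>F r in nhds 0. (i (d r), i (c r)) \<in> composable X" using D by eventually_elim (rule i_composable)
  have 3: "\<forall>\<^sub>F r in nhds 0. i (c r \<odot> d r) = i (d r) \<odot> i (c r)" using D by eventually_elim (rule i_comp)
  show ?thesis
    using has_velocity_eventually_unique[OF charted_G has_velocity_i[OF has_velocity_comp[OF c d D] 1] _ 3]
      has_velocity_comp[OF has_velocity_i[OF d 2(2)] has_velocity_i[OF c 2(1)] D'] i_comp[OF gh] by simp
qed

end

context lie_groupoid_action
begin

text \<open>
  Here three curves are needed, each of the last two being a lift of the source or anchor of the one before.
\<close>

lemma dact_dcomp:
  assumes pg: "(p, g) \<in> D" and gh: "(g, h) \<in> composable X"
    and tan: "da p u = dt g \<beta>" "ds g \<beta> = dt h \<alpha>"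
  shows "dact_at (act p g) h (dact_at p g u \<beta>) \<alpha> = dact_at p (g \<odot> h) u (dcomp X g h \<beta> \<alpha>)"
proof -
  obtain c d where c: "has_velocity P c p u" and d: "has_velocity G d g \<beta>"
    and D: "\<forall>\<^sub>F r in nhds 0. (c r, d r) \<in> D" using action_curves[OF pg tan(1)] .
  have d_in: "\<forall>\<^sub>F r in nhds 0. d r \<in> carrier G" using D by eventually_elim (rule domainD)
  have "has_velocity X0 (\<lambda>r. s (d r)) (t h) (dt h \<alpha>)"
    using has_velocity_s[OF d d_in] tan(2) composableD(3)[OF gh] by simp
  then obtain e where e: "has_velocity G e h \<alpha>" "\<forall>\<^sub>F r in nhds 0. e r \<in> carrier G \<and> t (e r) = s (d r)"
    by (rule submersion_lift[OF charted_G charted_X0 submersion_t composableD(2)[OF gh]])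
  have C: "\<forall>\<^sub>F r in nhds 0. (d r, e r) \<in> composable X"
    using d_in e(2) by eventually_elim (simp add: composableI)
  have D1: "\<forall>\<^sub>F r in nhds 0. (act (c r) (d r), e r) \<in> D"
    using D C by eventually_elim (rule domain_act)
  have D2: "\<forall>\<^sub>F r in nhds 0. (c r, d r \<odot> e r) \<in> D"
    using D C by eventually_elim (rule domain_comp)
  have eq: "\<forall>\<^sub>F r in nhds 0. act (act (c r) (d r)) (e r) = act (c r) (d r \<odot> e r)"
    using D C by eventually_elim (rule act_act)
  show ?thesis
    using has_velocity_eventually_unique[OF charted_P
        has_velocity_act[OF has_velocity_act[OF c d D] e(1) D1] _ eq]
      has_velocity_act[OF c has_velocity_comp[OF d e(1) C] D2] act_act[OF pg gh] by simp
qed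

end

context lie_groupoid_setting
begin

interpretation self: lie_groupoid_action X G s "gcomp X" by (rule self_action)

lemmas dcomp_assoc = self.dact_dcomp[simplified]

end


section \<open>Translations and the basic curvature\<close>

context lie_groupoid_setting
begin

lemma plot_at_comp:
  assumes "plot_at G S z g" "plot_at G S z h" "\<And>y. y \<in> S \<Longrightarrow> (g y, h y) \<in> composable X"
  shows "plot_at G S z (\<lambda>y. g y \<odot> h y)"
  using plot_at_smooth_map[OF charted_space_prod[OF charted_G charted_G] charted_G smooth_comp
      plot_at_Pair[OF assms(1,2)]] assms(3) by simp

lemma plot_at_i: "plot_at G S z g \<Longrightarrow> (\<And>y. y \<in> S \<Longrightarrow> g y \<in> carrier G) \<Longrightarrow> plot_at G S z (\<lambda>y. i (g y))"
  by (rule plot_at_smooth_map[OF charted_G charted_G smooth_i])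

lemma source_fibre_curve:
  assumes g: "g \<in> carrier G" and \<alpha>: "ds g \<alpha> = 0"
  obtains c where "has_velocity G c g \<alpha>" "\<forall>\<^sub>F r in nhds 0. c r \<in> carrier G \<and> s (c r) = s g"
proof -
  have "has_velocity X0 (\<lambda>_. s g) (s g) (ds g \<alpha>)"
    using has_velocity_const[OF charted_X0 s_in[OF g]] \<alpha> by simp
  then show ?thesis by (rule submersion_lift[OF charted_G charted_X0 submersion_s g]) (rule that)
qed

lemma dcomp_zero: "(g, h) \<in> composable X \<Longrightarrow> dcomp X g h 0 0 = 0"
  using dcomp_diff[of g h 0 0 0 0] by simp

text \<open>
  Right translation of a vertical vector is composition with a zero vector, \<open>r\<^sub>g \<alpha> = \<alpha>.0\<^sub>g\<close>, because the
  constant curve at \<open>g\<close> can be used as the second factor.  This brings translations under the rules for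
  composition of tangent vectors.
\<close>

lemma right_translation_eq:
  assumes g: "g \<in> carrier G" and \<alpha>: "\<alpha> \<in> algebroid X (t g)"
  shows "right_translation X g \<alpha> = dcomp X (one (t g)) g \<alpha> 0"
proof -
  let ?R = "{h \<in> carrier G. s h = t g}"
  have o: "one (t g) \<in> carrier G" "s (one (t g)) = t g" using g by (simp_all add: one_in t_in s_one)
  have sm: "smooth_map_on G G ?R (\<lambda>h. h \<odot> g)"
  proof (rule smooth_map_onI_plots)
    show "(\<lambda>h. h \<odot> g) ` ?R \<subseteq> carrier G" using g by (auto intro!: comp_in composableI)
    show "plot_at G T z (\<lambda>y. q y \<odot> g)" if "plot_at G T z q" "\<And>y. y \<in> T \<Longrightarrow> q y \<in> ?R"
      for T and z :: 'e and q
      using that g by (intro plot_at_comp plot_at_const[OF charted_G] plot_at_in[OF that(1)])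
        (auto intro: composableI)
  qed (auto intro: charted_space_imp_chart_cover[OF charted_G])
  have "ds (one (t g)) \<alpha> = 0" using \<alpha> by (simp add: algebroid_def)
  then obtain c where c: "has_velocity G c (one (t g)) \<alpha>" "\<forall>\<^sub>F r in nhds 0. c r \<in> carrier G \<and> s (c r) = t g"
    by (rule source_fibre_curve[OF o(1), unfolded o(2)])
  have R: "\<forall>\<^sub>F r in nhds 0. c r \<in> ?R" using c(2) by simp
  have C: "\<forall>\<^sub>F r in nhds 0. (c r, g) \<in> composable X" using c(2) by eventually_elim (simp add: composableI g)
  show ?thesis
    unfolding right_translation_def
    by (rule has_velocity_unique[OF charted_G differential_on_has_velocity[OF charted_G charted_G sm c(1) R]
          has_velocity_comp[OF c(1) has_velocity_const[OF charted_G g] C]])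
qed

text \<open>
  Likewise \<open>l\<^sub>g \<alpha> = 0\<^sub>g.di \<alpha>\<close>.
\<close>

lemma left_translation_eq:
  assumes g: "g \<in> carrier G" and \<alpha>: "\<alpha> \<in> algebroid X (s g)"
  shows "left_translation X g \<alpha> = dcomp X g (one (s g)) 0 (di (one (s g)) \<alpha>)"
proof -
  let ?R = "{h \<in> carrier G. s h = s g}"
  have o: "one (s g) \<in> carrier G" "s (one (s g)) = s g" using g by (simp_all add: one_in s_in s_one)
  have io: "i (one (s g)) = one (s g)" by (simp add: i_one s_in g)
  have sm: "smooth_map_on G G ?R (\<lambda>h. g \<odot> i h)"
  proof (rule smooth_map_onI_plots)
    show "(\<lambda>h. g \<odot> i h) ` ?R \<subseteq> carrier G" using g by (auto intro!: comp_in composableI simp: i_in t_i)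
    show "plot_at G T z (\<lambda>y. g \<odot> i (q y))" if "plot_at G T z q" "\<And>y. y \<in> T \<Longrightarrow> q y \<in> ?R"
      for T and z :: 'e and q
      using that g by (intro plot_at_comp plot_at_i plot_at_const[OF charted_G] plot_at_in[OF that(1)])
        (auto intro: composableI simp: i_in t_i)
  qed (auto intro: charted_space_imp_chart_cover[OF charted_G])
  have "ds (one (s g)) \<alpha> = 0" using \<alpha> by (simp add: algebroid_def)
  then obtain c where c: "has_velocity G c (one (s g)) \<alpha>" "\<forall>\<^sub>F r in nhds 0. c r \<in> carrier G \<and> s (c r) = s g"
    by (rule source_fibre_curve[OF o(1), unfolded o(2)])
  have R: "\<forall>\<^sub>F r in nhds 0. c r \<in> ?R" using c(2) by simp
  have c_in: "\<forall>\<^sub>F r in nhds 0. c r \<in> carrier G" using c(2) by eventually_elim simp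
  have C: "\<forall>\<^sub>F r in nhds 0. (g, i (c r)) \<in> composable X"
    using c(2) by eventually_elim (simp add: composableI g i_in t_i)
  show ?thesis
    unfolding left_translation_def
    using has_velocity_unique[OF charted_G differential_on_has_velocity[OF charted_G charted_G sm c(1) R]
          has_velocity_comp[OF has_velocity_const[OF charted_G g] has_velocity_i[OF c(1) c_in] C]]
    by (simp add: io)
qed

end

locale lie_groupoid_connection = lie_groupoid_setting X
  for X :: "('g, 'e::model_space, 'x, 'd::model_space) groupoid" +
  fixes H :: "'g \<Rightarrow> 'e set"
  assumes connection: "ehresmann_connection X H"
begin

abbreviation "\<sigma> \<equiv> horizontal_lift X H"
abbreviation "lam \<equiv> lambda1 X H"

lemma
  shows connection_subbundle: "subbundle G (tangent_bundle G) H"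
    and connection_complement: "g \<in> carrier G \<Longrightarrow> (let V = {w. ds g w = 0}
        in H g \<inter> V = {0} \<and> (\<forall>w. \<exists>y\<in>H g. \<exists>z\<in>V. w = y + z))"
    and connection_one: "x \<in> carrier X0 \<Longrightarrow> H (one x) = range (d1 x)"
  using connection unfolding ehresmann_connection_def by simp_all

lemmas connection_facts = charted_G charted_X0 submersion_s connection_subbundle connection_complement

lemma ds_\<sigma>: "g \<in> carrier G \<Longrightarrow> ds g (\<sigma> g v) = v"
  unfolding horizontal_lift_def by (rule subm_deriv_hlift[OF connection_facts])

lemma linear_\<sigma>: "g \<in> carrier G \<Longrightarrow> linear (\<sigma> g)"
  unfolding horizontal_lift_def by (rule linear_hlift[OF connection_facts])

lemma \<sigma>_one: "x \<in> carrier X0 \<Longrightarrow> \<sigma> (one x) v = d1 x v"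
  unfolding horizontal_lift_def
  by (rule hlift_unique[OF connection_facts]) (simp_all add: one_in connection_one ds_d1)

lemma field_at_\<sigma>:
  "\<lbrakk>plot_at G S z g; \<And>y. y \<in> S \<Longrightarrow> g y \<in> carrier G; field_at X0 S z (\<lambda>y. s (g y)) v\<rbrakk> \<Longrightarrow>
    field_at G S z g (\<lambda>y. \<sigma> (g y) (v y))"
  unfolding horizontal_lift_def by (rule field_at_hlift[OF connection_facts])

lemma lambda1_eq: "lam g v = dt g (\<sigma> g v)"
  by (simp add: lambda1_def)

lemma linear_lambda1: "g \<in> carrier G \<Longrightarrow> linear (lam g)"
  unfolding lambda1_def using linear_compose[OF linear_\<sigma> linear_dt] by (simp add: o_def)

lemma lambda1_one: "x \<in> carrier X0 \<Longrightarrow> lam (one x) v = v"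
  by (simp add: lambda1_eq \<sigma>_one dt_d1)

text \<open>
  The inverse of \<open>r\<^sub>k\<close> is composition with the zero vector at \<open>k\<inverse>\<close>: for a vector \<open>w\<close> that \<open>ds\<close>
  annihilates, \<open>(w.0).0 = w.(0.0) = w.d1(0) = w\<close>, and in the same way from the other side.
\<close>

lemma vertical_part:
  assumes k: "k \<in> carrier G"
  shows "vertical_part X H k w \<in> algebroid X (t k)"
    and "dcomp X (one (t k)) k (vertical_part X H k w) 0 = w - \<sigma> k (ds k w)"
proof -
  let ?w = "w - \<sigma> k (ds k w)"
  have t: "t k \<in> carrier X0" and s: "s k \<in> carrier X0" and ik: "i k \<in> carrier G"
    and o: "one (t k) \<in> carrier G" "one (s k) \<in> carrier G"
    using k by (simp_all add: t_in s_in i_in one_in)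
  have c: "(k, i k) \<in> composable X" "(i k, k) \<in> composable X" "(one (t k), k) \<in> composable X"
    using k o ik by (auto intro!: composableI simp: t_i s_i s_one t)
  have ds0: "ds g 0 = 0" and dt0: "dt g 0 = 0" if "g \<in> carrier G" for g
    using linear_0[OF linear_ds[OF that]] linear_0[OF linear_dt[OF that]] by auto
  have dsw: "ds k ?w = 0" by (simp add: linear_diff[OF linear_ds[OF k]] ds_\<sigma>[OF k])
  have unit_right: "dcomp X g (one (s g)) \<beta> 0 = \<beta>" if "g \<in> carrier G" "ds g \<beta> = 0" for g \<beta>
    using dcomp_one[OF that(1), of \<beta>] that linear_0[OF linear_d1[OF s_in[OF that(1)]]] by simp
  have "\<exists>!\<alpha>. \<alpha> \<in> algebroid X (t k) \<and> right_translation X k \<alpha> + \<sigma> k (ds k w) = w"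
  proof (rule ex1I)
    let ?\<alpha> = "dcomp X k (i k) ?w 0"
    have "ds (k \<odot> i k) ?\<alpha> = ds (i k) 0"
      by (rule ds_dcomp[OF c(1)]) (simp add: dsw dt0 ik)
    then have A: "?\<alpha> \<in> algebroid X (t k)"
      by (simp add: algebroid_def comp_i_right[OF k] ds0 ik)
    have "dcomp X (k \<odot> i k) k ?\<alpha> 0 = dcomp X k (i k \<odot> k) ?w (dcomp X (i k) k 0 0)"
      by (rule dcomp_assoc[OF c(1,2)]) (simp_all add: dsw ds0 dt0 ik k)
    then have "right_translation X k ?\<alpha> = ?w"
      unfolding right_translation_eq[OF k A]
      by (simp add: comp_i_right[OF k] comp_i_left[OF k] dcomp_zero[OF c(2)] unit_right[OF k dsw])
    with A show "?\<alpha> \<in> algebroid X (t k) \<and> right_translation X k ?\<alpha> + \<sigma> k (ds k w) = w" by simp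
    fix \<alpha> assume \<alpha>: "\<alpha> \<in> algebroid X (t k) \<and> right_translation X k \<alpha> + \<sigma> k (ds k w) = w"
    then have d\<alpha>: "ds (one (t k)) \<alpha> = 0" by (simp add: algebroid_def)
    have "dcomp X (one (t k)) k \<alpha> 0 = ?w"
      using \<alpha> right_translation_eq[OF k, of \<alpha>] by (simp add: eq_diff_eq)
    moreover have "dcomp X (one (t k) \<odot> k) (i k) (dcomp X (one (t k)) k \<alpha> 0) 0 =
        dcomp X (one (t k)) (k \<odot> i k) \<alpha> (dcomp X k (i k) 0 0)"
      by (rule dcomp_assoc[OF c(3,1)]) (simp_all add: d\<alpha> ds0 dt0 ik k)
    ultimately show "\<alpha> = ?\<alpha>"
      using unit_right[OF o(1) d\<alpha>]
      by (simp add: comp_one_left[OF k] comp_i_right[OF k] dcomp_zero[OF c(1)] s_one t)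
  qed
  from theI'[OF this] have v: "vertical_part X H k w \<in> algebroid X (t k)"
    "right_translation X k (vertical_part X H k w) + \<sigma> k (ds k w) = w"
    unfolding vertical_part_def by auto
  show "vertical_part X H k w \<in> algebroid X (t k)" by (rule v(1))
  show "dcomp X (one (t k)) k (vertical_part X H k w) 0 = w - \<sigma> k (ds k w)"
    using v(2) right_translation_eq[OF k v(1)] by (simp add: eq_diff_eq)
qed

text \<open>
  The image of the horizontal lift under inversion; it lifts \<open>v\<close> through the target map.
\<close>

definition target_lift :: "'g \<Rightarrow> 'd \<Rightarrow> 'e" where
  "target_lift g v = di (i g) (\<sigma> (i g) v)"

lemma dt_target_lift: "g \<in> carrier G \<Longrightarrow> dt g (target_lift g v) = v"
  using dt_di[OF i_in, of g] by (simp add: target_lift_def i_i ds_\<sigma> i_in)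

lemma ds_target_lift: "g \<in> carrier G \<Longrightarrow> ds g (target_lift g v) = lam (i g) v"
  using ds_di[OF i_in, of g] by (simp add: target_lift_def i_i lambda1_eq)

lemma linear_target_lift: "g \<in> carrier G \<Longrightarrow> linear (target_lift g)"
  using linear_compose[OF linear_\<sigma> linear_di, of "i g" "i g"]
  by (simp add: o_def i_in target_lift_def[abs_def])

lemma target_lift_one: "x \<in> carrier X0 \<Longrightarrow> target_lift (one x) v = d1 x v"
  by (simp add: target_lift_def i_one \<sigma>_one di_d1)

lemma field_at_target_lift:
  assumes g: "plot_at G S z g" "\<And>y. y \<in> S \<Longrightarrow> g y \<in> carrier G"
    and v: "field_at X0 S z (\<lambda>y. t (g y)) v"
  shows "field_at G S z g (\<lambda>y. target_lift (g y) (v y))"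
proof -
  have ig: "plot_at G S z (\<lambda>y. i (g y))" by (rule plot_at_i[OF g])
  have "field_at X0 S z (\<lambda>y. s (i (g y))) v"
    by (rule field_at_cong[OF charted_X0 v]) (simp_all add: s_i g(2))
  then have "field_at G S z (\<lambda>y. i (g y)) (\<lambda>y. \<sigma> (i (g y)) (v y))"
    by (intro field_at_\<sigma>[OF ig]) (simp_all add: i_in g(2))
  then have "field_at G S z (\<lambda>y. i (i (g y))) (\<lambda>y. di (i (g y)) (\<sigma> (i (g y)) (v y)))"
    by (rule field_at_differential[OF charted_G charted_G smooth_i])
      (simp add: i_in g(2) tangent_to_carrier[OF charted_G])
  then show ?thesis
    by (rule field_at_cong[OF charted_G]) (simp_all add: i_i g(2) target_lift_def)
qed

lemma field_at_lambda1:
  assumes g: "plot_at G S z g" "\<And>y. y \<in> S \<Longrightarrow> g y \<in> carrier G"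
    and v: "field_at X0 S z (\<lambda>y. s (g y)) v"
  shows "field_at X0 S z (\<lambda>y. t (g y)) (\<lambda>y. lam (g y) (v y))"
  unfolding lambda1_eq
  by (rule field_at_differential[OF charted_G charted_X0 smooth_t field_at_\<sigma>[OF g v]])
    (blast intro: g(2) tangent_to_carrier[OF charted_G g(2)])+

text \<open>
  The second factor of the product lifts the source component of the first one, which makes the two
  vectors composable.
\<close>

definition lift_defect :: "'g \<Rightarrow> 'g \<Rightarrow> 'd \<Rightarrow> 'e" where
  "lift_defect g h v =
     target_lift (g \<odot> h) v - dcomp X g h (target_lift g v) (target_lift h (lam (i g) v))"

lemma target_lift_composable:
  assumes "(g, h) \<in> composable X"
  shows "ds g (target_lift g v) = dt h (target_lift h (lam (i g) v))"
  using composableD[OF assms] by (simp add: ds_target_lift dt_target_lift)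

lemma
  assumes gh: "(g, h) \<in> composable X"
  shows dt_lift_defect: "dt (g \<odot> h) (lift_defect g h v) = 0"
    and ds_lift_defect: "ds (g \<odot> h) (lift_defect g h v) = lam (i (g \<odot> h)) v - lam (i h) (lam (i g) v)"
  using composableD[OF gh] comp_in[OF gh]
  by (simp_all add: lift_defect_def linear_diff[OF linear_dt] linear_diff[OF linear_ds]
      dt_target_lift ds_target_lift dt_dcomp[OF gh target_lift_composable[OF gh]]
      ds_dcomp[OF gh target_lift_composable[OF gh]])

lemma linear_lift_defect:
  assumes gh: "(g, h) \<in> composable X"
  shows "linear (lift_defect g h)"
proof -
  note g = composableD[OF gh]
  note lin = linear_target_lift[OF g(1)] linear_target_lift[OF g(2)] linear_target_lift[OF comp_in[OF gh]]
    linear_lambda1[OF i_in[OF g(1)]]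
  have add: "dcomp X g h (\<beta> + \<beta>') (\<alpha> + \<alpha>') = dcomp X g h \<beta> \<alpha> + dcomp X g h \<beta>' \<alpha>'" for \<beta> \<beta>' \<alpha> \<alpha>'
    by (rule dcomp_add[OF gh])
  have scale: "dcomp X g h (r *\<^sub>R \<beta>) (r *\<^sub>R \<alpha>) = r *\<^sub>R dcomp X g h \<beta> \<alpha>" for r \<beta> \<alpha>
    by (rule dcomp_scaleR[OF gh])
  show ?thesis
    by (rule linearI)
      (simp_all add: lift_defect_def lin[THEN linear_add] lin[THEN linear_cmul] add scale scaleR_diff_right)
qed

text \<open>
  With \<open>k = h\<inverse>g\<inverse>\<close> and \<open>w = \<sigma>(\<lambda>v).\<sigma>(v)\<close> at \<open>k\<close>, the decomposition of \<open>w\<close> reads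
  \<open>- r\<^sub>k K = w - \<sigma>\<^sub>k(v)\<close>.  Inversion turns right into left translation, \<open>di(K.0\<^sub>k) = 0.di K = l\<^bsub>gh\<^esub> K\<close>, and
  turns \<open>\<sigma>\<^sub>k(v) - w\<close> into the defect, as it reverses the factors of \<open>w\<close>.
\<close>

lemma left_translation_basic_curvature:
  assumes gh: "(g, h) \<in> composable X"
  shows "left_translation X (g \<odot> h) (basic_curvature X H (i h) (i g) v) = lift_defect g h v"
proof -
  note g = composableD[OF gh] and ihg = i_composable[OF gh]
  have gh_in: "g \<odot> h \<in> carrier G" by (rule comp_in[OF gh])
  let ?k = "i h \<odot> i g"
  have k: "?k \<in> carrier G" "?k = i (g \<odot> h)" "i ?k = g \<odot> h" "t ?k = s (g \<odot> h)"
    using gh_in by (simp_all add: i_comp[OF gh, symmetric] i_in i_i t_i)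
  let ?x = "s (g \<odot> h)"
  have x: "?x \<in> carrier X0" by (rule s_in[OF gh_in])
  have c: "(one ?x, ?k) \<in> composable X"
    using k x by (auto intro!: composableI simp: one_in s_one)
  let ?w = "dcomp X (i h) (i g) (\<sigma> (i h) (lam (i g) v)) (\<sigma> (i g) v)"
  let ?\<psi> = "vertical_part X H ?k ?w"
  have tan: "ds (i h) (\<sigma> (i h) (lam (i g) v)) = dt (i g) (\<sigma> (i g) v)"
    using g by (simp add: ds_\<sigma> i_in lambda1_eq)
  have dsw: "ds ?k ?w = v" using ds_dcomp[OF ihg tan] g by (simp add: ds_\<sigma> i_in)
  have \<psi>: "?\<psi> \<in> algebroid X ?x" "dcomp X (one ?x) ?k ?\<psi> 0 = ?w - \<sigma> ?k v"
    using vertical_part[OF k(1), of ?w] unfolding dsw k(4) .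
  have K: "basic_curvature X H (i h) (i g) v = - ?\<psi>" by (simp add: basic_curvature_def)
  have lin1: "linear (ds (one ?x))" "linear (di (one ?x))"
    using x by (simp_all add: linear_ds linear_di one_in)
  have d\<psi>: "ds (one ?x) ?\<psi> = 0" using \<psi>(1) by (simp add: algebroid_def)
  have A: "- ?\<psi> \<in> algebroid X ?x"
    using d\<psi> by (simp add: algebroid_def linear_neg[OF lin1(1)])
  have c': "(g \<odot> h, one ?x) \<in> composable X"
    using gh_in x by (auto intro!: composableI simp: one_in t_one)
  have "left_translation X (g \<odot> h) (- ?\<psi>) = dcomp X (g \<odot> h) (one ?x) 0 (- di (one ?x) ?\<psi>)"
    using left_translation_eq[OF gh_in A] by (simp add: linear_neg[OF lin1(2)])
  also have "\<dots> = - dcomp X (g \<odot> h) (one ?x) 0 (di (one ?x) ?\<psi>)"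
    using dcomp_scaleR[OF c', of "-1" 0 "di (one ?x) ?\<psi>"] by simp
  also have "dcomp X (g \<odot> h) (one ?x) 0 (di (one ?x) ?\<psi>) = di ?k (dcomp X (one ?x) ?k ?\<psi> 0)"
  proof -
    have "one ?x \<odot> ?k = ?k" using comp_one_left[OF k(1)] k(4) by simp
    moreover have "ds (one ?x) ?\<psi> = dt ?k 0" using d\<psi> linear_0[OF linear_dt[OF k(1)]] by simp
    ultimately show ?thesis
      using di_dcomp[OF c, of ?\<psi> 0] k(3) linear_0[OF linear_di[OF k(1)]] by (simp add: i_one x)
  qed
  also have "\<dots> = di ?k ?w - di ?k (\<sigma> ?k v)"
    unfolding \<psi>(2) by (rule linear_diff[OF linear_di[OF k(1)]])
  also have "di ?k ?w = dcomp X g h (target_lift g v) (target_lift h (lam (i g) v))"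
    using di_dcomp[OF ihg tan] g by (simp add: target_lift_def i_i)
  also have "di ?k (\<sigma> ?k v) = target_lift (g \<odot> h) v"
    by (simp add: target_lift_def k(2))
  finally show ?thesis by (simp add: K lift_defect_def)
qed

text \<open>
  After expansion by additivity, the terms that contain the lift at \<open>ghk\<close>, at \<open>gh\<close> or at \<open>hk\<close> cancel in
  pairs.  The remaining two are the triple products of lifts at \<open>g\<close>, \<open>h\<close>, \<open>k\<close> with the two bracketings.
\<close>

lemma lift_defect_cocycle:
  assumes gh: "(g, h) \<in> composable X" and hk: "(h, k) \<in> composable X"
  shows "dcomp X (g \<odot> h) k (lift_defect g h v) (target_lift k (ds (g \<odot> h) (lift_defect g h v)))
      + lift_defect (g \<odot> h) k v - lift_defect g (h \<odot> k) v
      - dcomp X g (h \<odot> k) 0 (lift_defect h k (lam (i g) v)) = 0"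
proof -
  note g = composableD[OF gh] and h = composableD[OF hk]
  have gh_k: "(g \<odot> h, k) \<in> composable X" using comp_in[OF gh] h s_comp[OF gh] by (simp add: composable_def)
  have g_hk: "(g, h \<odot> k) \<in> composable X" using comp_in[OF hk] g t_comp[OF hk] by (simp add: composable_def)
  let ?v' = "lam (i g) v"
  let ?A = "target_lift (g \<odot> h) v" and ?B = "dcomp X g h (target_lift g v) (target_lift h ?v')"
  let ?A' = "target_lift k (lam (i (g \<odot> h)) v)" and ?B' = "target_lift k (lam (i h) ?v')"
  have 1: "dcomp X (g \<odot> h) k (lift_defect g h v) (target_lift k (ds (g \<odot> h) (lift_defect g h v)))
      = dcomp X (g \<odot> h) k ?A ?A' - dcomp X (g \<odot> h) k ?B ?B'"
    unfolding ds_lift_defect[OF gh] linear_diff[OF linear_target_lift[OF h(2)]]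
    unfolding lift_defect_def by (rule dcomp_diff[OF gh_k])
  have 2: "dcomp X g (h \<odot> k) 0 (lift_defect h k ?v')
      = dcomp X g (h \<odot> k) (target_lift g v) (target_lift (h \<odot> k) ?v')
        - dcomp X g (h \<odot> k) (target_lift g v) (dcomp X h k (target_lift h ?v') ?B')"
    unfolding lift_defect_def
    using dcomp_diff[OF g_hk, of "target_lift g v" "target_lift g v"] by simp
  have 3: "dcomp X (g \<odot> h) k ?B ?B' = dcomp X g (h \<odot> k) (target_lift g v) (dcomp X h k (target_lift h ?v') ?B')"
    by (rule dcomp_assoc[OF gh hk target_lift_composable[OF gh] target_lift_composable[OF hk]])
  show ?thesis
    unfolding 1 2 3 by (simp add: lift_defect_def comp_assoc[OF gh hk])
qed

lemma field_at_lift_defect: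
  assumes g: "plot_at G S z g" and h: "plot_at G S z h" and gh: "\<And>y. y \<in> S \<Longrightarrow> (g y, h y) \<in> composable X"
    and v: "field_at X0 S z (\<lambda>y. t (g y)) v"
  shows "field_at G S z (\<lambda>y. g y \<odot> h y) (\<lambda>y. lift_defect (g y) (h y) (v y))"
  unfolding lift_defect_def
proof (rule field_at_diff[OF charted_G])
  note in_G = composableD[OF gh]
  have ig: "plot_at G S z (\<lambda>y. i (g y))" by (rule plot_at_i[OF g in_G(1)])
  show "field_at G S z (\<lambda>y. g y \<odot> h y) (\<lambda>y. target_lift (g y \<odot> h y) (v y))"
    by (rule field_at_target_lift[OF plot_at_comp[OF g h gh] comp_in[OF gh]
          field_at_cong[OF charted_X0 v]]) (simp_all add: t_comp[OF gh])
  have "field_at X0 S z (\<lambda>y. s (i (g y))) v"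
    by (rule field_at_cong[OF charted_X0 v]) (simp_all add: s_i in_G)
  then have "field_at X0 S z (\<lambda>y. t (i (g y))) (\<lambda>y. lam (i (g y)) (v y))"
    by (intro field_at_lambda1[OF ig]) (simp_all add: i_in in_G)
  then have "field_at X0 S z (\<lambda>y. t (h y)) (\<lambda>y. lam (i (g y)) (v y))"
    by (rule field_at_cong[OF charted_X0]) (simp_all add: t_i in_G)
  then show "field_at G S z (\<lambda>y. g y \<odot> h y)
      (\<lambda>y. dcomp X (g y) (h y) (target_lift (g y) (v y)) (target_lift (h y) (lam (i (g y)) (v y))))"
    by (intro field_at_dcomp field_at_target_lift g h v gh in_G target_lift_composable)
qed

end


section \<open>The quasi action on the tangent bundle\<close>

locale lie_groupoid_connection_action = lie_groupoid_connection X H + lie_groupoid_action X P a act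
  for X :: "('g, 'e::model_space, 'x, 'd::model_space) groupoid" and H :: "'g \<Rightarrow> 'e set"
    and P :: "('p, 'k::model_space) manifold" and a :: "'p \<Rightarrow> 'x" and act :: "'p \<Rightarrow> 'g \<Rightarrow> 'p"
begin

abbreviation "E0 \<equiv> tangent_bundle P"
abbreviation "E1 \<equiv> pullback_bundle P a (tangent_bundle X0)"
abbreviation "tau0 p g u \<equiv> dact_at p g u (target_lift g (da p u))"
abbreviation "tau1 p g v \<equiv> lam (i g) v"
abbreviation "homotopy p g h v \<equiv> dact_at p (g \<odot> h) 0 (lift_defect g h v)"

lemma tau0_tangent: "(p, g) \<in> D \<Longrightarrow> da p u = dt g (target_lift g (da p u))"
  by (simp add: dt_target_lift domainD)

lemma da_zero: "p \<in> carrier P \<Longrightarrow> da p 0 = 0"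
  by (rule linear_0[OF linear_da])

lemma homotopy_tangent:
  "(p, g) \<in> D \<Longrightarrow> (g, h) \<in> composable X \<Longrightarrow> da p 0 = dt (g \<odot> h) (lift_defect g h v)"
  by (simp add: da_zero domainD dt_lift_defect)

lemma linear_tau0:
  assumes pg: "(p, g) \<in> D"
  shows "linear (tau0 p g)"
proof -
  note lin = linear_da[OF domainD(1)[OF pg]] linear_target_lift[OF domainD(2)[OF pg]]
  show ?thesis
    by (rule linearI)
      (simp_all add: lin[THEN linear_add] lin[THEN linear_cmul] dact_add[OF pg] dact_scaleR[OF pg])
qed

lemma linear_homotopy:
  assumes pg: "(p, g) \<in> D" and gh: "(g, h) \<in> composable X"
  shows "linear (homotopy p g h)"
proof -
  note lin = linear_lift_defect[OF gh] and D = domain_comp[OF pg gh]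
  show ?thesis
    by (rule linearI)
      (use dact_add[OF D, of 0 0] dact_scaleR[OF D, of _ 0] in \<open>simp_all add: linear_add[OF lin] linear_cmul[OF lin]\<close>)
qed

text \<open>
  The special case \<open>u = 0\<close>, \<open>(0.0).\<beta> = 0.(0.\<beta>)\<close>, of associativity.  It moves the homotopy at the point
  \<open>pg\<close> back to \<open>p\<close>.
\<close>

lemma dact_zero_translate:
  assumes pg: "(p, g) \<in> D" and gh: "(g, h) \<in> composable X" and \<beta>: "dt h \<beta> = 0"
  shows "dact_at (act p g) h 0 \<beta> = dact_at p (g \<odot> h) 0 (dcomp X g h 0 \<beta>)"
proof -
  note g = composableD[OF gh]
  have "dact_at p g 0 0 = 0" using dact_diff[OF pg, of 0 0 0 0] by simp
  then show ?thesis
    using dact_dcomp[OF pg gh, of 0 0 \<beta>] \<beta> da_zero[OF domainD(1)[OF pg]]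
    by (simp add: linear_0[OF linear_dt] linear_0[OF linear_ds] g)
qed

lemma tau0_comp:
  assumes pg: "(p, g) \<in> D" and gh: "(g, h) \<in> composable X"
  shows "tau0 p (g \<odot> h) u - tau0 (act p g) h (tau0 p g u) = homotopy p g h (da p u)"
proof -
  note g = composableD[OF gh]
  have "tau0 (act p g) h (tau0 p g u) =
      dact_at (act p g) h (tau0 p g u) (target_lift h (lam (i g) (da p u)))"
    by (simp add: da_dact[OF pg tau0_tangent[OF pg]] ds_target_lift g)
  also have "\<dots> = dact_at p (g \<odot> h) u
      (dcomp X g h (target_lift g (da p u)) (target_lift h (lam (i g) (da p u))))"
    by (rule dact_dcomp[OF pg gh tau0_tangent[OF pg] target_lift_composable[OF gh]])
  finally show ?thesis
    using dact_diff[OF domain_comp[OF pg gh], of u u] by (simp add: lift_defect_def)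
qed

text \<open>
  Every term has the form \<open>0\<^sub>p.\<beta>\<close> with \<open>\<beta>\<close> tangent at \<open>ghk\<close>, and the vectors \<open>\<beta>\<close> are the terms of
  \<open>lift_defect_cocycle\<close>.
\<close>

lemma homotopy_cocycle:
  assumes pg: "(p, g) \<in> D" and gh: "(g, h) \<in> composable X" and hk: "(h, k) \<in> composable X"
  shows "tau0 (act p (g \<odot> h)) k (homotopy p g h v) + homotopy p (g \<odot> h) k v
    - homotopy p g (h \<odot> k) v - homotopy (act p g) h k (tau1 p g v) = 0"
proof -
  note g = composableD[OF gh] and h = composableD[OF hk]
  have gh_k: "(g \<odot> h, k) \<in> composable X" using comp_in[OF gh] h s_comp[OF gh] by (simp add: composable_def)
  have g_hk: "(g, h \<odot> k) \<in> composable X" using comp_in[OF hk] g t_comp[OF hk] by (simp add: composable_def)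
  have p_gh: "(p, g \<odot> h) \<in> D" by (rule domain_comp[OF pg gh])
  let ?q = "g \<odot> (h \<odot> k)" and ?\<delta> = "lift_defect g h v"
  have q: "(p, ?q) \<in> D" by (rule domain_comp[OF pg g_hk])
  note tan = homotopy_tangent[OF pg gh]
  have 1: "tau0 (act p (g \<odot> h)) k (homotopy p g h v) =
      dact_at p ?q 0 (dcomp X (g \<odot> h) k ?\<delta> (target_lift k (ds (g \<odot> h) ?\<delta>)))"
    unfolding da_dact[OF p_gh tan]
    using dact_dcomp[OF p_gh gh_k tan] h s_comp[OF gh] comp_in[OF gh]
    by (simp add: dt_target_lift comp_assoc[OF gh hk])
  have 2: "homotopy (act p g) h k (tau1 p g v) =
      dact_at p ?q 0 (dcomp X g (h \<odot> k) 0 (lift_defect h k (lam (i g) v)))"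
    by (rule dact_zero_translate[OF pg g_hk dt_lift_defect[OF hk]])
  have 3: "homotopy p (g \<odot> h) k v = dact_at p ?q 0 (lift_defect (g \<odot> h) k v)"
    by (simp add: comp_assoc[OF gh hk])
  have add: "dact_at p ?q 0 \<beta> + dact_at p ?q 0 \<beta>' = dact_at p ?q 0 (\<beta> + \<beta>')"
    and diff: "dact_at p ?q 0 \<beta> - dact_at p ?q 0 \<beta>' = dact_at p ?q 0 (\<beta> - \<beta>')" for \<beta> \<beta>'
    using dact_add[OF q, of 0 0] dact_diff[OF q, of 0 0] by simp_all
  show ?thesis
    unfolding 1 2 3 add diff lift_defect_cocycle[OF gh hk] using diff[of 0 0] by simp
qed

lemma E0_eq: "E0 = pullback_bundle P (\<lambda>p. p) (tangent_bundle P)"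
  by (rule tangent_bundle_eq_pullback[OF charted_P])

lemmas E0_facts = charted_P charted_P smooth_map_id[OF charted_P]
  and E1_facts = charted_P charted_X0 smooth_a

lemma carrier_E0: "carrier (total_space P E0) = carrier P \<times> UNIV"
  and carrier_E1: "carrier (total_space P E1) = carrier P \<times> UNIV"
  by (simp_all add: total_space_def)

lemma chart_cover_E0: "chart_cover (total_space P E0)"
  using chart_cover_total_space[OF E0_facts] by (simp only: E0_eq[symmetric])

lemma chart_cover_E1: "chart_cover (total_space P E1)"
  by (rule chart_cover_total_space[OF E1_facts])

lemma
  assumes "plot_at (total_space P E0) S z q"
  shows plot_at_E0_base: "plot_at P S z (\<lambda>y. fst (q y))"
    and field_at_E0: "field_at P S z (\<lambda>y. fst (q y)) (\<lambda>y. snd (q y))"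
  using plot_at_total_spaceD[OF E0_facts, folded E0_eq, OF assms] .

lemma
  assumes "plot_at (total_space P E1) S z q"
  shows plot_at_E1_base: "plot_at P S z (\<lambda>y. fst (q y))"
    and field_at_E1: "field_at X0 S z (\<lambda>y. a (fst (q y))) (\<lambda>y. snd (q y))"
  using plot_at_total_spaceD[OF E1_facts assms] .

lemma plot_at_E0I: "field_at P S z p u \<Longrightarrow> plot_at (total_space P E0) S z (\<lambda>y. (p y, u y))"
  by (rule plot_at_total_spaceI[OF E0_facts, folded E0_eq, OF field_at_imp_plot_at])

lemma plot_at_E1I:
  "plot_at P S z p \<Longrightarrow> field_at X0 S z (\<lambda>y. a (p y)) v \<Longrightarrow> plot_at (total_space P E1) S z (\<lambda>y. (p y, v y))"
  by (rule plot_at_total_spaceI[OF E1_facts])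

lemma plot_at_act:
  assumes "plot_at P S z p" "plot_at G S z g" "\<And>y. y \<in> S \<Longrightarrow> (p y, g y) \<in> D"
  shows "plot_at P S z (\<lambda>y. act (p y) (g y))"
  using plot_at_smooth_map[OF charted_space_prod[OF charted_P charted_G] charted_P smooth_act
      plot_at_Pair[OF assms(1,2)]] assms(3) by simp

lemma field_at_da:
  assumes u: "field_at P S z p u" and p: "\<And>y. y \<in> S \<Longrightarrow> p y \<in> carrier P"
  shows "field_at X0 S z (\<lambda>y. a (p y)) (\<lambda>y. da (p y) (u y))"
  by (rule field_at_differential[OF charted_P charted_X0 smooth_a u])
    (blast intro: p tangent_to_carrier[OF charted_P p])

lemma quasi_action_tau0: "quasi_action X P a act E0 tau0"
  unfolding quasi_action_def
proof (intro conjI ballI)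
  let ?S = "{((p, e), g). (p, g) \<in> D} :: (('p \<times> 'k) \<times> 'g) set"
  show "smooth_map_on (total_space P E0 \<times>\<^sub>M\<^sub>f G) (total_space P E0) ?S (\<lambda>((p, e), g). (act p g, tau0 p g e))"
  proof (rule smooth_map_onI_plots)
    show "?S \<subseteq> carrier (total_space P E0 \<times>\<^sub>M\<^sub>f G)"
      by (auto simp: carrier_E0 dest: domainD)
    show "(\<lambda>((p, e), g). (act p g, tau0 p g e)) ` ?S \<subseteq> carrier (total_space P E0)"
      by (auto simp: carrier_E0 intro: act_in)
    show "chart_cover (total_space P E0 \<times>\<^sub>M\<^sub>f G)"
      by (intro chart_cover_prod chart_cover_E0 charted_space_imp_chart_cover charted_G)
    fix S :: "(('k \<times> 'k) \<times> 'e) set" and z and q :: "('k \<times> 'k) \<times> 'e \<Rightarrow> ('p \<times> 'k) \<times> 'g"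
    assume q: "plot_at (total_space P E0 \<times>\<^sub>M\<^sub>f G) S z q" and S: "\<And>y. y \<in> S \<Longrightarrow> q y \<in> ?S"
    let ?p = "\<lambda>y. fst (fst (q y))" and ?u = "\<lambda>y. snd (fst (q y))" and ?g = "\<lambda>y. snd (q y)"
    have dom: "(?p y, ?g y) \<in> D" if "y \<in> S" for y using S[OF that] by auto
    have u: "field_at P S z ?p ?u" by (rule field_at_E0[OF plot_at_fst[OF q]])
    have g: "plot_at G S z ?g" by (rule plot_at_snd[OF q])
    have "field_at X0 S z (\<lambda>y. t (?g y)) (\<lambda>y. da (?p y) (?u y))"
      by (rule field_at_cong[OF charted_X0 field_at_da[OF u domainD(1)[OF dom]]])
        (simp_all add: domainD(3)[OF dom])
    from field_at_target_lift[OF g domainD(2)[OF dom] this]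
    have "field_at P S z (\<lambda>y. act (?p y) (?g y)) (\<lambda>y. tau0 (?p y) (?g y) (?u y))"
      by (intro field_at_dact[OF u]) (simp_all add: dom tau0_tangent[OF dom, symmetric])
    then show "plot_at (total_space P E0) S z (\<lambda>y. (\<lambda>((p, e), g). (act p g, tau0 p g e)) (q y))"
      using plot_at_E0I by (simp add: case_prod_beta)
  qed
  show "case x of (p, g) \<Rightarrow> linear (tau0 p g)" if "x \<in> D" for x
    using that linear_tau0 by auto
  show "tau0 p (one (a p)) = id" if "p \<in> carrier P" for p
    using dact_one[OF that] by (auto simp: target_lift_one a_in that)
qed

lemma quasi_action_tau1: "quasi_action X P a act E1 tau1"
  unfolding quasi_action_def
proof (intro conjI ballI)
  let ?S = "{((p, e), g). (p, g) \<in> D} :: (('p \<times> 'd) \<times> 'g) set"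
  show "smooth_map_on (total_space P E1 \<times>\<^sub>M\<^sub>f G) (total_space P E1) ?S (\<lambda>((p, e), g). (act p g, tau1 p g e))"
  proof (rule smooth_map_onI_plots)
    show "?S \<subseteq> carrier (total_space P E1 \<times>\<^sub>M\<^sub>f G)"
      by (auto simp: carrier_E1 dest: domainD)
    show "(\<lambda>((p, e), g). (act p g, tau1 p g e)) ` ?S \<subseteq> carrier (total_space P E1)"
      by (auto simp: carrier_E1 intro: act_in)
    show "chart_cover (total_space P E1 \<times>\<^sub>M\<^sub>f G)"
      by (intro chart_cover_prod chart_cover_E1 charted_space_imp_chart_cover charted_G)
    fix S :: "(('k \<times> 'd) \<times> 'e) set" and z and q :: "('k \<times> 'd) \<times> 'e \<Rightarrow> ('p \<times> 'd) \<times> 'g"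
    assume q: "plot_at (total_space P E1 \<times>\<^sub>M\<^sub>f G) S z q" and S: "\<And>y. y \<in> S \<Longrightarrow> q y \<in> ?S"
    let ?p = "\<lambda>y. fst (fst (q y))" and ?v = "\<lambda>y. snd (fst (q y))" and ?g = "\<lambda>y. snd (q y)"
    have dom: "(?p y, ?g y) \<in> D" if "y \<in> S" for y using S[OF that] by auto
    have v: "field_at X0 S z (\<lambda>y. a (?p y)) ?v" by (rule field_at_E1[OF plot_at_fst[OF q]])
    have p: "plot_at P S z ?p" by (rule plot_at_E1_base[OF plot_at_fst[OF q]])
    have g: "plot_at G S z ?g" by (rule plot_at_snd[OF q])
    have "field_at X0 S z (\<lambda>y. s (i (?g y))) ?v"
      by (rule field_at_cong[OF charted_X0 v]) (simp_all add: domainD[OF dom] s_i)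
    then have "field_at X0 S z (\<lambda>y. t (i (?g y))) (\<lambda>y. lam (i (?g y)) (?v y))"
      by (intro field_at_lambda1 plot_at_i g) (simp_all add: domainD[OF dom] i_in)
    then have "field_at X0 S z (\<lambda>y. a (act (?p y) (?g y))) (\<lambda>y. tau1 (?p y) (?g y) (?v y))"
      by (rule field_at_cong[OF charted_X0]) (simp_all add: domainD[OF dom] t_i a_act[OF dom])
    then show "plot_at (total_space P E1) S z (\<lambda>y. (\<lambda>((p, e), g). (act p g, tau1 p g e)) (q y))"
      using plot_at_E1I[OF plot_at_act[OF p g dom]] by (simp add: case_prod_beta)
  qed
  show "case x of (p, g) \<Rightarrow> linear (tau1 p g)" if "x \<in> D" for x
    using that linear_lambda1[OF i_in] domainD by auto
  show "tau1 p (one (a p)) = id" if "p \<in> carrier P" for p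
    using a_in[OF that] by (auto simp: i_one lambda1_one)
qed

lemma smooth_anchor_differential: "smooth_map (total_space P E0) (total_space P E1) (\<lambda>(p, e). (p, da p e))"
proof (rule smooth_map_onI_plots)
  fix S :: "('k \<times> 'k) set" and z and q :: "'k \<times> 'k \<Rightarrow> 'p \<times> 'k"
  assume q: "plot_at (total_space P E0) S z q" and S: "\<And>y. y \<in> S \<Longrightarrow> q y \<in> carrier (total_space P E0)"
  have "fst (q y) \<in> carrier P" if "y \<in> S" for y using S[OF that] by (auto simp: carrier_E0)
  from plot_at_E1I[OF plot_at_E0_base[OF q] field_at_da[OF field_at_E0[OF q] this]]
  show "plot_at (total_space P E1) S z (\<lambda>y. case q y of (p, e) \<Rightarrow> (p, da p e))"
    by (simp add: case_prod_beta)
qed (auto simp: carrier_E0 carrier_E1 chart_cover_E0)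

lemma smooth_homotopy:
  "smooth_map_on (total_space P E1 \<times>\<^sub>M\<^sub>f (G \<times>\<^sub>M\<^sub>f G)) (total_space P E0)
       {((p, e), (g, h)). (p, g) \<in> D \<and> (g, h) \<in> composable X}
       (\<lambda>((p, e), (g, h)). (act p (g \<odot> h), homotopy p g h e))"
  (is "smooth_map_on _ _ ?S _")
proof (rule smooth_map_onI_plots)
  show "?S \<subseteq> carrier (total_space P E1 \<times>\<^sub>M\<^sub>f (G \<times>\<^sub>M\<^sub>f G))"
    by (auto simp: carrier_E1 dest: domainD composableD)
  show "(\<lambda>((p, e), (g, h)). (act p (g \<odot> h), homotopy p g h e)) ` ?S \<subseteq> carrier (total_space P E0)"
    by (auto simp: carrier_E0 intro!: act_in domain_comp)
  show "chart_cover (total_space P E1 \<times>\<^sub>M\<^sub>f (G \<times>\<^sub>M\<^sub>f G))"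
    by (intro chart_cover_prod chart_cover_E1 charted_space_imp_chart_cover charted_G)
  fix S :: "(('k \<times> 'd) \<times> ('e \<times> 'e)) set" and z and q :: "('k \<times> 'd) \<times> ('e \<times> 'e) \<Rightarrow> ('p \<times> 'd) \<times> ('g \<times> 'g)"
  assume q: "plot_at (total_space P E1 \<times>\<^sub>M\<^sub>f (G \<times>\<^sub>M\<^sub>f G)) S z q" and S: "\<And>y. y \<in> S \<Longrightarrow> q y \<in> ?S"
  let ?p = "\<lambda>y. fst (fst (q y))" and ?v = "\<lambda>y. snd (fst (q y))"
    and ?g = "\<lambda>y. fst (snd (q y))" and ?h = "\<lambda>y. snd (snd (q y))"
  have dom: "(?p y, ?g y) \<in> D" and com: "(?g y, ?h y) \<in> composable X" if "y \<in> S" for y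
    using S[OF that] by auto
  have v: "field_at X0 S z (\<lambda>y. a (?p y)) ?v" by (rule field_at_E1[OF plot_at_fst[OF q]])
  have p: "plot_at P S z ?p" by (rule plot_at_E1_base[OF plot_at_fst[OF q]])
  have g: "plot_at G S z ?g" and h: "plot_at G S z ?h"
    using plot_at_fst[OF plot_at_snd[OF q]] plot_at_snd[OF plot_at_snd[OF q]] .
  have "field_at X0 S z (\<lambda>y. t (?g y)) ?v"
    by (rule field_at_cong[OF charted_X0 v]) (simp_all add: domainD[OF dom])
  from field_at_lift_defect[OF g h com this]
  have "field_at P S z (\<lambda>y. act (?p y) (?g y \<odot> ?h y)) (\<lambda>y. homotopy (?p y) (?g y) (?h y) (?v y))"
    by (intro field_at_dact field_at_zero[OF charted_P p] domain_comp[OF dom com] homotopy_tangent[OF dom com])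
  then show "plot_at (total_space P E0) S z
      (\<lambda>y. (\<lambda>((p, e), (g, h)). (act p (g \<odot> h), homotopy p g h e)) (q y))"
    using plot_at_E0I by (simp add: case_prod_beta)
qed

text \<open>
  The homotopy is determined on composable pairs only, where it is given by the left translated basic
  curvature and by the lift defect; elsewhere \<open>\<Upsilon>\<close> is arbitrary.
\<close>

lemma quasi_equivariant:
  assumes \<Upsilon>: "\<And>p g h v. (g, h) \<in> composable X \<Longrightarrow> \<Upsilon> p g h v = homotopy p g h v"
  shows "quasi_equivariant_bundle X P a act E0 E1 tau0 tau1 da \<Upsilon>"
  unfolding quasi_equivariant_bundle_def
proof (intro conjI allI impI ballI; (elim conjE)?)
  show "right_action X P a act" by (rule action)
  show "vector_bundle P E0"
    by (rule vector_bundle_pulled_back_tangent[OF E0_facts, folded E0_eq])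
  show "vector_bundle P E1" by (rule vector_bundle_pulled_back_tangent[OF E1_facts])
  show "smooth_map_on (total_space P E1 \<times>\<^sub>M\<^sub>f (G \<times>\<^sub>M\<^sub>f G)) (total_space P E0)
       {((p, e), (g, h)). (p, g) \<in> D \<and> (g, h) \<in> composable X}
       (\<lambda>((p, e), (g, h)). (act p (g \<odot> h), \<Upsilon> p g h e))"
    by (rule smooth_map_on_cong[OF smooth_homotopy]) (auto simp: \<Upsilon>)
  show "da (act p g) (tau0 p g e) = tau1 p g (da p e)" if "(p, g) \<in> D" for p g e
    using that by (simp add: da_dact[OF that tau0_tangent[OF that]] ds_target_lift domainD)
  show "tau1 p (g \<odot> h) e - tau1 (act p g) h (tau1 p g e) = da (act p (g \<odot> h)) (\<Upsilon> p g h e)"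
    if "(p, g) \<in> D" "(g, h) \<in> composable X" for p g h e
    by (simp add: \<Upsilon>[OF that(2)] da_dact[OF domain_comp[OF that] homotopy_tangent[OF that]]
        ds_lift_defect[OF that(2)])
  fix p g h assume pg: "(p, g) \<in> D" and gh: "(g, h) \<in> composable X"
  show "linear (\<Upsilon> p g h)"
    using linear_homotopy[OF pg gh] by (simp add: \<Upsilon>[OF gh, abs_def])
  show "tau0 p (g \<odot> h) u - tau0 (act p g) h (tau0 p g u) = \<Upsilon> p g h (da p u)" for u
    using tau0_comp[OF pg gh] by (simp add: \<Upsilon>[OF gh])
  fix k assume hk: "(h, k) \<in> composable X"
  have gh_k: "(g \<odot> h, k) \<in> composable X" and g_hk: "(g, h \<odot> k) \<in> composable X"
    using gh hk comp_in[OF gh] comp_in[OF hk] s_comp[OF gh] t_comp[OF hk] by (auto simp: composable_def)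
  show "tau0 (act p (g \<odot> h)) k (\<Upsilon> p g h v) + \<Upsilon> p (g \<odot> h) k v - \<Upsilon> p g (h \<odot> k) v
      - \<Upsilon> (act p g) h k (tau1 p g v) = 0" for v
    using homotopy_cocycle[OF pg gh hk, of v] by (simp add: \<Upsilon>[OF gh] \<Upsilon>[OF hk] \<Upsilon>[OF gh_k] \<Upsilon>[OF g_hk])
qed (fact quasi_action_tau0 quasi_action_tau1 smooth_anchor_differential linear_da)+

end

theorem proposition9:
  fixes X :: "('g, 'e::model_space, 'x, 'd::model_space) groupoid"
    and H :: "'g \<Rightarrow> 'e set"
    and P :: "('p, 'k::model_space) manifold"
    and M :: "('m, 'l::model_space) manifold"
    and \<pi> :: "'p \<Rightarrow> 'm"
    and a :: "'p \<Rightarrow> 'x"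
    and act :: "'p \<Rightarrow> 'g \<Rightarrow> 'p"
  assumes "lie_groupoid X"
    and "ehresmann_connection X H"
    and "principal_bundle X P M \<pi> a act"
  defines "\<xi> \<equiv> (\<lambda>p. differential P (objects X) a p)"
    and "\<tau>0 \<equiv> (\<lambda>p g u.
      dact X P a act p g u
        (differential (arrows X) (arrows X) (ginv X) (ginv X g)
          (horizontal_lift X H (ginv X g) (differential P (objects X) a p u))))"
    and "\<tau>1 \<equiv> (\<lambda>(p::'p) g v. lambda1 X H (ginv X g) v)"
    and "\<Upsilon> \<equiv> (\<lambda>p g h v.
      dact X P a act p (gcomp X g h) 0
        (left_translation X (gcomp X g h) (basic_curvature X H (ginv X h) (ginv X g) v)))"
  shows "quasi_equivariant_bundle X P a act
           (tangent_bundle P) (pullback_bundle P a (tangent_bundle (objects X)))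
           \<tau>0 \<tau>1 \<xi> \<Upsilon>"
proof -
  interpret lie_groupoid_connection_action X H P a act
    using assms(1-3) by unfold_locales (auto simp: principal_bundle_def)
  have "\<Upsilon> p g h v = homotopy p g h v" if "(g, h) \<in> composable X" for p g h v
    by (simp add: \<Upsilon>_def left_translation_basic_curvature[OF that])
  then show ?thesis
    unfolding \<tau>0_def \<tau>1_def \<xi>_def by (rule quasi_equivariant[unfolded target_lift_def])
qed

end
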